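(* Let $\sigma^2:=16\log 2-10$. There exists a constant $C\in[0,\infty)$ such that for all $t\in(0,\infty)$, \[ \sup_{x\in\mathbb R}\left|\Pr\left(\sqrt{\frac{2t}{\sigma^2}}\left(N_t-\frac{2}{t}\right)\le x\right)-\Phi(x)\right|\le C\sqrt t. \]
   Context: Kakutani's interval-splitting process: let $U_1,U_2,\dots$ be i.i.d. uniform random variables on $[0,1]$. At time $0$ the partition of $[0,1]$ consists of the single interval $[0,1]$. Given the partition at time $n\in\mathbb Z_+$ (which consists of $n+1$ intervals, whose lengths are a.s. distinct), let $[a,b]$ be the interval of maximal length; the partition at time $n+1$ is obtained by replacing $[a,b]$ by the two intervals $[a,a+U_{n+1}(b-a)]$ and $[a+U_{n+1}(b-a),b]$. Write $L_{n,1},\dots,L_{n,n+1}$ for the interval lengths at time $n$ and $M_n:=\max_i L_{n,i}$. For $t\in(0,\infty)$ define the threshold time $N_t:=\inf\{n\in\mathbb Z_+: M_n\le t\}$. $\Phi$ is the standard normal distribution function. *)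

theory Defs
  imports "HOL-Probability.Probability"
begin

text \<open>Intervals are represented as pairs (a,b) standing for [a,b]; a partition is a list of intervals.\<close>

definition ilen :: "real \<times> real \<Rightarrow> real" where
  "ilen I = snd I - fst I"

definition maxlen :: "(real \<times> real) list \<Rightarrow> real" where
  "maxlen P = Max (ilen ` set P)"

definition kak_step :: "real \<Rightarrow> (real \<times> real) list \<Rightarrow> (real \<times> real) list" where
  "kak_step u P =
     (let I = hd (filter (\<lambda>J. ilen J = maxlen P) P); a = fst I; b = snd I
      in remove1 I P @ [(a, a + u * (b - a)), (a + u * (b - a), b)])"

text \<open>Partition at time n; the sequence u is indexed from 0, so u n plays the role of U_(n+1).\<close>
primrec kak_partition :: "(nat \<Rightarrow> real) \<Rightarrow> nat \<Rightarrow> (real \<times> real) list" where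
  "kak_partition u 0 = [(0, 1)]"
| "kak_partition u (Suc n) = kak_step (u n) (kak_partition u n)"

definition kak_M :: "(nat \<Rightarrow> real) \<Rightarrow> nat \<Rightarrow> real" where
  "kak_M u n = maxlen (kak_partition u n)"

definition kak_N :: "(nat \<Rightarrow> real) \<Rightarrow> real \<Rightarrow> nat" where
  "kak_N u t = (LEAST n. kak_M u n \<le> t)"

definition Phi :: "real \<Rightarrow> real" where
  "Phi x = (LBINT y:{..x}. std_normal_density y)"

definition kak_sigma2 :: real where
  "kak_sigma2 = 16 * ln 2 - 10"

end

(*
  Put x = 1 / t and let Y be the number N_t + 1 of intervals at the threshold time. With w = exp (i s), let psi
  solve psi x = w for x <= 1 and psi x = the integral of psi (x u) psi (x (1 - u)) over u in [0, 1] for x > 1. The product of psi over the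
  current (rescaled) intervals is a bounded martingale up to the threshold time, so E w^Y = psi (1 / t).

  For x > 1 the equation is solved exactly by exponentials exp (c x). Hence
  theta x = exp (- 2 i s x + v s^2 x / 2) psi x, with v = 8 ln 2 - 5, satisfies the same equation. An explicit
  second order expansion tau in s solves it up to O(|s|^3), with tau = 1 for x > 2, and comparison with an exponential
  supersolution shows |theta x - 1| <= K |s|^3 x exp (K |s|^3 x) for small s and x > 2. Thus E w^Y is close to the
  characteristic function of a normal variable for |s| <= s_1, and Esseen's smoothing inequality turns this into the
  rate sqrt t.
*)
theory Submission
  imports Defs
begin

section \<open>Integration against the uniform law\<close>

text \<open>The rate dictates the size of every error. Where the Gaussian factor matters, s^2 x is
  of order 1, so an error |s|^3 x costs one power of |s|, which the smoothing inequality can afford.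
  But the boundary value w on x <= 1 differs from the exponentials by order s, and a comparison
  started from there would lose the rate; \<open>kak_tau\<close> first removes the terms of order s
  and s^2. It ends at x = 2 for two reasons: its source term needs both children of relative length
  at most 1, and \<open>kv\<close> is the one number for which the second order term then averages
  to zero over [0, 2]. The cutoff also tames the cross terms between \<open>kak_tau\<close> and the
  error: for large x a child lands below 2 only with probability of order 1 / x. The N_t + 1
  intervals are counted, rather than the N_t splits, because their number is additive over the two
  parts of a split interval; the shift by 1 costs a factor exp (- i s). For the normalisation,
  \<open>kak_sigma2\<close> is twice \<open>kv\<close>.\<close>

lemma norm_integral_le_integral:
  fixes f :: "'a \<Rightarrow> 'b::{banach, second_countable_topology}"
  assumes "integrable M f" "integrable M g" "\<And>x. x \<in> space M \<Longrightarrow> norm (f x) \<le> g x"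
  shows "norm (\<integral>x. f x \<partial>M) \<le> (\<integral>x. g x \<partial>M)"
  using integral_norm_bound[of M f] integral_mono[OF integrable_norm[OF assms(1)] assms(2,3)]
  by linarith

abbreviation unif :: "real measure" where
  "unif \<equiv> uniform_measure lborel {0..1}"

lemma unif_eq_density: "unif = density lborel (\<lambda>x. ennreal (indicator {0..1} x))"
  unfolding uniform_measure_def by (intro density_cong) (auto simp: indicator_def divide_ennreal_def)

lemma prob_space_unif: "prob_space unif"
  by (rule prob_space_uniform_measure) auto

interpretation unif: prob_space unif by (rule prob_space_unif)

lemma sets_unif [measurable_cong, simp]: "sets unif = sets borel"
  by simp

lemma AE_unif: "AE x in unif. 0 \<le> x \<and> x \<le> 1"
  by (rule AE_uniform_measureI) auto

lemma integral_unif_has_integral: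
  fixes f :: "real \<Rightarrow> real"
  assumes "(f has_integral I) {0..1}" and f: "f \<in> borel_measurable borel"
    and "\<And>x. 0 \<le> x \<Longrightarrow> x \<le> 1 \<Longrightarrow> \<bar>f x\<bar> \<le> B"
  shows "(\<integral>x. f x \<partial>unif) = I" "integrable unif f"
proof -
  have "AE x in unif. norm (f x) \<le> B" using AE_unif by eventually_elim (use assms in auto)
  then show int: "integrable unif f"
    by (rule unif.integrable_const_bound) (use f in simp)
  have "integrable lborel (\<lambda>x. indicator {0..1} x *\<^sub>R f x)"
    using int f unfolding unif_eq_density by (subst (asm) integrable_density) auto
  then have "set_integrable lborel {0..1} f" by (simp add: set_integrable_def)
  from set_borel_integral_eq_integral(2)[OF this] assms(1)
  have "(LINT x:{0..1}|lborel. f x) = I" by (simp add: integral_unique)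
  then show "(\<integral>x. f x \<partial>unif) = I"
    unfolding unif_eq_density using f by (subst integral_density) (auto simp: set_lebesgue_integral_def)
qed

lemma distr_unif_reflect: "distr unif borel (\<lambda>u. 1 - u) = unif"
proof (rule measure_eqI)
  fix A :: "real set" assume "A \<in> sets (distr unif borel (\<lambda>u. 1 - u))"
  then have A [measurable]: "A \<in> sets borel" by simp
  have "emeasure (distr unif borel (\<lambda>u. 1 - u)) A = (\<integral>\<^sup>+x. ennreal (indicator {0..1} x) * indicator A (1 - x) \<partial>lborel)"
  proof -
    have "(\<lambda>u. 1 - u) -` A \<in> sets borel" by (rule measurable_sets_borel[OF _ A]) simp
    then show ?thesis
      by (subst emeasure_distr)
         (auto simp: unif_eq_density emeasure_density intro!: nn_integral_cong split: split_indicator)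
  qed
  also have "\<dots> = (\<integral>\<^sup>+x. ennreal (indicator {0..1} x) * indicator A x \<partial>lborel)"
    by (subst nn_integral_real_affine[where c="-1" and t=1])
       (auto intro!: nn_integral_cong split: split_indicator)
  also have "\<dots> = emeasure unif A"
    by (simp add: unif_eq_density emeasure_density)
  finally show "emeasure (distr unif borel (\<lambda>u. 1 - u)) A = emeasure unif A" .
qed simp

lemma integral_unif_reflect:
  fixes f :: "real \<Rightarrow> 'b::{banach, second_countable_topology}"
  assumes "f \<in> borel_measurable borel"
  shows "(\<integral>u. f (1 - u) \<partial>unif) = (\<integral>u. f u \<partial>unif)"
  by (subst (2) distr_unif_reflect[symmetric], subst integral_distr) (use assms in auto)

lemma integrable_unif_bounded:
  fixes f :: "real \<Rightarrow> 'b::{banach, second_countable_topology}"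
  assumes "f \<in> borel_measurable borel" "\<And>u. 0 \<le> u \<Longrightarrow> u \<le> 1 \<Longrightarrow> norm (f u) \<le> B"
  shows "integrable unif f"
proof -
  have "AE u in unif. norm (f u) \<le> B" using AE_unif by eventually_elim (use assms in auto)
  then show ?thesis by (rule unif.integrable_const_bound) (use assms(1) in simp)
qed

lemma integral_unif_mono:
  fixes f g :: "real \<Rightarrow> real"
  assumes "integrable unif f" "integrable unif g" "\<And>u. 0 \<le> u \<Longrightarrow> u \<le> 1 \<Longrightarrow> f u \<le> g u"
  shows "(\<integral>u. f u \<partial>unif) \<le> (\<integral>u. g u \<partial>unif)"
proof (rule integral_mono_AE[OF assms(1,2)])
  show "AE u in unif. f u \<le> g u" using AE_unif by eventually_elim (use assms(3) in auto)
qed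

lemma norm_integral_unif_le:
  fixes f :: "real \<Rightarrow> 'b::{banach, second_countable_topology}"
  assumes "integrable unif f" "integrable unif g" "\<And>u. 0 \<le> u \<Longrightarrow> u \<le> 1 \<Longrightarrow> norm (f u) \<le> g u"
  shows "norm (\<integral>u. f u \<partial>unif) \<le> (\<integral>u. g u \<partial>unif)"
  using integral_norm_bound[of unif f] integral_unif_mono[OF integrable_norm[OF assms(1)] assms(2,3)]
  by linarith

lemma integral_unif_const [simp]: "(\<integral>u. c \<partial>unif) = (c :: 'b::{banach, second_countable_topology})"
  using unif.prob_space by simp

text \<open>The average over u is a mean over [0, x]. The finite exceptional set \<open>S\<close>
  admits piecewise integrands such as \<open>kak_a\<close> and \<open>kak_b\<close>, provided one
  continuous primitive serves all pieces.\<close>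

lemma integral_unif_scale:
  fixes g G :: "real \<Rightarrow> real"
  assumes x: "x > 0" and S: "finite S"
    and deriv: "\<And>y. 0 < y \<Longrightarrow> y < x \<Longrightarrow> y \<notin> S \<Longrightarrow> (G has_real_derivative g y) (at y)"
    and cont: "continuous_on {0..x} G" and g [measurable]: "g \<in> borel_measurable borel"
    and bound: "\<And>y. 0 \<le> y \<Longrightarrow> y \<le> x \<Longrightarrow> \<bar>g y\<bar> \<le> B"
  shows "(\<integral>u. g (x * u) \<partial>unif) = (G x - G 0) / x"
proof -
  let ?F = "\<lambda>u. G (x * u) / x"
  have "((\<lambda>u. g (x * u)) has_integral (?F 1 - ?F 0)) {0..1}"
  proof (rule fundamental_theorem_of_calculus_interior_strong[of "(\<lambda>y. y / x) ` S"])
    show "finite ((\<lambda>y. y / x) ` S)" using S by simp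
    show "(?F has_vector_derivative g (x * u)) (at u)" if u: "u \<in> {0<..<1} - (\<lambda>y. y / x) ` S" for u
    proof -
      have "x * u \<notin> S" using u x by (force simp: field_simps)
      then have "(G has_real_derivative g (x * u)) (at (x * u))"
        using u x by (intro deriv) auto
      then have "((\<lambda>u. G (x * u)) has_real_derivative g (x * u) * x) (at u)"
        by (rule DERIV_chain2) (auto intro!: derivative_eq_intros)
      from DERIV_cdivide[OF this, of x] show ?thesis
        using x by (simp add: has_real_derivative_iff_has_vector_derivative)
    qed
    have "continuous_on {0..1} (\<lambda>u. G (x * u))"
      using x by (intro continuous_on_compose2[OF cont] continuous_intros) (auto simp: mult_left_le)
    then show "continuous_on {0..1} ?F" using x by (intro continuous_intros) auto
  qed simp
  then have "(\<integral>u. g (x * u) \<partial>unif) = ?F 1 - ?F 0"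
    by (rule integral_unif_has_integral(1)[where B=B]) (use x bound in \<open>auto simp: mult_left_le\<close>)
  then show ?thesis by (simp add: diff_divide_distrib)
qed

lemma integral_unif_abs_power: "(\<integral>u. \<bar>u\<bar> ^ k \<partial>unif) = 1 / real (Suc k)"
  and integrable_unif_abs_power: "integrable unif (\<lambda>u. \<bar>u\<bar> ^ k)"
  and integral_unif_abs_power': "(\<integral>u. \<bar>1 - u\<bar> ^ k \<partial>unif) = 1 / real (Suc k)"
  and integrable_unif_abs_power': "integrable unif (\<lambda>u. \<bar>1 - u\<bar> ^ k)"
proof -
  have "(\<integral>u. \<bar>1 * u\<bar> ^ k \<partial>unif) = (1 ^ Suc k / real (Suc k) - 0 ^ Suc k / real (Suc k)) / 1"
    by (rule integral_unif_scale[where S="{}" and G="\<lambda>u. u ^ Suc k / real (Suc k)" and B=1])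
       (auto intro!: derivative_eq_intros continuous_intros power_le_one simp del: power_Suc)
  then show 1: "(\<integral>u. \<bar>u\<bar> ^ k \<partial>unif) = 1 / real (Suc k)" by simp
  then show "(\<integral>u. \<bar>1 - u\<bar> ^ k \<partial>unif) = 1 / real (Suc k)"
    using integral_unif_reflect[of "\<lambda>u. \<bar>u\<bar> ^ k"] by simp
  show "integrable unif (\<lambda>u. \<bar>u\<bar> ^ k)" "integrable unif (\<lambda>u. \<bar>1 - u\<bar> ^ k)"
    by (rule integrable_unif_bounded[of _ 1]; auto intro!: power_le_one)+
qed

lemma integral_unif_two_powers:
  "(\<integral>u. c * \<bar>u\<bar> ^ k + c * \<bar>1 - u\<bar> ^ k \<partial>unif) = c * (1 / real (Suc k)) + c * (1 / real (Suc k))"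
proof -
  have 1: "integrable unif (\<lambda>u. c * \<bar>u\<bar> ^ k)" "integrable unif (\<lambda>u. c * \<bar>1 - u\<bar> ^ k)"
    by (intro integrable_mult_right integrable_unif_abs_power integrable_unif_abs_power')+
  show ?thesis
    unfolding Bochner_Integration.integral_add[OF 1] integral_mult_right_zero
      integral_unif_abs_power integral_unif_abs_power' ..
qed

section \<open>A smoothing inequality of Esseen type\<close>

lemma fubini_bounded:
  fixes f :: "'a \<Rightarrow> 'b \<Rightarrow> 'c::{banach, second_countable_topology}"
  assumes "finite_measure M1" "finite_measure M2"
    and m: "case_prod f \<in> borel_measurable (M1 \<Otimes>\<^sub>M M2)" and b: "\<And>x y. norm (f x y) \<le> B"
  shows "(\<integral>x. (\<integral>y. f x y \<partial>M2) \<partial>M1) = (\<integral>y. (\<integral>x. f x y \<partial>M1) \<partial>M2)"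
proof -
  interpret M1: finite_measure M1 by fact
  interpret M2: finite_measure M2 by fact
  interpret P: pair_sigma_finite M1 M2 ..
  interpret PP: finite_measure "M1 \<Otimes>\<^sub>M M2" by (rule finite_measure_pair_measure) fact+
  have "integrable (M1 \<Otimes>\<^sub>M M2) (case_prod f)"
    by (rule PP.integrable_const_bound[of _ B]) (use m b in auto)
  from P.Fubini_integral[OF this] show ?thesis by simp
qed

text \<open>The primitive exp (i t y) / (i t) has modulus 1 / |t| at both ends, so the bound is
  uniform in the interval; this later permits \<open>b\<close> to tend to minus infinity.\<close>

lemma norm_integral_iexp_le:
  assumes "b \<le> a" "t \<noteq> 0"
  shows "norm (\<integral>y. indicator {b<..a} y *\<^sub>R iexp (t * y) \<partial>lborel) \<le> 2 / \<bar>t\<bar>"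
proof -
  let ?F = "\<lambda>y. iexp (t * y) / (\<i> * t)"
  have "((\<lambda>y. iexp (t * y)) has_integral (?F a - ?F b)) {b..a}"
  proof (rule fundamental_theorem_of_calculus[OF assms(1)])
    fix y assume "y \<in> {b..a}"
    have "((\<lambda>z. exp (\<i> * of_real t * z) / (\<i> * t)) has_field_derivative exp (\<i> * of_real t * of_real y)) (at (of_real y))"
      using assms(2) by (auto intro!: derivative_eq_intros)
    from has_vector_derivative_real_field[OF this, of "{b..a}"]
    show "(?F has_vector_derivative iexp (t * y)) (at y within {b..a})" by (simp add: mult.assoc)
  qed
  moreover have "set_integrable lborel {b..a} (\<lambda>y. iexp (t * y))"
    by (intro borel_integrable_atLeastAtMost') (auto intro!: continuous_intros)
  ultimately have "(LINT y:{b..a}|lborel. iexp (t * y)) = ?F a - ?F b"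
    by (subst set_borel_integral_eq_integral(2)) (auto simp: integral_unique)
  moreover have "(LINT y:{b..a}|lborel. iexp (t * y)) = (\<integral>y. indicator {b<..a} y *\<^sub>R iexp (t * y) \<partial>lborel)"
    unfolding set_lebesgue_integral_def
    by (rule integral_cong_AE) (use AE_lborel_singleton[of b] in \<open>auto elim!: eventually_mono simp: indicator_def\<close>)
  moreover have "norm (?F a - ?F b) \<le> norm (?F a) + norm (?F b)" by (rule norm_triangle_ineq4)
  moreover have "norm (?F y) = 1 / \<bar>t\<bar>" for y by (simp add: norm_divide norm_mult)
  ultimately show ?thesis by simp
qed

lemma real_distribution_unif: "real_distribution unif"
  by unfold_locales simp_all

text \<open>The kernel is the characteristic function of the difference of two independent uniform variables.
  This makes it nonnegative and integrable, and it is the Fourier transform of a law on \<open>[-1, 1]\<close>.\<close>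

definition smooth_kernel :: "real \<Rightarrow> real" where
  "smooth_kernel z = (cmod (char unif z))\<^sup>2"

abbreviation unif2 :: "(real \<times> real) measure" where
  "unif2 \<equiv> unif \<Otimes>\<^sub>M unif"

lemma prob_space_unif2: "prob_space unif2"
proof -
  interpret pair_prob_space unif unif ..
  show ?thesis by (rule prob_space_axioms)
qed

interpretation unif2: prob_space unif2 by (rule prob_space_unif2)

lemma measurable_smooth_kernel [measurable]: "smooth_kernel \<in> borel_measurable borel"
proof -
  interpret real_distribution unif by (rule real_distribution_unif)
  show ?thesis unfolding smooth_kernel_def by measurable
qed

lemma smooth_kernel_bounds: "0 \<le> smooth_kernel z" "smooth_kernel z \<le> 1"
  using real_distribution.cmod_char_le_1[OF real_distribution_unif, of z]
  by (auto simp: smooth_kernel_def intro: power_le_one)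

lemma smooth_kernel_eq:
  "complex_of_real (smooth_kernel z) = (\<integral>p. iexp (z * (fst p - snd p)) \<partial>unif2)"
proof -
  interpret pair_prob_space unif unif ..
  have int: "integrable unif2 (\<lambda>p. iexp (z * (fst p - snd p)))"
    by (rule unif2.integrable_const_bound[of _ 1]) auto
  have "of_real (smooth_kernel z) = char unif z * cnj (char unif z)"
    unfolding smooth_kernel_def by (rule complex_norm_square)
  also have "cnj (char unif z) = (\<integral>y. cnj (iexp (z * y)) \<partial>unif)"
    unfolding char_def
    by (rule integral_bounded_linear[OF bounded_linear_cnj, symmetric]) (rule unif.integrable_const_bound[of _ 1], auto)
  also have "\<dots> = (\<integral>y. iexp (- (z * y)) \<partial>unif)"
    by (simp add: exp_cnj)
  also have "char unif z * \<dots> = (\<integral>x. iexp (z * x) * (\<integral>y. iexp (- (z * y)) \<partial>unif) \<partial>unif)"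
    by (simp add: char_def)
  also have "\<dots> = (\<integral>x. (\<integral>y. iexp (z * (x - y)) \<partial>unif) \<partial>unif)"
    by (simp add: exp_add[symmetric] algebra_simps flip: integral_mult_right_zero)
  also have "\<dots> = (\<integral>p. iexp (z * (fst p - snd p)) \<partial>unif2)"
    using integral_fst'[OF int] by simp
  finally show ?thesis .
qed

text \<open>Quadratic decay comes from the bound 2 / |z| on the characteristic function for large z,
  and from the bound 1 near 0.\<close>

lemma smooth_kernel_le: "smooth_kernel z \<le> 8 * inverse (1 + z\<^sup>2)"
proof (cases "\<bar>z\<bar> \<le> 1")
  case True
  then have "z\<^sup>2 \<le> 1" by (simp add: abs_square_le_1)
  then have "1 \<le> 8 * inverse (1 + z\<^sup>2)" by (simp add: field_simps add_pos_nonneg)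
  with smooth_kernel_bounds(2)[of z] show ?thesis by linarith
next
  case False
  then have z2: "1 < z\<^sup>2" by (simp add: abs_square_le_1 flip: not_le)
  have "char unif z = (\<integral>y. indicator {0..1} y *\<^sub>R iexp (z * y) \<partial>lborel)"
    unfolding char_def unif_eq_density by (subst integral_density) auto
  also have "\<dots> = (\<integral>y. indicator {0<..1} y *\<^sub>R iexp (z * y) \<partial>lborel)"
    by (rule integral_cong_AE) (use AE_lborel_singleton[of 0] in \<open>auto elim!: eventually_mono simp: indicator_def\<close>)
  finally have "cmod (char unif z) \<le> 2 / \<bar>z\<bar>" using norm_integral_iexp_le[of 0 1 z] False by auto
  then have "smooth_kernel z \<le> (2 / \<bar>z\<bar>)\<^sup>2" unfolding smooth_kernel_def by (intro power_mono) auto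
  then have "smooth_kernel z \<le> 4 / z\<^sup>2" by (simp add: power_divide)
  moreover have "4 / w \<le> 8 * inverse (1 + w)" if "1 < w" for w :: real using that by (simp add: field_simps)
  ultimately show ?thesis using z2 by (meson order_trans)
qed

lemma integrable_inverse_1_plus_square_lborel: "integrable lborel (\<lambda>x::real. inverse (1 + x\<^sup>2))"
  using integrable_inverse_1_plus_square by (simp add: set_integrable_def einterval_def)

lemma integrable_smooth_kernel: "integrable lborel smooth_kernel"
  by (rule Bochner_Integration.integrable_bound[OF integrable_mult_right[OF integrable_inverse_1_plus_square_lborel, of 8]])
     (use smooth_kernel_le smooth_kernel_bounds in \<open>auto intro!: AE_I2\<close>)

section \<open>The smoothing measure: mass, tail and lower bounds\<close>

definition smooth_measure :: "real measure" where
  "smooth_measure = density lborel (\<lambda>z. ennreal (smooth_kernel z))"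

lemma sets_smooth_measure [simp, measurable_cong]: "sets smooth_measure = sets borel"
  and space_smooth_measure [simp]: "space smooth_measure = UNIV"
  by (simp_all add: smooth_measure_def)

lemma finite_measure_smooth: "finite_measure smooth_measure"
proof
  have "emeasure smooth_measure UNIV = (\<integral>\<^sup>+z. ennreal (smooth_kernel z) \<partial>lborel)"
    by (simp add: smooth_measure_def emeasure_density)
  also have "\<dots> = ennreal (\<integral>z. smooth_kernel z \<partial>lborel)"
    by (rule nn_integral_eq_integral[OF integrable_smooth_kernel]) (simp add: smooth_kernel_bounds)
  finally show "emeasure smooth_measure (space smooth_measure) \<noteq> \<infinity>" by simp
qed

interpretation smooth: finite_measure smooth_measure by (rule finite_measure_smooth)

lemma integral_smooth_measure:
  fixes f :: "real \<Rightarrow> real"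
  assumes "f \<in> borel_measurable borel"
  shows "(\<integral>z. f z \<partial>smooth_measure) = (\<integral>z. smooth_kernel z * f z \<partial>lborel)"
  unfolding smooth_measure_def using assms smooth_kernel_bounds by (subst integral_density) auto

text \<open>For z in [0, 1] the phases z x stay in [0, 1], so the real part of the characteristic
  function is at least cos 1 > 0.\<close>

lemma measure_smooth_pos: "0 < measure smooth_measure UNIV"
proof -
  have lower: "(cos 1)\<^sup>2 * indicator {0..1} z \<le> smooth_kernel z" for z
  proof (cases "z \<in> {0..1}")
    case True
    interpret real_distribution unif by (rule real_distribution_unif)
    have int: "integrable unif (\<lambda>x. iexp (z * x))" by (rule unif.integrable_const_bound[of _ 1]) auto
    have c: "0 < cos (1 :: real)" using cos_gt_zero_pi[of 1] pi_gt3 by auto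
    have "AE x in unif. cos 1 \<le> Re (iexp (z * x))"
      using AE_unif
    proof eventually_elim
      case (elim x)
      have "0 \<le> z * x" "z * x \<le> 1" using True elim by (auto intro: mult_le_one)
      then have "cos 1 \<le> cos (z * x)" using pi_gt3 by (intro cos_monotone_0_pi_le) auto
      then show ?case by (simp add: Re_exp)
    qed
    then have "(\<integral>x. cos 1 \<partial>unif) \<le> (\<integral>x. Re (iexp (z * x)) \<partial>unif)"
      using int by (intro integral_mono_AE) auto
    also have "\<dots> = Re (char unif z)" using int by (simp add: char_def)
    also have "\<dots> \<le> cmod (char unif z)" by (rule complex_Re_le_cmod)
    finally have "cos 1 \<le> cmod (char unif z)" using unif.prob_space by simp
    then have "(cos 1)\<^sup>2 \<le> smooth_kernel z" unfolding smooth_kernel_def using c by (intro power_mono) auto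
    then show ?thesis using True by simp
  qed (use smooth_kernel_bounds in simp)
  have "0 < (cos 1 :: real)\<^sup>2" using cos_gt_zero_pi[of 1] pi_gt3 by (auto simp: zero_less_power2)
  also have "(cos 1 :: real)\<^sup>2 = (\<integral>z. (cos 1)\<^sup>2 * indicator {0..1::real} z \<partial>lborel)" by simp
  also have "\<dots> \<le> (\<integral>z. smooth_kernel z \<partial>lborel)"
    by (rule integral_mono) (auto simp: lower integrable_smooth_kernel)
  also have "\<dots> = (\<integral>z. 1 \<partial>smooth_measure)" by (subst integral_smooth_measure) auto
  finally show ?thesis by simp
qed

text \<open>On the window |z| <= A the function is at least d - e; outside only the bound - \<eta>
  is available, but there the mass is at most a quarter of \<kappa>. The window must outweigh the
  tail for the supremum to be absorbed in \<open>esseen_smoothing\<close>.\<close>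

lemma integral_smooth_lower:
  assumes [measurable]: "g \<in> borel_measurable borel" and "\<And>z. \<bar>g z\<bar> \<le> \<eta>" and "\<And>z. \<bar>z\<bar> \<le> A \<Longrightarrow> d - e \<le> g z"
    and "0 \<le> d" "0 \<le> e" and tail: "measure smooth_measure {z. A < \<bar>z\<bar>} \<le> \<kappa> / 4"
    and \<kappa>: "\<kappa> = measure smooth_measure UNIV"
  shows "3 / 4 * \<kappa> * d - \<kappa> * e - \<eta> * \<kappa> / 4 \<le> (\<integral>z. g z \<partial>smooth_measure)"
proof -
  let ?I = "indicator {z. A < \<bar>z\<bar>} :: real \<Rightarrow> real"
  have eta: "0 \<le> \<eta>" using assms(2)[of 0] by linarith
  have m: "{z::real. A < \<bar>z\<bar>} \<in> sets borel" by measurable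
  have "(\<integral>z. (d - e) - (d + \<eta>) * ?I z \<partial>smooth_measure) \<le> (\<integral>z. g z \<partial>smooth_measure)"
  proof (rule integral_mono)
    show "integrable smooth_measure g" by (rule smooth.integrable_const_bound[of _ \<eta>]) (use assms(2) in auto)
    show "integrable smooth_measure (\<lambda>z. (d - e) - (d + \<eta>) * ?I z)"
      by (rule smooth.integrable_const_bound[of _ "\<bar>d - e\<bar> + \<bar>d + \<eta>\<bar>"]) (auto simp: indicator_def)
    show "(d - e) - (d + \<eta>) * ?I z \<le> g z" for z
      using assms(2)[of z] assms(3)[of z] assms(5) by (auto simp: indicator_def)
  qed
  also have "(\<integral>z. (d - e) - (d + \<eta>) * ?I z \<partial>smooth_measure) = \<kappa> * (d - e) - (d + \<eta>) * measure smooth_measure {z. A < \<bar>z\<bar>}"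
    using m \<kappa> by (subst Bochner_Integration.integral_diff)
      (auto intro!: integrable_real_indicator simp: smooth.emeasure_eq_measure)
  finally have "\<kappa> * (d - e) - (d + \<eta>) * measure smooth_measure {z. A < \<bar>z\<bar>} \<le> (\<integral>z. g z \<partial>smooth_measure)" .
  moreover have "(d + \<eta>) * measure smooth_measure {z. A < \<bar>z\<bar>} \<le> (d + \<eta>) * (\<kappa> / 4)"
    using tail assms(4) eta by (intro mult_left_mono) auto
  ultimately show ?thesis by (simp add: algebra_simps)
qed

lemma smooth_tail: "\<exists>A\<ge>0. measure smooth_measure {z. A < \<bar>z\<bar>} \<le> measure smooth_measure UNIV / 4"
proof -
  have "(\<lambda>n. measure smooth_measure {z. real n < \<bar>z\<bar>}) \<longlonglongrightarrow> measure smooth_measure (\<Inter>n. {z. real n < \<bar>z\<bar>})"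
    by (rule smooth.finite_Lim_measure_decseq) (auto simp: decseq_def)
  also have "(\<Inter>n. {z::real. real n < \<bar>z\<bar>}) = {}"
  proof -
    have "\<exists>n. \<not> real n < \<bar>z\<bar>" for z :: real using reals_Archimedean2[of "\<bar>z\<bar>"] by (meson less_asym)
    then show ?thesis by blast
  qed
  finally have "(\<lambda>n. measure smooth_measure {z. real n < \<bar>z\<bar>}) \<longlonglongrightarrow> 0" by simp
  then have "\<forall>\<^sub>F n in sequentially. measure smooth_measure {z. real n < \<bar>z\<bar>} < measure smooth_measure UNIV / 4"
    by (rule order_tendstoD) (use measure_smooth_pos in simp)
  then obtain n where "measure smooth_measure {z. real n < \<bar>z\<bar>} < measure smooth_measure UNIV / 4"
    unfolding eventually_sequentially by blast
  then show ?thesis by (intro exI[of _ "real n"]) auto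
qed

section \<open>Smoothed distribution functions in terms of characteristic functions\<close>

lemma (in real_distribution) integral_kernel_eq_char:
  "complex_of_real (\<integral>x. smooth_kernel (x - y) \<partial>M) = (\<integral>p. iexp (- ((fst p - snd p) * y)) * char M (fst p - snd p) \<partial>unif2)"
proof -
  have "complex_of_real (\<integral>x. smooth_kernel (x - y) \<partial>M) = (\<integral>x. of_real (smooth_kernel (x - y)) \<partial>M)" by simp
  also have "\<dots> = (\<integral>x. (\<integral>p. iexp ((x - y) * (fst p - snd p)) \<partial>unif2) \<partial>M)" by (simp only: smooth_kernel_eq)
  also have "\<dots> = (\<integral>p. (\<integral>x. iexp ((x - y) * (fst p - snd p)) \<partial>M) \<partial>unif2)"
    by (rule fubini_bounded[of _ _ _ 1]) (auto intro: finite_measure_axioms unif2.finite_measure_axioms)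
  also have "\<dots> = (\<integral>p. iexp (- ((fst p - snd p) * y)) * char M (fst p - snd p) \<partial>unif2)"
  proof (rule Bochner_Integration.integral_cong[OF refl])
    fix p :: "real \<times> real"
    have "iexp ((x - y) * (fst p - snd p)) = iexp (- ((fst p - snd p) * y)) * iexp ((fst p - snd p) * x)" for x
      by (simp add: exp_add[symmetric] algebra_simps)
    then show "(\<integral>x. iexp ((x - y) * (fst p - snd p)) \<partial>M) = iexp (- ((fst p - snd p) * y)) * char M (fst p - snd p)"
      by (simp only: char_def integral_mult_right_zero)
  qed
  finally show ?thesis .
qed

text \<open>Fubini and the substitution z = x - y: y lies in (b, a] iff x lies in (b + z, a + z].
  The interval is kept bounded so that all measures in the interchange are finite.\<close>

lemma (in real_distribution) integral_kernel_Ioc: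
  assumes "b < a"
  shows "(\<integral>y. indicator {b<..a} y * (\<integral>x. smooth_kernel (x - y) \<partial>M) \<partial>lborel) = (\<integral>z. cdf M (a + z) - cdf M (b + z) \<partial>smooth_measure)"
proof -
  let ?R = "density lborel (\<lambda>y. ennreal (indicator {b<..a} y))"
  have finR: "finite_measure ?R"
    by standard (use assms in \<open>simp add: emeasure_density nn_integral_indicator ennreal_indicator\<close>)
  have "(\<integral>y. indicator {b<..a} y * (\<integral>x. smooth_kernel (x - y) \<partial>M) \<partial>lborel) = (\<integral>y. (\<integral>x. smooth_kernel (x - y) \<partial>M) \<partial>?R)"
    by (subst integral_density) auto
  also have "\<dots> = (\<integral>x. (\<integral>y. smooth_kernel (x - y) \<partial>?R) \<partial>M)"
    by (rule fubini_bounded[OF finR finite_measure_axioms, of _ 1]) (auto simp: smooth_kernel_bounds)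
  also have "\<dots> = (\<integral>x. (\<integral>z. indicator {b + z<..a + z} x \<partial>smooth_measure) \<partial>M)"
  proof (rule Bochner_Integration.integral_cong[OF refl])
    fix x
    have "(\<integral>y. smooth_kernel (x - y) \<partial>?R) = (\<integral>y. indicator {b<..a} y * smooth_kernel (x - y) \<partial>lborel)"
      by (subst integral_density) auto
    also have "\<dots> = (\<integral>z. indicator {b<..a} (x - z) * smooth_kernel z \<partial>lborel)"
      by (subst lborel_integral_real_affine[where c="-1" and t=x]) auto
    also have "\<dots> = (\<integral>z. smooth_kernel z * indicator {b + z<..a + z} x \<partial>lborel)"
      by (rule Bochner_Integration.integral_cong[OF refl]) (auto simp: indicator_def)
    also have "\<dots> = (\<integral>z. indicator {b + z<..a + z} x \<partial>smooth_measure)"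
    proof (rule integral_smooth_measure[symmetric])
      have "(\<lambda>z. indicator {b + z<..a + z} x :: real) = (\<lambda>z. indicator {b<..a} (x - z))"
        by (rule ext) (simp add: indicator_def less_diff_eq diff_le_eq)
      then show "(\<lambda>z. indicator {b + z<..a + z} x :: real) \<in> borel_measurable borel" by simp
    qed
    finally show "(\<integral>y. smooth_kernel (x - y) \<partial>?R) = (\<integral>z. indicator {b + z<..a + z} x \<partial>smooth_measure)" .
  qed
  also have "\<dots> = (\<integral>z. (\<integral>x. indicator {b + z<..a + z} x \<partial>M) \<partial>smooth_measure)"
  proof (rule fubini_bounded[OF finite_measure_axioms finite_measure_smooth, of _ 1])
    have "case_prod (\<lambda>x z. indicator {b + z<..a + z} x :: real) = (\<lambda>p. indicator {b<..a} (fst p - snd p))"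
      by (rule ext) (simp add: indicator_def less_diff_eq diff_le_eq split: prod.split)
    then show "case_prod (\<lambda>x z. indicator {b + z<..a + z} x :: real) \<in> borel_measurable (M \<Otimes>\<^sub>M smooth_measure)"
      by simp
  qed simp
  also have "\<dots> = (\<integral>z. cdf M (a + z) - cdf M (b + z) \<partial>smooth_measure)"
    using assms by (intro Bochner_Integration.integral_cong[OF refl]) (simp add: cdf_diff_eq)
  finally show ?thesis .
qed

text \<open>The Fourier transform of the kernel lives on [-1, 1], so only frequencies |t| <= 1
  enter. Integrating over (b, a] in space brings the factor 1 / |t| of the classical
  inequality.\<close>

lemma smoothed_cdf_diff_le:
  assumes \<mu>: "real_distribution \<mu>" and \<nu>: "real_distribution \<nu>"
    and G: "integrable lborel G" "\<And>t. 0 \<le> G t"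
    and bound: "\<And>t. \<bar>t\<bar> \<le> 1 \<Longrightarrow> norm (char \<mu> t - char \<nu> t) \<le> \<bar>t\<bar> * G t"
  shows "\<bar>\<integral>z. cdf \<mu> (a + z) - cdf \<nu> (a + z) \<partial>smooth_measure\<bar> \<le> 2 * (\<integral>t. G t \<partial>lborel)"
proof -
  interpret m: real_distribution \<mu> by fact
  interpret n: real_distribution \<nu> by fact
  let ?J = "\<integral>t. G t \<partial>lborel"
  let ?\<delta> = "\<lambda>p. fst p - snd p :: real"
  have mG [measurable]: "G \<in> borel_measurable borel" using borel_measurable_integrable[OF G(1)] by simp
  have cm [measurable]: "cdf \<mu> \<in> borel_measurable borel" "cdf \<nu> \<in> borel_measurable borel"
    by (auto intro!: borel_measurable_mono simp: mono_def m.cdf_nondecreasing n.cdf_nondecreasing)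
  have cb: "\<bar>cdf \<mu> x\<bar> \<le> 1" "\<bar>cdf \<nu> x\<bar> \<le> 1" for x
    using m.cdf_nonneg m.cdf_bounded_prob n.cdf_nonneg n.cdf_bounded_prob by (auto simp: abs_le_iff intro: order_trans[of _ 0])
  have "\<bar>\<integral>z. (cdf \<mu> (a + z) - cdf \<mu> (b + z)) - (cdf \<nu> (a + z) - cdf \<nu> (b + z)) \<partial>smooth_measure\<bar> \<le> 2 * ?J" if b: "b < a" for b
  proof -
    let ?R = "density lborel (\<lambda>y. ennreal (indicator {b<..a} y))"
    have finR: "finite_measure ?R"
      by standard (use b in \<open>simp add: emeasure_density nn_integral_indicator ennreal_indicator\<close>)
    interpret R: finite_measure ?R by fact
    let ?P = "\<lambda>\<mu> y. \<integral>x. smooth_kernel (x - y) \<partial>\<mu>"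
    have int: "integrable smooth_measure (\<lambda>z. cdf \<mu> (a + z) - cdf \<mu> (b + z))" "integrable smooth_measure (\<lambda>z. cdf \<nu> (a + z) - cdf \<nu> (b + z))"
    proof -
      have i: "integrable smooth_measure (\<lambda>z. cdf \<mu> (c + z))" "integrable smooth_measure (\<lambda>z. cdf \<nu> (c + z))" for c
        by (rule smooth.integrable_const_bound[of _ 1]; use cb in simp)+
      show "integrable smooth_measure (\<lambda>z. cdf \<mu> (a + z) - cdf \<mu> (b + z))" "integrable smooth_measure (\<lambda>z. cdf \<nu> (a + z) - cdf \<nu> (b + z))"
        by (intro Bochner_Integration.integrable_diff i)+
    qed
    have [measurable]: "?P \<mu> \<in> borel_measurable borel"
      by (rule m.borel_measurable_lebesgue_integral) measurable
    have [measurable]: "?P \<nu> \<in> borel_measurable borel"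
      by (rule n.borel_measurable_lebesgue_integral) measurable
    have Pb: "\<bar>?P \<mu> y\<bar> \<le> 1" "\<bar>?P \<nu> y\<bar> \<le> 1" for y
    proof -
      have i: "integrable \<mu> (\<lambda>x. smooth_kernel (x - y))" "integrable \<nu> (\<lambda>x. smooth_kernel (x - y))"
        by (rule m.integrable_const_bound[of _ 1] n.integrable_const_bound[of _ 1]; use smooth_kernel_bounds in simp)+
      have "norm (?P \<mu> y) \<le> (\<integral>x. 1 \<partial>\<mu>)" "norm (?P \<nu> y) \<le> (\<integral>x. 1 \<partial>\<nu>)"
        by (rule norm_integral_le_integral[OF i(1)] norm_integral_le_integral[OF i(2)]; use smooth_kernel_bounds in simp)+
      then show "\<bar>?P \<mu> y\<bar> \<le> 1" "\<bar>?P \<nu> y\<bar> \<le> 1" using m.prob_space n.prob_space by simp_all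
    qed
    have intP: "integrable ?R (?P \<mu>)" "integrable ?R (?P \<nu>)"
      by (rule R.integrable_const_bound[of _ 1]; use Pb in simp)+
    let ?D = "\<lambda>t. char \<mu> t - char \<nu> t"
    have Db: "norm (?D t) \<le> 2" for t
      using norm_triangle_ineq4[of "char \<mu> t" "char \<nu> t"] m.cmod_char_le_1[of t] n.cmod_char_le_1[of t] by linarith
    have "(\<integral>z. (cdf \<mu> (a + z) - cdf \<mu> (b + z)) - (cdf \<nu> (a + z) - cdf \<nu> (b + z)) \<partial>smooth_measure) =
        (\<integral>y. ?P \<mu> y \<partial>?R) - (\<integral>y. ?P \<nu> y \<partial>?R)"
      using int b by (simp add: m.integral_kernel_Ioc[symmetric] n.integral_kernel_Ioc[symmetric] integral_density)
    also have "\<dots> = (\<integral>y. ?P \<mu> y - ?P \<nu> y \<partial>?R)" using intP by simp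
    finally have "complex_of_real (\<integral>z. (cdf \<mu> (a + z) - cdf \<mu> (b + z)) - (cdf \<nu> (a + z) - cdf \<nu> (b + z)) \<partial>smooth_measure) =
        complex_of_real (\<integral>y. ?P \<mu> y - ?P \<nu> y \<partial>?R)" by (rule arg_cong)
    also have "\<dots> = (\<integral>y. complex_of_real (?P \<mu> y) - complex_of_real (?P \<nu> y) \<partial>?R)"
      by (simp only: integral_complex_of_real[symmetric] of_real_diff)
    also have "\<dots> = (\<integral>y. (\<integral>p. iexp (- (?\<delta> p * y)) * ?D (?\<delta> p) \<partial>unif2) \<partial>?R)"
    proof (rule Bochner_Integration.integral_cong[OF refl])
      fix y
      have "integrable unif2 (\<lambda>p. iexp (- (?\<delta> p * y)) * char \<mu> (?\<delta> p))" "integrable unif2 (\<lambda>p. iexp (- (?\<delta> p * y)) * char \<nu> (?\<delta> p))"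
        by (rule unif2.integrable_const_bound[of _ 1]; auto simp: norm_mult m.cmod_char_le_1 n.cmod_char_le_1)+
      then show "complex_of_real (?P \<mu> y) - complex_of_real (?P \<nu> y) = (\<integral>p. iexp (- (?\<delta> p * y)) * ?D (?\<delta> p) \<partial>unif2)"
        unfolding m.integral_kernel_eq_char n.integral_kernel_eq_char right_diff_distrib
        by (rule Bochner_Integration.integral_diff[symmetric])
    qed
    also have "\<dots> = (\<integral>p. (\<integral>y. iexp (- (?\<delta> p * y)) * ?D (?\<delta> p) \<partial>?R) \<partial>unif2)"
      by (rule fubini_bounded[OF finR unif2.finite_measure_axioms, of _ 2]) (auto simp: norm_mult Db)
    finally have eq: "complex_of_real (\<integral>z. (cdf \<mu> (a + z) - cdf \<mu> (b + z)) - (cdf \<nu> (a + z) - cdf \<nu> (b + z)) \<partial>smooth_measure) =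
        (\<integral>p. (\<integral>y. iexp (- (?\<delta> p * y)) * ?D (?\<delta> p) \<partial>?R) \<partial>unif2)" .
    \<comment> \<open>The factor 2 / |t| of the oscillating integral cancels the |t| in
      \<open>bound\<close>; at t = 0 both characteristic functions are 1.\<close>
    have inner: "norm (\<integral>y. iexp (- (t * y)) * ?D t \<partial>?R) \<le> 2 * G t" if t: "\<bar>t\<bar> \<le> 1" for t
    proof (cases "t = 0")
      case True
      then show ?thesis using G by (simp add: m.char_zero n.char_zero)
    next
      case False
      have "norm (\<integral>y. iexp (- (t * y)) * ?D t \<partial>?R) = norm (\<integral>y. iexp (- (t * y)) \<partial>?R) * norm (?D t)"
        by (simp add: norm_mult)
      also have "(\<integral>y. iexp (- (t * y)) \<partial>?R) = (\<integral>y. indicator {b<..a} y *\<^sub>R iexp ((- t) * y) \<partial>lborel)"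
        by (subst integral_density) auto
      also have "norm \<dots> * norm (?D t) \<le> (2 / \<bar>- t\<bar>) * (\<bar>t\<bar> * G t)"
        using b False by (intro mult_mono norm_integral_iexp_le bound t) auto
      finally show ?thesis using False by simp
    qed
    \<comment> \<open>A function that is not integrable has integral 0 by convention, so the
      inequality holds in either case.\<close>
    have "ennreal (norm (\<integral>p. (\<integral>y. iexp (- (?\<delta> p * y)) * ?D (?\<delta> p) \<partial>?R) \<partial>unif2)) \<le>
        (\<integral>\<^sup>+p. ennreal (norm (\<integral>y. iexp (- (?\<delta> p * y)) * ?D (?\<delta> p) \<partial>?R)) \<partial>unif2)"
      (is "ennreal (norm (\<integral>p. ?h p \<partial>unif2)) \<le> _")
      by (cases "integrable unif2 ?h") (auto simp: integral_norm_bound_ennreal not_integrable_integral_eq)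
    also have "\<dots> \<le> (\<integral>\<^sup>+p. ennreal (2 * G (?\<delta> p)) \<partial>unif2)"
    proof (rule nn_integral_mono_AE)
      interpret pair_prob_space unif unif ..
      have "AE p in unif2. \<bar>?\<delta> p\<bar> \<le> 1"
      proof (rule AE_pair_measure)
        show "AE x in unif. AE y in unif. \<bar>?\<delta> (x, y)\<bar> \<le> 1"
          using AE_unif
        proof eventually_elim
          case (elim x)
          show ?case using AE_unif by eventually_elim (use elim in auto)
        qed
      qed measurable
      then show "AE p in unif2. ennreal (norm (\<integral>y. iexp (- (?\<delta> p * y)) * ?D (?\<delta> p) \<partial>?R)) \<le> ennreal (2 * G (?\<delta> p))"
        by eventually_elim (intro ennreal_leI inner)
    qed
    also have "\<dots> = (\<integral>\<^sup>+x. (\<integral>\<^sup>+y. ennreal (2 * G (x - y)) \<partial>unif) \<partial>unif)"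
      by (subst unif.nn_integral_fst[symmetric]) auto
    also have "\<dots> \<le> (\<integral>\<^sup>+x. ennreal (2 * ?J) \<partial>unif)"
    proof (rule nn_integral_mono)
      fix x
      \<comment> \<open>The uniform density is at most 1, so the average is at most the integral
        over the line, where reflection and translation remove x.\<close>
      have "(\<integral>\<^sup>+y. ennreal (2 * G (x - y)) \<partial>unif) \<le> (\<integral>\<^sup>+y. ennreal (2 * G (x - y)) \<partial>lborel)"
        unfolding unif_eq_density
        by (subst nn_integral_density) (auto intro!: nn_integral_mono simp: indicator_def)
      also have "\<dots> = (\<integral>\<^sup>+y. ennreal (2 * G y) \<partial>lborel)"
        by (subst (2) nn_integral_real_affine[where c="-1" and t=x]) auto
      also have "\<dots> = ennreal (\<integral>y. 2 * G y \<partial>lborel)"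
        using G by (intro nn_integral_eq_integral) auto
      finally show "(\<integral>\<^sup>+y. ennreal (2 * G (x - y)) \<partial>unif) \<le> ennreal (2 * ?J)" by simp
    qed
    also have "\<dots> = ennreal (2 * ?J)" using unif.emeasure_space_1 by simp
    finally have "norm (\<integral>p. (\<integral>y. iexp (- (?\<delta> p * y)) * ?D (?\<delta> p) \<partial>?R) \<partial>unif2) \<le> 2 * ?J"
      using G by (subst (asm) ennreal_le_iff) (auto intro!: Bochner_Integration.integral_nonneg)
    then show ?thesis unfolding eq[symmetric] by simp
  qed
  note le = this
  \<comment> \<open>The bound does not depend on \<open>b\<close>; for b = - n the subtracted values
    tend to 0.\<close>
  let ?f = "\<lambda>n z. (cdf \<mu> (a + z) - cdf \<mu> (- real n + z)) - (cdf \<nu> (a + z) - cdf \<nu> (- real n + z))"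
  have "(\<lambda>n. \<integral>z. ?f n z \<partial>smooth_measure) \<longlonglongrightarrow> (\<integral>z. (cdf \<mu> (a + z) - 0) - (cdf \<nu> (a + z) - 0) \<partial>smooth_measure)"
  proof (rule integral_dominated_convergence[where w="\<lambda>_. 4"])
    have bot: "filterlim (\<lambda>n. - real n + z) at_bot sequentially" for z
      unfolding filterlim_at_bot
    proof
      fix Z :: real
      have "\<forall>\<^sub>F n in sequentially. z - Z \<le> real n"
        using filterlim_real_sequentially unfolding filterlim_at_top by blast
      then show "\<forall>\<^sub>F n in sequentially. - real n + z \<le> Z" by eventually_elim simp
    qed
    show "AE z in smooth_measure. (\<lambda>n. ?f n z) \<longlonglongrightarrow> (cdf \<mu> (a + z) - 0) - (cdf \<nu> (a + z) - 0)"
      by (intro AE_I2 tendsto_intros filterlim_compose[OF m.cdf_lim_at_bot bot] filterlim_compose[OF n.cdf_lim_at_bot bot])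
    show "AE z in smooth_measure. norm (?f n z) \<le> 4" for n
    proof (rule AE_I2)
      fix z show "norm (?f n z) \<le> 4"
        using cb(1)[of "a + z"] cb(1)[of "- real n + z"] cb(2)[of "a + z"] cb(2)[of "- real n + z"]
        unfolding real_norm_def by linarith
    qed
  qed auto
  then have "(\<lambda>n. \<bar>\<integral>z. ?f n z \<partial>smooth_measure\<bar>) \<longlonglongrightarrow> \<bar>\<integral>z. cdf \<mu> (a + z) - cdf \<nu> (a + z) \<partial>smooth_measure\<bar>"
    by (simp add: tendsto_rabs)
  moreover have "\<forall>\<^sub>F n in sequentially. \<bar>\<integral>z. ?f n z \<partial>smooth_measure\<bar> \<le> 2 * ?J"
  proof -
    have "\<forall>\<^sub>F n in sequentially. - a < real n"
      by (rule filterlim_real_sequentially[THEN filterlim_at_top_dense[THEN iffD1], rule_format])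
    then show ?thesis by eventually_elim (rule le, simp)
  qed
  ultimately show ?thesis by (intro tendsto_upperbound) auto
qed

text \<open>Esseen's inequality with frequency cutoff 1; other cutoffs are reached by rescaling the
  laws. \<open>G\<close> dominates the difference of the characteristic functions divided by |t|, so
  no singular integrand at 0 appears.\<close>

definition smoothing_bound :: "real \<Rightarrow> bool" where
  "smoothing_bound C \<longleftrightarrow> C \<ge> 0 \<and> (\<forall>\<mu> \<nu> L G. real_distribution \<mu> \<longrightarrow> real_distribution \<nu> \<longrightarrow> L \<ge> 0 \<longrightarrow>
     (\<forall>x y. x \<le> y \<longrightarrow> cdf \<nu> y - cdf \<nu> x \<le> L * (y - x)) \<longrightarrow>
     integrable lborel G \<longrightarrow> (\<forall>t. 0 \<le> G t) \<longrightarrow>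
     (\<forall>t. \<bar>t\<bar> \<le> 1 \<longrightarrow> norm (char \<mu> t - char \<nu> t) \<le> \<bar>t\<bar> * G t) \<longrightarrow>
     (\<forall>x. \<bar>cdf \<mu> x - cdf \<nu> x\<bar> \<le> C * ((\<integral>t. G t \<partial>lborel) + L)))"

lemma smoothing_boundD:
  assumes "smoothing_bound C" "real_distribution \<mu>" "real_distribution \<nu>" "L \<ge> 0"
    and "\<And>x y. x \<le> y \<Longrightarrow> cdf \<nu> y - cdf \<nu> x \<le> L * (y - x)"
    and "integrable lborel G" "\<And>t. 0 \<le> G t"
    and "\<And>t. \<bar>t\<bar> \<le> 1 \<Longrightarrow> norm (char \<mu> t - char \<nu> t) \<le> \<bar>t\<bar> * G t"
  shows "\<bar>cdf \<mu> x - cdf \<nu> x\<bar> \<le> C * ((\<integral>t. G t \<partial>lborel) + L)"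
  using assms unfolding smoothing_bound_def by simp

theorem esseen_smoothing: "\<exists>C. smoothing_bound C"
proof -
  define \<kappa> where "\<kappa> = measure smooth_measure UNIV"
  have \<kappa>: "0 < \<kappa>" using measure_smooth_pos by (simp add: \<kappa>_def)
  obtain A where A: "A \<ge> 0" "measure smooth_measure {z. A < \<bar>z\<bar>} \<le> \<kappa> / 4" using smooth_tail by (auto simp: \<kappa>_def)
  \<comment> \<open>Solving the last inequality for the supremum gives 4 / \<kappa> as coefficient
    of the integral and 4 A as coefficient of \<open>L\<close>; the sum covers both.\<close>
  define C where "C = 4 / \<kappa> + 4 * A"
  have C: "C \<ge> 0" using \<kappa> A by (simp add: C_def)
  have "\<bar>cdf \<mu> x - cdf \<nu> x\<bar> \<le> C * ((\<integral>t. G t \<partial>lborel) + L)"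
    if \<mu>: "real_distribution \<mu>" and \<nu>: "real_distribution \<nu>" and L: "L \<ge> 0"
      and lip: "\<And>x y. x \<le> y \<Longrightarrow> cdf \<nu> y - cdf \<nu> x \<le> L * (y - x)"
      and G: "integrable lborel G" "\<And>t. 0 \<le> G t"
      and bound: "\<And>t. \<bar>t\<bar> \<le> 1 \<Longrightarrow> norm (char \<mu> t - char \<nu> t) \<le> \<bar>t\<bar> * G t"
    for \<mu> \<nu> L G x
  proof -
    interpret m: real_distribution \<mu> by fact
    interpret n: real_distribution \<nu> by fact
    define \<Delta> where "\<Delta> y = cdf \<mu> y - cdf \<nu> y" for y
    define J where "J = (\<integral>t. G t \<partial>lborel)"
    have J: "0 \<le> J" unfolding J_def by (rule Bochner_Integration.integral_nonneg) (rule G)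
    have sm: "\<bar>\<integral>z. \<Delta> (a + z) \<partial>smooth_measure\<bar> \<le> 2 * J" for a
      unfolding \<Delta>_def J_def by (rule smoothed_cdf_diff_le[OF \<mu> \<nu> G bound])
    have [measurable]: "cdf \<mu> \<in> borel_measurable borel" "cdf \<nu> \<in> borel_measurable borel"
      by (auto intro!: borel_measurable_mono simp: mono_def m.cdf_nondecreasing n.cdf_nondecreasing)
    have \<Delta>m [measurable]: "\<Delta> \<in> borel_measurable borel" unfolding \<Delta>_def by measurable
    have \<Delta>1: "\<bar>\<Delta> y\<bar> \<le> 1" for y
      using m.cdf_nonneg[of y] m.cdf_bounded_prob[of y] n.cdf_nonneg[of y] n.cdf_bounded_prob[of y]
      unfolding \<Delta>_def by linarith
    \<comment> \<open>The supremum reappears on the right as \<open>\<eta> / 3\<close>; being at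
      most 1 it is finite and can be absorbed.\<close>
    define \<eta> where "\<eta> = (SUP y. \<bar>\<Delta> y\<bar>)"
    have bdd: "bdd_above (range (\<lambda>y. \<bar>\<Delta> y\<bar>))" using \<Delta>1 by (intro bdd_aboveI[of _ 1]) auto
    have \<eta>: "\<bar>\<Delta> y\<bar> \<le> \<eta>" for y unfolding \<eta>_def by (rule cSUP_upper[OF _ bdd]) simp
    have "\<bar>\<Delta> y\<bar> \<le> 4 / (3 * \<kappa>) * (2 * J) + 4 / 3 * (2 * L * A) + \<eta> / 3" for y
    proof -
      \<comment> \<open>A positive difference persists to the right of y, as
        \<open>cdf \<mu>\<close> increases and \<open>cdf \<nu>\<close> is Lipschitz; a negative one
        persists to the left. Hence windows of radius A centred at y + A and y - A, on which the
        loss is at most 2 L A.\<close>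
      have main: "3 / 4 * \<kappa> * \<bar>\<Delta> y\<bar> - \<kappa> * (2 * L * A) - \<eta> * \<kappa> / 4 \<le> 2 * J"
      proof (cases "0 \<le> \<Delta> y")
        case True
        have "3 / 4 * \<kappa> * \<bar>\<Delta> y\<bar> - \<kappa> * (2 * L * A) - \<eta> * \<kappa> / 4 \<le> (\<integral>z. \<Delta> (y + A + z) \<partial>smooth_measure)"
        proof (rule integral_smooth_lower[where A=A])
          fix z :: real assume z: "\<bar>z\<bar> \<le> A"
          have "cdf \<mu> y \<le> cdf \<mu> (y + A + z)" using z by (intro m.cdf_nondecreasing) auto
          moreover have "cdf \<nu> (y + A + z) - cdf \<nu> y \<le> L * ((y + A + z) - y)" using z by (intro lip) auto
          moreover have "L * ((y + A + z) - y) \<le> L * (2 * A)" using z L by (intro mult_left_mono) auto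
          ultimately show "\<bar>\<Delta> y\<bar> - 2 * L * A \<le> \<Delta> (y + A + z)" using True by (simp add: \<Delta>_def)
        qed (use \<eta> A L \<kappa>_def in auto)
        also have "\<dots> \<le> 2 * J" using sm[of "y + A"] by linarith
        finally show ?thesis .
      next
        case False
        have "3 / 4 * \<kappa> * \<bar>\<Delta> y\<bar> - \<kappa> * (2 * L * A) - \<eta> * \<kappa> / 4 \<le> (\<integral>z. - \<Delta> (y - A + z) \<partial>smooth_measure)"
        proof (rule integral_smooth_lower[where A=A])
          fix z :: real assume z: "\<bar>z\<bar> \<le> A"
          have "cdf \<mu> (y - A + z) \<le> cdf \<mu> y" using z by (intro m.cdf_nondecreasing) auto
          moreover have "cdf \<nu> y - cdf \<nu> (y - A + z) \<le> L * (y - (y - A + z))" using z by (intro lip) auto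
          moreover have "L * (y - (y - A + z)) \<le> L * (2 * A)" using z L by (intro mult_left_mono) auto
          ultimately show "\<bar>\<Delta> y\<bar> - 2 * L * A \<le> - \<Delta> (y - A + z)" using False by (simp add: \<Delta>_def)
        qed (use \<eta> A L \<kappa>_def in auto)
        also have "\<dots> \<le> 2 * J" using sm[of "y - A"] by simp
        finally show ?thesis .
      qed
      then have "3 / 4 * \<kappa> * \<bar>\<Delta> y\<bar> \<le> 2 * J + \<kappa> * (2 * L * A) + \<eta> * \<kappa> / 4" by simp
      then have "\<bar>\<Delta> y\<bar> \<le> (2 * J + \<kappa> * (2 * L * A) + \<eta> * \<kappa> / 4) / (3 / 4 * \<kappa>)"
        using \<kappa> by (simp add: pos_le_divide_eq mult_ac)
      also have "\<dots> = 4 / (3 * \<kappa>) * (2 * J) + 4 / 3 * (2 * L * A) + \<eta> / 3"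
        using \<kappa> by (simp add: field_simps)
      finally show ?thesis .
    qed
    then have "\<eta> \<le> 4 / (3 * \<kappa>) * (2 * J) + 4 / 3 * (2 * L * A) + \<eta> / 3"
      unfolding \<eta>_def by (intro cSUP_least) auto
    then have "\<eta> \<le> 4 / \<kappa> * J + 4 * A * L" using \<kappa> by (simp add: field_simps)
    also have "\<dots> \<le> C * (J + L)"
    proof -
      have "0 \<le> 4 / \<kappa> * L" "0 \<le> 4 * A * J" using \<kappa> A L J by auto
      then show ?thesis unfolding C_def distrib_left distrib_right by linarith
    qed
    finally show ?thesis using \<eta>[of x] by (simp add: \<Delta>_def J_def)
  qed
  with C show ?thesis unfolding smoothing_bound_def by (intro exI[of _ C]) simp
qed

section \<open>The functional equation\<close>

text \<open>Existence is enough: \<open>expectation_power_kak_N\<close> identifies any solution. The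
  bound by 1 at every real x, also at negative ones, bounds the product over the intervals for every
  sequence of splitting points, including those outside [0, 1].\<close>

definition kak_solution :: "complex \<Rightarrow> (real \<Rightarrow> complex) \<Rightarrow> bool" where
  "kak_solution w \<psi> \<longleftrightarrow> \<psi> \<in> borel_measurable borel \<and> (\<forall>x. norm (\<psi> x) \<le> 1) \<and> (\<forall>x\<le>1. \<psi> x = w) \<and>
     (\<forall>x>1. \<psi> x = (\<integral>u. \<psi> (x * u) * \<psi> (x * (1 - u)) \<partial>unif))"

text \<open>Picard iteration. For |w| <= 1 and x >= 0 it is the generating function at w of the
  number of leaves of the splitting tree cut after n generations.\<close>

primrec kak_iter :: "complex \<Rightarrow> nat \<Rightarrow> real \<Rightarrow> complex" where
  "kak_iter w 0 x = w"
| "kak_iter w (Suc n) x = (if x \<le> 1 then w else (\<integral>u. kak_iter w n (x * u) * kak_iter w n (x * (1 - u)) \<partial>unif))"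

lemma measurable_kak_iter [measurable]: "kak_iter w n \<in> borel_measurable borel"
proof (induction n)
  case (Suc n)
  note [measurable] = Suc
  have "(\<lambda>x. \<integral>u. kak_iter w n (x * u) * kak_iter w n (x * (1 - u)) \<partial>unif) \<in> borel_measurable borel"
    by (rule unif.borel_measurable_lebesgue_integral) measurable
  then show ?case by simp
qed simp

lemma norm_kak_iter_le:
  assumes "norm w \<le> 1"
  shows "norm (kak_iter w n x) \<le> 1"
proof (induction n arbitrary: x)
  case (Suc n)
  have "norm (kak_iter w n (x * u) * kak_iter w n (x * (1 - u))) \<le> 1" for u
    unfolding norm_mult using Suc by (intro mult_le_one) auto
  then have "norm (\<integral>u. kak_iter w n (x * u) * kak_iter w n (x * (1 - u)) \<partial>unif) \<le> (\<integral>u. 1 \<partial>unif)"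
    by (intro norm_integral_unif_le integrable_unif_bounded[of _ 1]) auto
  then show ?case using assms by simp
qed (use assms in simp)

lemma norm_mult_diff_le:
  fixes a b c d :: complex
  assumes "norm b \<le> 1" "norm c \<le> 1"
  shows "norm (a * b - c * d) \<le> norm (a - c) + norm (b - d)"
proof -
  have "a * b - c * d = (a - c) * b + c * (b - d)" by (simp add: algebra_simps)
  also have "norm \<dots> \<le> norm (a - c) * norm b + norm c * norm (b - d)"
    by (metis norm_mult norm_triangle_ineq)
  also have "\<dots> \<le> norm (a - c) + norm (b - d)"
    using assms by (intro add_mono mult_left_le mult_left_le_one_le) auto
  finally show ?thesis .
qed

text \<open>The functional equation is a contraction with factor \<open>1 / 2\<close> for the weight \<open>x\<^sup>3\<close>,
  since \<open>2 * (\<integral>u. u ^ 3) = 1 / 2\<close>.\<close>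

lemma kak_iter_diff_le:
  assumes w: "norm w \<le> 1"
  shows "norm (kak_iter w (Suc n) x - kak_iter w n x) \<le> 2 * \<bar>x\<bar> ^ 3 * (1 / 2) ^ n"
proof (induction n arbitrary: x)
  case 0
  show ?case
  proof (cases "x \<le> 1")
    case False
    then have "1 \<le> \<bar>x\<bar> ^ 3" by (intro one_le_power) auto
    moreover have "norm (kak_iter w (Suc 0) x - kak_iter w 0 x) \<le> 1 + 1"
      using norm_kak_iter_le[OF w] by (intro order_trans[OF norm_triangle_ineq4] add_mono)
    ultimately show ?thesis by simp
  qed simp
next
  case (Suc n)
  let ?k = "kak_iter w n" and ?k' = "kak_iter w (Suc n)"
  note le = norm_kak_iter_le[OF w]
  show ?case
  proof (cases "x \<le> 1")
    case False
    have mk [measurable]: "?k' \<in> borel_measurable borel" by (rule measurable_kak_iter)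
    have int: "integrable unif (\<lambda>u. kak_iter w m (x * u) * kak_iter w m (x * (1 - u)))" for m
      by (rule integrable_unif_bounded[of _ 1]) (auto simp: norm_mult intro!: mult_le_one le)
    let ?c = "2 * (1 / 2) ^ n * \<bar>x\<bar> ^ 3"
    have "kak_iter w (Suc (Suc n)) x - kak_iter w (Suc n) x =
        (\<integral>u. ?k' (x * u) * ?k' (x * (1 - u)) \<partial>unif) - (\<integral>u. ?k (x * u) * ?k (x * (1 - u)) \<partial>unif)"
      using False by (simp only: kak_iter.simps(2)[of w "Suc n"] kak_iter.simps(2)[of w n x] if_False)
    also have "\<dots> = (\<integral>u. ?k' (x * u) * ?k' (x * (1 - u)) - ?k (x * u) * ?k (x * (1 - u)) \<partial>unif)"
      by (rule Bochner_Integration.integral_diff[OF int int, symmetric])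
    finally have "norm (kak_iter w (Suc (Suc n)) x - kak_iter w (Suc n) x) =
        norm (\<integral>u. ?k' (x * u) * ?k' (x * (1 - u)) - ?k (x * u) * ?k (x * (1 - u)) \<partial>unif)" by (rule arg_cong)
    also have "\<dots> \<le> (\<integral>u. ?c * \<bar>u\<bar> ^ 3 + ?c * \<bar>1 - u\<bar> ^ 3 \<partial>unif)"
    proof (intro norm_integral_unif_le Bochner_Integration.integrable_diff int Bochner_Integration.integrable_add
        integrable_mult_right integrable_unif_abs_power integrable_unif_abs_power')
      fix u :: real
      have "norm (?k' (x * u) * ?k' (x * (1 - u)) - ?k (x * u) * ?k (x * (1 - u)))
          \<le> norm (?k' (x * u) - ?k (x * u)) + norm (?k' (x * (1 - u)) - ?k (x * (1 - u)))"
        by (rule norm_mult_diff_le) (rule le)+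
      also have "\<dots> \<le> 2 * \<bar>x * u\<bar> ^ 3 * (1 / 2) ^ n + 2 * \<bar>x * (1 - u)\<bar> ^ 3 * (1 / 2) ^ n"
        by (intro add_mono Suc)
      also have "\<dots> = ?c * \<bar>u\<bar> ^ 3 + ?c * \<bar>1 - u\<bar> ^ 3"
        by (simp add: abs_mult power_mult_distrib mult_ac)
      finally show "norm (?k' (x * u) * ?k' (x * (1 - u)) - ?k (x * u) * ?k (x * (1 - u))) \<le> \<dots>" .
    qed
    also have "\<dots> = ?c * (1 / 4) + ?c * (1 / 4)"
      using integral_unif_two_powers[of ?c 3] by (simp only:) simp
    also have "\<dots> = 2 * \<bar>x\<bar> ^ 3 * (1 / 2) ^ Suc n" by simp
    finally show ?thesis .
  qed simp
qed

text \<open>The increments are summable at each x, so the iterates converge by telescoping; the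
  uniform bound 1 lets the limit pass through the integral.\<close>

lemma kak_solution_exists:
  assumes w: "norm w \<le> 1"
  shows "\<exists>\<psi>. kak_solution w \<psi>"
proof -
  have conv: "convergent (\<lambda>n. kak_iter w n x)" for x
  proof -
    have "summable (\<lambda>n. kak_iter w (Suc n) x - kak_iter w n x)"
    proof (rule summable_comparison_test')
      show "summable (\<lambda>n. 2 * \<bar>x\<bar> ^ 3 * (1 / 2) ^ n)" by (intro summable_mult summable_geometric) simp
      show "norm (kak_iter w (Suc n) x - kak_iter w n x) \<le> 2 * \<bar>x\<bar> ^ 3 * (1 / 2) ^ n" if "n \<ge> 0" for n
        by (rule kak_iter_diff_le[OF w])
    qed
    then have "convergent (\<lambda>n. \<Sum>k<n. kak_iter w (Suc k) x - kak_iter w k x)"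
      by (simp only: summable_iff_convergent)
    then have "convergent (\<lambda>n. kak_iter w n x - kak_iter w 0 x)"
      by (simp only: sum_lessThan_telescope[of "\<lambda>k. kak_iter w k x"])
    then show ?thesis by (simp add: convergent_diff_const_right_iff)
  qed
  define \<psi> where "\<psi> x = lim (\<lambda>n. kak_iter w n x)" for x
  have lim: "(\<lambda>n. kak_iter w n x) \<longlonglongrightarrow> \<psi> x" for x
    using conv unfolding \<psi>_def by (simp add: convergent_LIMSEQ_iff)
  have m [measurable]: "\<psi> \<in> borel_measurable borel"
    by (rule borel_measurable_LIMSEQ_metric[OF _ lim]) measurable
  have "norm (\<psi> x) \<le> 1" for x
    by (rule LIMSEQ_le_const2[OF tendsto_norm[OF lim]]) (use norm_kak_iter_le[OF w] in auto)
  moreover have "\<psi> x = w" if "x \<le> 1" for x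
  proof -
    have "kak_iter w n x = w" for n using that by (cases n) auto
    then show ?thesis using LIMSEQ_unique[OF lim[of x]] by simp
  qed
  moreover have "\<psi> x = (\<integral>u. \<psi> (x * u) * \<psi> (x * (1 - u)) \<partial>unif)" if x: "x > 1" for x
  proof (rule LIMSEQ_unique)
    show "(\<lambda>n. kak_iter w (Suc n) x) \<longlonglongrightarrow> \<psi> x" using lim by (rule LIMSEQ_Suc)
    have "(\<lambda>n. \<integral>u. kak_iter w n (x * u) * kak_iter w n (x * (1 - u)) \<partial>unif) \<longlonglongrightarrow> (\<integral>u. \<psi> (x * u) * \<psi> (x * (1 - u)) \<partial>unif)"
    proof (rule integral_dominated_convergence[where w="\<lambda>_. 1"])
      show "AE u in unif. norm (kak_iter w n (x * u) * kak_iter w n (x * (1 - u))) \<le> 1" for n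
        by (auto simp: norm_mult intro!: mult_le_one norm_kak_iter_le[OF w])
    qed (auto intro!: tendsto_mult lim)
    then show "(\<lambda>n. kak_iter w (Suc n) x) \<longlonglongrightarrow> (\<integral>u. \<psi> (x * u) * \<psi> (x * (1 - u)) \<partial>unif)"
      using x by simp
  qed
  ultimately show ?thesis using m unfolding kak_solution_def by blast
qed

text \<open>Averaging |x u|^k over u gains 1 / (k + 1); with k >= 2 A every pass through
  \<open>gt1\<close> halves the bound H |x|^k. The start is legitimate because h vanishes on [0, 1]
  and |x|^k >= 1 beyond. All is confined to [0, X], where the constants are valid.\<close>

lemma gronwall_unif:
  fixes h :: "real \<Rightarrow> real"
  assumes h [measurable]: "h \<in> borel_measurable borel" and nonneg: "\<And>x. 0 \<le> h x"
    and bound: "\<And>x. 0 \<le> x \<Longrightarrow> x \<le> X \<Longrightarrow> h x \<le> H"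
    and le1: "\<And>x. 0 \<le> x \<Longrightarrow> x \<le> 1 \<Longrightarrow> x \<le> X \<Longrightarrow> h x = 0"
    and gt1: "\<And>x. 1 < x \<Longrightarrow> x \<le> X \<Longrightarrow> h x \<le> A * (\<integral>u. h (x * u) \<partial>unif)"
    and A: "A \<ge> 0" and x: "0 \<le> x" "x \<le> X"
  shows "h x = 0"
proof -
  obtain k :: nat where k: "2 * A \<le> real k" using real_arch_simple by blast
  have H: "0 \<le> H" using bound[OF x] nonneg[of x] by linarith
  have le: "h x \<le> H * \<bar>x\<bar> ^ k * (1 / 2) ^ n" if "0 \<le> x" "x \<le> X" for n x
    using that
  proof (induction n arbitrary: x)
    case 0
    show ?case
    proof (cases "x \<le> 1")
      case False
      then have "1 \<le> \<bar>x\<bar> ^ k" by (intro one_le_power) auto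
      then have "H * 1 \<le> H * \<bar>x\<bar> ^ k" using H by (intro mult_left_mono)
      then show ?thesis using bound[OF 0] by simp
    qed (use 0 le1 H in simp)
  next
    case (Suc n)
    show ?case
    proof (cases "x \<le> 1")
      case False
      let ?c = "H * \<bar>x\<bar> ^ k * (1 / 2) ^ n"
      have xu: "0 \<le> x * u \<and> x * u \<le> X" if "0 \<le> u" "u \<le> 1" for u
      proof
        show "0 \<le> x * u" using that Suc.prems by simp
        have "x * u \<le> x" using that Suc.prems by (simp add: mult_left_le)
        then show "x * u \<le> X" using Suc.prems by simp
      qed
      have "(\<integral>u. h (x * u) \<partial>unif) \<le> (\<integral>u. ?c * \<bar>u\<bar> ^ k \<partial>unif)"
      proof (rule integral_unif_mono)
        show "integrable unif (\<lambda>u. h (x * u))"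
          by (rule integrable_unif_bounded[of _ H]) (use xu bound nonneg in auto)
        show "h (x * u) \<le> ?c * \<bar>u\<bar> ^ k" if "0 \<le> u" "u \<le> 1" for u
          using Suc.IH[of "x * u"] xu[OF that] by (simp add: abs_mult power_mult_distrib mult_ac)
      qed (intro integrable_mult_right integrable_unif_abs_power)
      also have "\<dots> = ?c / real (Suc k)" by (simp add: integral_unif_abs_power)
      finally have "A * (\<integral>u. h (x * u) \<partial>unif) \<le> A * (?c / real (Suc k))" using A by (intro mult_left_mono)
      also have "\<dots> = ?c * (A / real (Suc k))" by simp
      also have "\<dots> \<le> ?c * (1 / 2)"
        using k H by (intro mult_left_mono) (auto simp: field_simps)
      finally show ?thesis using gt1[of x] False Suc.prems by simp
    qed (use Suc le1 H in simp)
  qed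
  have "(\<lambda>n. H * \<bar>x\<bar> ^ k * (1 / 2) ^ n) \<longlonglongrightarrow> H * \<bar>x\<bar> ^ k * 0"
    by (intro tendsto_intros LIMSEQ_power_zero) simp
  then have "h x \<le> H * \<bar>x\<bar> ^ k * 0"
    by (rule LIMSEQ_le_const) (use le[OF x] in auto)
  then show ?thesis using nonneg[of x] by simp
qed

section \<open>Mean and variance of the number of intervals\<close>

definition kv :: real where "kv = 8 * ln 2 - 5"

lemma kv_bounds: "1 / 3 \<le> kv" "kv \<le> 3"
proof -
  show "1 / 3 \<le> kv" using ln2_ge_two_thirds by (simp add: kv_def)
  have "ln (2::real) \<le> 1" using ln_le_minus_one[of 2] by simp
  then show "kv \<le> 3" by (simp add: kv_def)
qed

text \<open>For the number \<open>Y\<close> of intervals produced from one interval of relative length \<open>x\<close>,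
  \<open>kak_a x\<close> is the mean of \<open>Y - 2 * x\<close>, and \<open>kak_b x\<close> is its second moment minus \<open>kv * x\<close>.\<close>

definition kak_a :: "real \<Rightarrow> real" where
  "kak_a x = (if x \<le> 1 then 1 - 2 * x else 0)"

definition kak_b :: "real \<Rightarrow> real" where
  "kak_b x = (if x \<le> 1 then (1 - 2 * x)\<^sup>2 - kv * x
     else if x \<le> 2 then - 4 * x\<^sup>2 + 2 * x + 8 * x * ln x + 2 - kv * x else 0)"

lemma measurable_kak_a [measurable]: "kak_a \<in> borel_measurable borel"
  and measurable_kak_b [measurable]: "kak_b \<in> borel_measurable borel"
  unfolding kak_a_def kak_b_def by measurable

lemma abs_kak_a_le: "0 \<le> x \<Longrightarrow> \<bar>kak_a x\<bar> \<le> 1"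
  by (auto simp: kak_a_def)

lemma abs_kak_b_le:
  assumes "0 \<le> x"
  shows "\<bar>kak_b x\<bar> \<le> 50"
proof (cases "x \<le> 1")
  case True
  have "\<bar>1 - 2 * x\<bar> \<le> 1" using True assms by auto
  then have "(1 - 2 * x)\<^sup>2 \<le> 1" by (simp add: abs_square_le_1)
  moreover have "0 \<le> kv * x" using kv_bounds assms by simp
  moreover have "kv * x \<le> 3 * 1" using kv_bounds True assms by (intro mult_mono) auto
  moreover have "0 \<le> (1 - 2 * x)\<^sup>2" by simp
  moreover have "kak_b x = (1 - 2 * x)\<^sup>2 - kv * x" using True by (simp add: kak_b_def)
  ultimately show ?thesis by linarith
next
  case False
  show ?thesis
  proof (cases "x \<le> 2")
    case True
    have "x\<^sup>2 \<le> 4" using power_mono[of x 2 2] True False by simp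
    moreover have "0 \<le> x\<^sup>2" by simp
    moreover have "0 \<le> ln x" "ln x \<le> 1" using False True ln_le_minus_one[of x] by auto
    then have "0 \<le> x * ln x" "x * ln x \<le> 2 * 1" using True False by (simp, intro mult_mono, auto)
    moreover have "0 \<le> kv * x" using kv_bounds False by simp
    moreover have "kv * x \<le> 3 * 2" using kv_bounds True False by (intro mult_mono) auto
    moreover have "kak_b x = - 4 * x\<^sup>2 + 2 * x + 8 * (x * ln x) + 2 - kv * x"
      using True False by (simp add: kak_b_def)
    ultimately show ?thesis using True False by linarith
  qed (use False in \<open>simp add: kak_b_def\<close>)
qed

text \<open>The positive and negative parts of 1 - 2 x on [0, 1] cancel, and every x > 1 sees all of
  them. This is why the mean is exactly 2 x above 1.\<close>

lemma integral_kak_a: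
  assumes x: "x > 1"
  shows "(\<integral>u. kak_a (x * u) \<partial>unif) = 0"
proof -
  \<comment> \<open>\<open>min\<close> freezes the primitive at 1, beyond which the integrand
    vanishes; this keeps it continuous.\<close>
  let ?G = "\<lambda>y::real. min y 1 - (min y 1)\<^sup>2"
  have "(\<integral>u. kak_a (x * u) \<partial>unif) = (?G x - ?G 0) / x"
  proof (rule integral_unif_scale[where S="{1}" and B=1])
    fix y :: real assume y: "0 < y" "y < x" "y \<notin> {1}"
    show "(?G has_real_derivative kak_a y) (at y)"
    proof (cases "y < 1")
      case True
      show ?thesis
        by (rule has_field_derivative_transform_within_open[of "\<lambda>y. y - y\<^sup>2" _ _ "{..<1}"])
           (use True in \<open>auto intro!: derivative_eq_intros simp: kak_a_def\<close>)
    next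
      case False
      show ?thesis
        by (rule has_field_derivative_transform_within_open[of "\<lambda>y. 0" _ _ "{1<..}"])
           (use False y in \<open>auto simp: kak_a_def\<close>)
    qed
  qed (use x in \<open>auto intro!: continuous_intros abs_kak_a_le\<close>)
  then show ?thesis using x by simp
qed

text \<open>At x = 2 the numerator is 16 ln 2 - 10 - 2 \<open>kv\<close>, which determines
  \<open>kv\<close>: with any other value the correction would not stop at 2.\<close>

lemma integral_kak_b:
  assumes x: "x > 1"
  shows "(\<integral>u. kak_b (x * u) \<partial>unif) =
    (if x \<le> 2 then - (4 / 3) * x ^ 3 - x\<^sup>2 + 4 * x\<^sup>2 * ln x + 2 * x + 2 / 3 - kv * x\<^sup>2 / 2 else 0) / x"
proof -
  define P1 where "P1 y = y - 2 * y\<^sup>2 + 4 / 3 * y ^ 3 - kv * y\<^sup>2 / 2" for y :: real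
  define P2 where "P2 y = - (4 / 3) * y ^ 3 - y\<^sup>2 + 4 * y\<^sup>2 * ln y + 2 * y - kv * y\<^sup>2 / 2" for y :: real
  have P1: "(P1 has_real_derivative (1 - 2 * y)\<^sup>2 - kv * y) (at y)" for y
    unfolding P1_def by (auto intro!: derivative_eq_intros simp: power2_eq_square field_simps)
  have P2: "(P2 has_real_derivative - 4 * y\<^sup>2 + 2 * y + 8 * y * ln y + 2 - kv * y) (at y)" if "y > 0" for y
    unfolding P2_def using that by (auto intro!: derivative_eq_intros simp: power2_eq_square field_simps)
  \<comment> \<open>Each primitive is clamped to its own piece and is constant outside it.\<close>
  let ?G = "\<lambda>y::real. P1 (min y 1) + P2 (max 1 (min y 2)) - P2 1"
  have "(\<integral>u. kak_b (x * u) \<partial>unif) = (?G x - ?G 0) / x"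
  proof (rule integral_unif_scale[where S="{1, 2}" and B=50])
    fix y :: real assume y: "0 < y" "y < x" "y \<notin> {1, 2}"
    consider "y < 1" | "1 < y" "y < 2" | "2 < y" using y by fastforce
    then show "(?G has_real_derivative kak_b y) (at y)"
    proof cases
      case 1
      show ?thesis
        by (rule has_field_derivative_transform_within_open[of P1 _ _ "{..<1}"])
           (use 1 P1[of y] in \<open>auto simp: kak_b_def\<close>)
    next
      case 2
      show ?thesis
        by (rule has_field_derivative_transform_within_open[of "\<lambda>y. P1 1 + P2 y - P2 1" _ _ "{1<..<2}"])
           (use 2 P2[of y] in \<open>auto simp: kak_b_def intro!: derivative_eq_intros\<close>)
    next
      case 3
      show ?thesis
        by (rule has_field_derivative_transform_within_open[of "\<lambda>y. P1 1 + P2 2 - P2 1" _ _ "{2<..}"])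
           (use 3 in \<open>auto simp: kak_b_def\<close>)
    qed
  next
    show "continuous_on {0..x} ?G" unfolding P1_def P2_def by (intro continuous_intros) auto
  qed (use x abs_kak_b_le in auto)
  moreover have "?G 0 = 0" by (simp add: P1_def)
  moreover have "?G x = (if x \<le> 2 then - (4 / 3) * x ^ 3 - x\<^sup>2 + 4 * x\<^sup>2 * ln x + 2 * x + 2 / 3 - kv * x\<^sup>2 / 2 else 0)"
    using x by (auto simp: P1_def P2_def kv_def diff_divide_distrib)
  ultimately show ?thesis by simp
qed

text \<open>Both x u and x - x u must be at most 1, so in the variable y = x u the integrand lives
  on [x - 1, 1], which is empty for x > 2.\<close>

lemma integral_kak_a_a:
  assumes x: "x > 1"
  shows "(\<integral>u. kak_a (x * u) * kak_a (x * (1 - u)) \<partial>unif) =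
    (if x \<le> 2 then - (2 / 3) * x ^ 3 + 2 * x\<^sup>2 - x - 2 / 3 else 0) / x"
proof -
  define Q where "Q y = (1 - 2 * x) * y + 2 * x * y\<^sup>2 - 4 / 3 * y ^ 3" for y
  have Q: "(Q has_real_derivative (1 - 2 * y) * (1 - 2 * (x - y))) (at y)" for y
    unfolding Q_def by (auto intro!: derivative_eq_intros simp: power2_eq_square field_simps)
  let ?G = "\<lambda>y. if x \<le> 2 then Q (max (x - 1) (min y 1)) else 0"
  have "(\<integral>u. kak_a (x * u) * kak_a (x - x * u) \<partial>unif) = (?G x - ?G 0) / x"
  proof (rule integral_unif_scale[where S="{x - 1, 1}" and B=1])
    fix y :: real assume y: "0 < y" "y < x" "y \<notin> {x - 1, 1}"
    show "(?G has_real_derivative kak_a y * kak_a (x - y)) (at y)"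
    proof (cases "x \<le> 2")
      case True
      consider "y < x - 1" | "x - 1 < y" "y < 1" | "1 < y" using y by fastforce
      then show ?thesis
      proof cases
        case 1
        show ?thesis
          by (rule has_field_derivative_transform_within_open[of "\<lambda>y. Q (x - 1)" _ _ "{..<x - 1}"])
             (use 1 True in \<open>auto simp: kak_a_def max_def min_def\<close>)
      next
        case 2
        show ?thesis
          by (rule has_field_derivative_transform_within_open[of Q _ _ "{x - 1<..<1}"])
             (use 2 True Q[of y] in \<open>auto simp: kak_a_def max_def min_def\<close>)
      next
        case 3
        show ?thesis
          by (rule has_field_derivative_transform_within_open[of "\<lambda>y. Q 1" _ _ "{1<..}"])
             (use 3 True in \<open>auto simp: kak_a_def max_def min_def\<close>)
      qed
    qed (auto simp: kak_a_def)
  next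
    show "continuous_on {0..x} ?G" unfolding Q_def by (cases "x \<le> 2") (auto intro!: continuous_intros)
    show "\<bar>kak_a y * kak_a (x - y)\<bar> \<le> 1" if "0 \<le> y" "y \<le> x" for y
      using that abs_kak_a_le by (simp add: abs_mult mult_le_one)
  qed (use x in auto)
  also have "?G x - ?G 0 = (if x \<le> 2 then - (2 / 3) * x ^ 3 + 2 * x\<^sup>2 - x - 2 / 3 else 0)"
    using x by (auto simp: Q_def max_def min_def power2_eq_square power3_eq_cube field_simps)
  finally show ?thesis by (simp add: algebra_simps)
qed

text \<open>Given the split, the two counts are independent: the second moment of the sum is the sum
  of the second moments plus twice the product of the means. The linear term passes through because
  the two lengths add up to x.\<close>

lemma kak_b_equation:
  assumes "x > 1"
  shows "kak_b x = 2 * (\<integral>u. kak_b (x * u) \<partial>unif) + 2 * (\<integral>u. kak_a (x * u) * kak_a (x * (1 - u)) \<partial>unif)"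
  unfolding integral_kak_b[OF assms] integral_kak_a_a[OF assms] using assms
  by (auto simp: kak_b_def power2_eq_square power3_eq_cube field_simps)

text \<open>The second order expansion in s of exp (- 2 i s x + kv s^2 x / 2) times the expectation
  of exp (i s Y): the mean contributes i s \<open>kak_a x\<close>, and the second moment combines
  with the exponent kv s^2 x / 2 to - s^2 \<open>kak_b x\<close> / 2.\<close>

definition kak_tau :: "real \<Rightarrow> real \<Rightarrow> complex" where
  "kak_tau s x = Complex (1 - s\<^sup>2 * kak_b x / 2) (s * kak_a x)"

definition kak_theta :: "real \<Rightarrow> (real \<Rightarrow> complex) \<Rightarrow> real \<Rightarrow> complex" where
  "kak_theta s \<psi> x = exp (of_real x * Complex (kv * s\<^sup>2 / 2) (- 2 * s)) * \<psi> x"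

lemma measurable_kak_tau [measurable]: "kak_tau s \<in> borel_measurable borel"
  unfolding kak_tau_def Complex_eq by measurable

lemma measurable_kak_theta: "\<psi> \<in> borel_measurable borel \<Longrightarrow> kak_theta s \<psi> \<in> borel_measurable borel"
  unfolding kak_theta_def by measurable

text \<open>This deviation, confined to x <= 2, becomes the coefficient of the cross terms in
  \<open>kak_op\<close>; 26 is 1 + 50 / 2.\<close>

lemma norm_kak_tau_minus_1:
  assumes s: "\<bar>s\<bar> \<le> 1" and x: "0 \<le> x"
  shows "norm (kak_tau s x - 1) \<le> 26 * \<bar>s\<bar> * indicator {..2} x"
proof (cases "x \<le> 2")
  case True
  have "norm (kak_tau s x - 1) \<le> \<bar>s\<^sup>2 * kak_b x / 2\<bar> + \<bar>s * kak_a x\<bar>"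
    using cmod_le[of "kak_tau s x - 1"] by (simp add: kak_tau_def)
  also have "\<bar>s\<^sup>2 * kak_b x / 2\<bar> = (\<bar>s\<bar> * \<bar>s\<bar>) * (\<bar>kak_b x\<bar> / 2)"
    by (simp add: abs_mult power2_eq_square)
  also have "\<dots> \<le> (\<bar>s\<bar> * 1) * (50 / 2)"
    using s abs_kak_b_le[OF x] by (intro mult_mono) auto
  also have "\<bar>s * kak_a x\<bar> \<le> \<bar>s\<bar> * 1"
    unfolding abs_mult using abs_kak_a_le[OF x] by (intro mult_left_mono) auto
  finally show ?thesis using True by simp
qed (simp add: kak_tau_def kak_a_def kak_b_def Complex_eq)

text \<open>Order s vanishes by \<open>integral_kak_a\<close>, order s^2 by
  \<open>kak_b_equation\<close>. What remains is a real part of order s^4 and an imaginary part of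
  order s^3, at most 625 |s|^3 and 50 |s|^3 by the bounds 1 and 50 on \<open>kak_a\<close> and
  \<open>kak_b\<close>.\<close>

lemma kak_tau_equation:
  assumes s: "\<bar>s\<bar> \<le> 1" and x: "x > 1"
  shows "norm (kak_tau s x - (\<integral>u. kak_tau s (x * u) * kak_tau s (x * (1 - u)) \<partial>unif)) \<le> 700 * \<bar>s\<bar> ^ 3"
proof -
  let ?a = "\<lambda>u. kak_a (x * u)" and ?a' = "\<lambda>u. kak_a (x * (1 - u))"
  let ?b = "\<lambda>u. kak_b (x * u)" and ?b' = "\<lambda>u. kak_b (x * (1 - u))"
  have a: "\<bar>?a u\<bar> \<le> 1" "\<bar>?a' u\<bar> \<le> 1" "\<bar>?b u\<bar> \<le> 50" "\<bar>?b' u\<bar> \<le> 50" if "0 \<le> u" "u \<le> 1" for u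
    using that x by (auto intro!: abs_kak_a_le abs_kak_b_le)
  have p: "\<bar>?a u * ?a' u\<bar> \<le> 1 * 1" "\<bar>?b u * ?b' u\<bar> \<le> 50 * 50" "\<bar>?a' u * ?b u\<bar> \<le> 1 * 50"  "\<bar>?a u * ?b' u\<bar> \<le> 1 * 50"
    if "0 \<le> u" "u \<le> 1" for u
    unfolding abs_mult using a[OF that] by (intro mult_mono; simp)+
  have int: "integrable unif ?a" "integrable unif ?a'" "integrable unif ?b" "integrable unif ?b'"
    using integrable_unif_bounded[of ?a 1] integrable_unif_bounded[of ?a' 1]
      integrable_unif_bounded[of ?b 50] integrable_unif_bounded[of ?b' 50] a by simp_all
  have intp: "integrable unif (\<lambda>u. ?a u * ?a' u)" "integrable unif (\<lambda>u. ?b u * ?b' u)"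
    "integrable unif (\<lambda>u. ?a' u * ?b u)" "integrable unif (\<lambda>u. ?a u * ?b' u)"
    using integrable_unif_bounded[of "\<lambda>u. ?a u * ?a' u" "1 * 1"] integrable_unif_bounded[of "\<lambda>u. ?b u * ?b' u" "50 * 50"]
      integrable_unif_bounded[of "\<lambda>u. ?a' u * ?b u" "1 * 50"] integrable_unif_bounded[of "\<lambda>u. ?a u * ?b' u" "1 * 50"] p
    by simp_all
  have ref: "(\<integral>u. ?a' u \<partial>unif) = (\<integral>u. ?a u \<partial>unif)" "(\<integral>u. ?b' u \<partial>unif) = (\<integral>u. ?b u \<partial>unif)"
    by (rule integral_unif_reflect[where f="?a"], simp) (rule integral_unif_reflect[where f="?b"], simp)
  let ?I = "\<integral>u. kak_tau s (x * u) * kak_tau s (x * (1 - u)) \<partial>unif"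
  have intt: "integrable unif (\<lambda>u. kak_tau s (x * u) * kak_tau s (x * (1 - u)))"
  proof (rule integrable_unif_bounded[of _ "27 * 27"])
    have "norm (kak_tau s y) \<le> 27" if "0 \<le> y" for y
    proof -
      have "26 * \<bar>s\<bar> * indicator {..2} y \<le> 26" using s by (auto simp: indicator_def)
      then show ?thesis
        using norm_kak_tau_minus_1[OF s that] norm_triangle_ineq[of "kak_tau s y - 1" 1] by simp
    qed
    then show "norm (kak_tau s (x * u) * kak_tau s (x * (1 - u))) \<le> 27 * 27" if "0 \<le> u" "u \<le> 1" for u
      unfolding norm_mult using that x by (intro mult_mono) auto
  qed measurable
  have "Re ?I = (\<integral>u. 1 - s\<^sup>2 / 2 * ?b u - s\<^sup>2 / 2 * ?b' u - s\<^sup>2 * (?a u * ?a' u) + s ^ 4 / 4 * (?b u * ?b' u) \<partial>unif)"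
    unfolding integral_Re[OF intt, symmetric]
    by (intro Bochner_Integration.integral_cong) (auto simp: kak_tau_def power2_eq_square power4_eq_xxxx field_simps)
  also have "\<dots> = 1 - s\<^sup>2 / 2 * (\<integral>u. ?b u \<partial>unif) - s\<^sup>2 / 2 * (\<integral>u. ?b' u \<partial>unif) - s\<^sup>2 * (\<integral>u. ?a u * ?a' u \<partial>unif)
     + s ^ 4 / 4 * (\<integral>u. ?b u * ?b' u \<partial>unif)"
    using int intp by simp
  also have "\<dots> = Re (kak_tau s x) + s ^ 4 / 4 * (\<integral>u. ?b u * ?b' u \<partial>unif)"
    unfolding ref kak_tau_def kak_b_equation[OF x] by (simp add: algebra_simps)
  finally have re: "Re (kak_tau s x - ?I) = - (s ^ 4 / 4 * (\<integral>u. ?b u * ?b' u \<partial>unif))" by simp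
  have "Im ?I = (\<integral>u. s * ?a u + s * ?a' u - s ^ 3 / 2 * (?a' u * ?b u) - s ^ 3 / 2 * (?a u * ?b' u) \<partial>unif)"
    unfolding integral_Im[OF intt, symmetric]
    by (intro Bochner_Integration.integral_cong) (auto simp: kak_tau_def power2_eq_square power3_eq_cube field_simps)
  also have "\<dots> = s * (\<integral>u. ?a u \<partial>unif) + s * (\<integral>u. ?a' u \<partial>unif) - s ^ 3 / 2 * (\<integral>u. ?a' u * ?b u \<partial>unif) - s ^ 3 / 2 * (\<integral>u. ?a u * ?b' u \<partial>unif)"
    using int intp by simp
  also have "\<dots> = - (s ^ 3 / 2 * (\<integral>u. ?a' u * ?b u \<partial>unif) + s ^ 3 / 2 * (\<integral>u. ?a u * ?b' u \<partial>unif))"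
    unfolding ref integral_kak_a[OF x] by simp
  finally have im: "Im (kak_tau s x - ?I) = s ^ 3 / 2 * ((\<integral>u. ?a' u * ?b u \<partial>unif) + (\<integral>u. ?a u * ?b' u \<partial>unif))"
    using x by (simp add: kak_tau_def kak_a_def algebra_simps)
  have bb: "\<bar>\<integral>u. ?b u * ?b' u \<partial>unif\<bar> \<le> 2500"
    using norm_integral_unif_le[OF intp(2), of "\<lambda>_. 2500"] p(2) by simp
  have ab: "\<bar>\<integral>u. ?a' u * ?b u \<partial>unif\<bar> \<le> 50" "\<bar>\<integral>u. ?a u * ?b' u \<partial>unif\<bar> \<le> 50"
    using norm_integral_unif_le[OF intp(3), of "\<lambda>_. 50"] norm_integral_unif_le[OF intp(4), of "\<lambda>_. 50"] p(3,4) by simp_all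
  have s4: "\<bar>s\<bar> ^ 4 \<le> \<bar>s\<bar> ^ 3" using s by (intro power_decreasing) auto
  have "\<bar>Re (kak_tau s x - ?I)\<bar> = \<bar>s\<bar> ^ 4 / 4 * \<bar>\<integral>u. ?b u * ?b' u \<partial>unif\<bar>"
    unfolding re by (simp add: abs_mult power_abs)
  also have "\<dots> \<le> \<bar>s\<bar> ^ 3 / 4 * 2500" using s4 bb by (intro mult_mono) auto
  finally have r: "\<bar>Re (kak_tau s x - ?I)\<bar> \<le> 625 * \<bar>s\<bar> ^ 3" by simp
  have "\<bar>Im (kak_tau s x - ?I)\<bar> = \<bar>s\<bar> ^ 3 / 2 * \<bar>(\<integral>u. ?a' u * ?b u \<partial>unif) + (\<integral>u. ?a u * ?b' u \<partial>unif)\<bar>"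
    unfolding im by (simp add: abs_mult power_abs)
  also have "\<dots> \<le> \<bar>s\<bar> ^ 3 / 2 * 100" using ab by (intro mult_left_mono) auto
  finally have i: "\<bar>Im (kak_tau s x - ?I)\<bar> \<le> 50 * \<bar>s\<bar> ^ 3" by simp
  have "0 \<le> \<bar>s\<bar> ^ 3" by simp
  with cmod_le[of "kak_tau s x - ?I"] r i show ?thesis by linarith
qed

text \<open>Below 1 the solution is constant, so \<open>kak_theta\<close> is exp z with an explicit
  z of order s. The quadratic Taylor polynomial of exp at z differs from \<open>kak_tau\<close> only
  in orders s^3 and s^4. The result is the initial error of the comparison.\<close>

lemma kak_theta_minus_tau_le1:
  assumes s: "\<bar>s\<bar> \<le> 1" and x: "0 \<le> x" "x \<le> 1" and \<psi>: "\<psi> x = cis s"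
  shows "norm (kak_theta s \<psi> x - kak_tau s x) \<le> 80 * \<bar>s\<bar> ^ 3"
proof -
  define p where "p = kv * x / 2"
  define a where "a = 1 - 2 * x"
  define z where "z = Complex (p * s\<^sup>2) (s * a)"
  have "kv * x \<le> 3 * 1" using kv_bounds x by (intro mult_mono) auto
  then have p: "0 \<le> p" "p \<le> 3 / 2" using kv_bounds x by (auto simp: p_def)
  have a: "\<bar>a\<bar> \<le> 1" using x by (auto simp: a_def)
  have "s\<^sup>2 \<le> 1" using s by (simp add: abs_square_le_1)
  have s2: "s\<^sup>2 \<le> \<bar>s\<bar>" using s mult_left_le[of "\<bar>s\<bar>" "\<bar>s\<bar>"] by (simp add: power2_eq_square)
  have pz: "p * s\<^sup>2 \<le> 3 / 2 * \<bar>s\<bar>" using p s2 by (intro mult_mono) auto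
  have theta: "kak_theta s \<psi> x = exp z"
  proof -
    have "of_real x * Complex (kv * s\<^sup>2 / 2) (- 2 * s) + \<i> * of_real s = z"
      by (simp add: complex_eq_iff z_def p_def a_def algebra_simps)
    then show ?thesis
      unfolding kak_theta_def \<psi> cis_conv_exp exp_add[symmetric] by simp
  qed
  have nz: "cmod z \<le> 5 / 2 * \<bar>s\<bar>"
  proof -
    have "cmod z \<le> \<bar>p * s\<^sup>2\<bar> + \<bar>s * a\<bar>" using cmod_le[of z] by (simp add: z_def)
    also have "\<bar>s * a\<bar> \<le> \<bar>s\<bar> * 1" unfolding abs_mult using a by (intro mult_left_mono) auto
    finally show ?thesis using pz p by simp
  qed
  have "cmod (exp z - (\<Sum>k\<le>2. z ^ k / fact k)) \<le> exp \<bar>Re z\<bar> * cmod z ^ Suc 2 / fact 2"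
    by (rule Taylor_exp)
  also have "(\<Sum>k\<le>2. z ^ k / fact k) = 1 + z + z\<^sup>2 / 2"
    by (simp add: numeral_2_eq_2)
  also have "exp \<bar>Re z\<bar> * cmod z ^ Suc 2 / fact 2 \<le> 9 * (5 / 2 * \<bar>s\<bar>) ^ 3 / 2"
  proof -
    have "\<bar>Re z\<bar> \<le> 2" using pz p s by (auto simp: z_def)
    then have "exp \<bar>Re z\<bar> \<le> exp (1 + 1 :: real)" by simp
    also have "\<dots> \<le> 3 * 3" unfolding exp_add using exp_le by (intro mult_mono) auto
    finally have "exp \<bar>Re z\<bar> \<le> 9" by simp
    moreover have "cmod z ^ 3 \<le> (5 / 2 * \<bar>s\<bar>) ^ 3" using nz by (intro power_mono) auto
    ultimately have "exp \<bar>Re z\<bar> * cmod z ^ 3 \<le> 9 * (5 / 2 * \<bar>s\<bar>) ^ 3" by (intro mult_mono) auto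
    then show ?thesis by (simp add: numeral_3_eq_3[symmetric] fact_2)
  qed
  also have "\<dots> \<le> 75 * \<bar>s\<bar> ^ 3" by (simp add: power_mult_distrib power_divide)
  finally have 1: "cmod (exp z - (1 + z + z\<^sup>2 / 2)) \<le> 75 * \<bar>s\<bar> ^ 3" .
  have "1 + z + z\<^sup>2 / 2 - kak_tau s x = Complex (p\<^sup>2 * s ^ 4 / 2) (p * s ^ 3 * a)"
    using x by (simp add: complex_eq_iff z_def kak_tau_def kak_a_def kak_b_def p_def a_def
        power2_eq_square power3_eq_cube power4_eq_xxxx field_simps)
  then have "cmod (1 + z + z\<^sup>2 / 2 - kak_tau s x) \<le> \<bar>p\<^sup>2 * s ^ 4 / 2\<bar> + \<bar>p * s ^ 3 * a\<bar>"
    using cmod_le[of "1 + z + z\<^sup>2 / 2 - kak_tau s x"] by simp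
  also have "\<bar>p\<^sup>2 * s ^ 4 / 2\<bar> \<le> 9 / 4 * \<bar>s\<bar> ^ 3 / 2"
  proof -
    have "p\<^sup>2 \<le> (3 / 2)\<^sup>2" using p by (intro power_mono) auto
    moreover have "\<bar>s\<bar> ^ 4 \<le> \<bar>s\<bar> ^ 3" using s by (intro power_decreasing) auto
    ultimately have "p\<^sup>2 * \<bar>s\<bar> ^ 4 \<le> 9 / 4 * \<bar>s\<bar> ^ 3" by (intro mult_mono) (auto simp: power_divide)
    then show ?thesis by (simp add: abs_mult)
  qed
  also have "\<bar>p * s ^ 3 * a\<bar> \<le> 3 / 2 * \<bar>s\<bar> ^ 3 * 1"
    unfolding abs_mult power_abs using p a by (intro mult_mono) auto
  finally have 2: "cmod (1 + z + z\<^sup>2 / 2 - kak_tau s x) \<le> 9 / 4 * \<bar>s\<bar> ^ 3 / 2 + 3 / 2 * \<bar>s\<bar> ^ 3 * 1" by simp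
  have "0 \<le> \<bar>s\<bar> ^ 3" by simp
  moreover have eq: "kak_theta s \<psi> x - kak_tau s x = (exp z - (1 + z + z\<^sup>2 / 2)) + (1 + z + z\<^sup>2 / 2 - kak_tau s x)"
    by (simp add: theta)
  ultimately show ?thesis unfolding eq using 1 2 norm_triangle_ineq[of "exp z - (1 + z + z\<^sup>2 / 2)" "1 + z + z\<^sup>2 / 2 - kak_tau s x"]
    by linarith
qed

text \<open>With e = theta - tau, and primes for the second child, theta theta' - tau tau' = e + e'
  + e e' + e (tau' - 1) + e' (tau - 1). The operator bounds its modulus, \<open>f\<close> standing
  for |e| and \<open>c\<close> for the size of tau - 1. Replacing the indicators by 1 would leave
  cross terms growing with x that the supersolution could not absorb.\<close>

definition kak_op :: "real \<Rightarrow> real \<Rightarrow> (real \<Rightarrow> real) \<Rightarrow> real \<Rightarrow> real" where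
  "kak_op c x f u = f (x * u) + f (x * (1 - u)) + f (x * u) * f (x * (1 - u)) +
     c * (f (x * u) * indicator {..2} (x * (1 - u)) + f (x * (1 - u)) * indicator {..2} (x * u))"

lemma measurable_kak_op [measurable (raw)]:
  assumes [measurable]: "f \<in> borel_measurable borel"
  shows "kak_op c x f \<in> borel_measurable borel"
  unfolding kak_op_def by measurable

lemma scale_mem:
  fixes x u :: real
  assumes "0 \<le> x" "x \<le> X" "0 \<le> u" "u \<le> 1"
  shows "0 \<le> x * u" "x * u \<le> X" "0 \<le> x * (1 - u)" "x * (1 - u) \<le> X"
proof -
  have "x * u \<le> x" "x * (1 - u) \<le> x" using assms by (auto intro: mult_left_le)
  with assms show "0 \<le> x * u" "x * u \<le> X" "0 \<le> x * (1 - u)" "x * (1 - u) \<le> X" by auto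
qed

lemma integrable_kak_op:
  assumes f: "f \<in> borel_measurable borel" and bound: "\<And>y. 0 \<le> y \<Longrightarrow> y \<le> x \<Longrightarrow> \<bar>f y\<bar> \<le> \<Gamma>" and x: "0 \<le> x" and c: "0 \<le> c" "c \<le> 1"
  shows "integrable unif (kak_op c x f)"
proof (rule integrable_unif_bounded[of _ "\<Gamma> + \<Gamma> + \<Gamma> * \<Gamma> + 1 * (\<Gamma> + \<Gamma>)"])
  fix u :: real assume u: "0 \<le> u" "u \<le> 1"
  note m = scale_mem[OF x order_refl u]
  have b: "\<bar>f (x * u)\<bar> \<le> \<Gamma>" "\<bar>f (x * (1 - u))\<bar> \<le> \<Gamma>" using bound m by auto
  then have G: "0 \<le> \<Gamma>" by linarith
  have ind: "\<bar>f (x * u) * indicator {..2} (x * (1 - u))\<bar> \<le> \<Gamma>" "\<bar>f (x * (1 - u)) * indicator {..2} (x * u)\<bar> \<le> \<Gamma>"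
    using b G by (auto simp: indicator_def)
  have "\<bar>f (x * u) * f (x * (1 - u))\<bar> \<le> \<Gamma> * \<Gamma>" unfolding abs_mult using b by (intro mult_mono) auto
  moreover have "\<bar>c * (f (x * u) * indicator {..2} (x * (1 - u)) + f (x * (1 - u)) * indicator {..2} (x * u))\<bar> \<le> 1 * (\<Gamma> + \<Gamma>)"
    unfolding abs_mult[of c] using ind c by (intro mult_mono) auto
  ultimately show "norm (kak_op c x f u) \<le> \<Gamma> + \<Gamma> + \<Gamma> * \<Gamma> + 1 * (\<Gamma> + \<Gamma>)"
    unfolding kak_op_def real_norm_def using b by linarith
qed (use f in measurable)

text \<open>Monotonicity of the operator on nonnegative functions gives the positive part of f - g a
  linear inequality without source, and \<open>gronwall_unif\<close> makes it zero. In 2 * (2 +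
  \<Gamma>), each child pays 1 for the linear term, \<Gamma> for the product and 1 for the cross
  term.\<close>

lemma kak_op_comparison:
  fixes f g :: "real \<Rightarrow> real"
  assumes f [measurable]: "f \<in> borel_measurable borel" and g [measurable]: "g \<in> borel_measurable borel"
    and fb: "\<And>y. 0 \<le> y \<Longrightarrow> y \<le> X \<Longrightarrow> 0 \<le> f y \<and> f y \<le> \<Gamma>"
    and gb: "\<And>y. 0 \<le> y \<Longrightarrow> y \<le> X \<Longrightarrow> 0 \<le> g y \<and> g y \<le> \<Gamma>"
    and c: "0 \<le> c" "c \<le> 1"
    and le1: "\<And>y. 0 \<le> y \<Longrightarrow> y \<le> 1 \<Longrightarrow> f y \<le> g y"
    and sub: "\<And>y. 1 < y \<Longrightarrow> y \<le> X \<Longrightarrow> f y \<le> (\<integral>u. kak_op c y f u \<partial>unif) + e"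
    and super: "\<And>y. 1 < y \<Longrightarrow> y \<le> X \<Longrightarrow> (\<integral>u. kak_op c y g u \<partial>unif) + e \<le> g y"
    and x: "0 \<le> x" "x \<le> X"
  shows "f x \<le> g x"
proof -
  define h where "h y = max 0 (f y - g y)" for y
  have h [measurable]: "h \<in> borel_measurable borel" unfolding h_def by measurable
  have G: "0 \<le> \<Gamma>" using fb[OF x] by linarith
  have hb: "h y \<le> \<Gamma>" "\<bar>h y\<bar> \<le> \<Gamma>" if "0 \<le> y" "y \<le> X" for y using fb[OF that] gb[OF that] G by (auto simp: h_def)
  have "h x = 0"
  proof (rule gronwall_unif[of h X \<Gamma> "2 * (2 + \<Gamma>)" x])
    fix y assume y: "1 < y" "y \<le> X"
    have y0: "0 \<le> y" using y by simp
    have int: "integrable unif (kak_op c y f)" "integrable unif (kak_op c y g)"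
      by (rule integrable_kak_op[of _ _ \<Gamma>]; use y c fb gb in force)+
    have inth: "integrable unif (\<lambda>u. h (y * u))" "integrable unif (\<lambda>u. h (y * (1 - u)))"
      by (rule integrable_unif_bounded[of _ \<Gamma>]; use hb(2) scale_mem[OF y0 y(2)] in simp)+
    have ref: "(\<integral>u. h (y * (1 - u)) \<partial>unif) = (\<integral>u. h (y * u) \<partial>unif)"
      by (rule integral_unif_reflect[where f="\<lambda>u. h (y * u)"]) measurable
    have "f y - g y \<le> (\<integral>u. kak_op c y f u - kak_op c y g u \<partial>unif)"
      using sub[OF y] super[OF y] int by simp
    also have "\<dots> \<le> (\<integral>u. (2 + \<Gamma>) * h (y * u) + (2 + \<Gamma>) * h (y * (1 - u)) \<partial>unif)"
    proof (rule integral_unif_mono)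
      fix u :: real assume u: "0 \<le> u" "u \<le> 1"
      note m = scale_mem[OF y0 y(2) u]
      define p q where "p = y * u" and "q = y * (1 - u)"
      have p: "0 \<le> f p" "f p \<le> \<Gamma>" "0 \<le> g p" "g p \<le> \<Gamma>" "0 \<le> f q" "f q \<le> \<Gamma>" "0 \<le> g q" "g q \<le> \<Gamma>"
        using fb gb m by (auto simp: p_def q_def)
      have hp: "0 \<le> h p" "f p - g p \<le> h p" "0 \<le> h q" "f q - g q \<le> h q" by (auto simp: h_def)
      have "f p * f q - g p * g q = (f p - g p) * f q + g p * (f q - g q)" by (simp add: algebra_simps)
      also have "\<dots> \<le> h p * f q + g p * h q" using hp p by (intro add_mono mult_right_mono mult_left_mono) auto
      also have "\<dots> \<le> h p * \<Gamma> + \<Gamma> * h q" using hp p by (intro add_mono mult_right_mono mult_left_mono) auto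
      finally have 1: "f p * f q - g p * g q \<le> h p * \<Gamma> + \<Gamma> * h q" .
      have "c * ((f p - g p) * indicator {..2} q + (f q - g q) * indicator {..2} p) \<le> c * (h p + h q)"
        using hp c by (intro mult_left_mono add_mono) (auto simp: indicator_def)
      also have "\<dots> \<le> h p + h q" using hp c by (intro mult_left_le_one_le) auto
      finally have "c * ((f p - g p) * indicator {..2} q + (f q - g q) * indicator {..2} p) \<le> h p + h q" .
      moreover have "kak_op c y f u - kak_op c y g u = (f p - g p) + (f q - g q) + (f p * f q - g p * g q) +
          c * ((f p - g p) * indicator {..2} q + (f q - g q) * indicator {..2} p)"
        unfolding kak_op_def p_def[symmetric] q_def[symmetric] by (simp add: algebra_simps)
      ultimately have "kak_op c y f u - kak_op c y g u \<le> (2 + \<Gamma>) * h p + (2 + \<Gamma>) * h q"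
        using 1 hp by (simp add: algebra_simps)
      then show "kak_op c y f u - kak_op c y g u \<le> (2 + \<Gamma>) * h (y * u) + (2 + \<Gamma>) * h (y * (1 - u))"
        by (simp only: p_def q_def)
    qed (use int inth in auto)
    also have "\<dots> = 2 * (2 + \<Gamma>) * (\<integral>u. h (y * u) \<partial>unif)"
      using inth by (simp add: ref)
    finally have "f y - g y \<le> 2 * (2 + \<Gamma>) * (\<integral>u. h (y * u) \<partial>unif)" .
    moreover have "0 \<le> (\<integral>u. h (y * u) \<partial>unif)" by (rule integral_nonneg_AE) (auto simp: h_def)
    ultimately show "h y \<le> (2 * (2 + \<Gamma>)) * (\<integral>u. h (y * u) \<partial>unif)"
      using G by (auto simp: h_def[of y])
  next
    show "h y = 0" if "0 \<le> y" "y \<le> 1" for y using le1[OF that] by (simp add: h_def)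
  qed (use x hb G in \<open>auto simp: h_def\<close>)
  then show ?thesis by (simp add: h_def)
qed

text \<open>\<open>exp (K * S * x)\<close> solves the homogeneous equation \<open>1 + g x = (\<integral>u. (1 + g (x * u)) * (1 + g (x * (1 - u))))\<close>;
  the correction \<open>S * kak_kappa x\<close> has negative average and absorbs the error terms.\<close>

definition kak_kappa :: "real \<Rightarrow> real" where
  "kak_kappa x = (if x \<le> 1 then 160 - 8000 * x else - 3000)"

definition kak_g :: "real \<Rightarrow> real \<Rightarrow> real" where
  "kak_g S x = exp (8000 * S * x) * (1 + S * kak_kappa x) - 1"

lemma measurable_kak_kappa [measurable]: "kak_kappa \<in> borel_measurable borel"
  and measurable_kak_g [measurable]: "kak_g S \<in> borel_measurable borel"
  unfolding kak_g_def kak_kappa_def by measurable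

lemma kak_kappa_le: "0 \<le> x \<Longrightarrow> kak_kappa x \<le> 160" "0 \<le> x \<Longrightarrow> \<bar>kak_kappa x\<bar> \<le> 8000"
  by (auto simp: kak_kappa_def)

text \<open>On [0, 1] the - 8000 x in \<open>kak_kappa\<close> cancels the first order growth of the
  exponential and leaves about 160 S; half of it covers the initial error 80 S, the rest the
  quadratic terms. Above 1 the growth 8000 S outweighs the drop 3000 S.\<close>

lemma kak_g_lower:
  assumes S: "0 \<le> S" "S \<le> 1 / 1000000000000" and x: "0 \<le> x"
  shows "x \<le> 1 \<Longrightarrow> 80 * S \<le> kak_g S x" "0 \<le> kak_g S x"
proof -
  have e: "1 + 8000 * S * y \<le> exp (8000 * S * y)" for y by (rule exp_ge_add_one_self)
  have SS: "S * S \<le> S * (1 / 1000000000000)" using S by (intro mult_left_mono)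
  show le1: "80 * S \<le> kak_g S x" if "x \<le> 1"
  proof -
    have Sx: "0 \<le> S * x" "S * x \<le> S" using S x that by (auto simp: mult_left_le)
    have "(S * x) * (S * x) \<le> S * S" using Sx by (intro mult_mono) auto
    moreover have "0 \<le> S * (S * x)" using S x by simp
    moreover have "(1 + 8000 * S * x) * (1 + S * kak_kappa x) =
        1 + 160 * S + 8000 * 160 * (S * (S * x)) - 8000 * 8000 * ((S * x) * (S * x))"
      using that by (simp add: kak_kappa_def algebra_simps)
    ultimately have "1 + 80 * S \<le> (1 + 8000 * S * x) * (1 + S * kak_kappa x)" using SS S by linarith
    also have "\<dots> \<le> exp (8000 * S * x) * (1 + S * kak_kappa x)"
    proof (rule mult_right_mono[OF e])
      show "0 \<le> 1 + S * kak_kappa x" using that Sx S by (simp add: kak_kappa_def algebra_simps)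
    qed
    finally show ?thesis by (simp add: kak_g_def)
  qed
  show "0 \<le> kak_g S x"
  proof (cases "x \<le> 1")
    case True
    then show ?thesis using le1 S by force
  next
    case False
    have "1 \<le> (1 + 8000 * S) * (1 - 3000 * S)" using S SS by (simp add: algebra_simps)
    also have "\<dots> \<le> exp (8000 * S * x) * (1 - 3000 * S)"
    proof (rule mult_right_mono)
      have "8000 * S * 1 \<le> 8000 * S * x" using False S by (intro mult_left_mono) auto
      then show "1 + 8000 * S \<le> exp (8000 * S * x)" using e[of x] by linarith
    qed (use S in simp)
    finally show ?thesis using False by (simp add: kak_g_def kak_kappa_def mult.commute[of S])
  qed
qed

text \<open>From exp h - 1 <= h exp h. The bound involves x and not y, so it leaves the average over
  the children as a constant.\<close>

lemma kak_g_upper: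
  assumes S: "0 \<le> S" and y: "0 \<le> y" "y \<le> x" and "1 \<le> x"
  shows "kak_g S y \<le> exp (8000 * S * x) * (S * (8000 * x + 160))"
proof -
  have "exp (8000 * S * y) * (1 + S * kak_kappa y) \<le> exp (8000 * S * y) * (1 + S * 160)"
    using S kak_kappa_le(1)[OF y(1)] by (intro mult_left_mono add_mono) auto
  also have "\<dots> \<le> exp (8000 * S * x) * (1 + S * 160)"
    using S y by (intro mult_right_mono) (auto intro!: mult_left_mono)
  finally have 1: "kak_g S y \<le> exp (8000 * S * x) * (1 + S * 160) - 1" by (simp add: kak_g_def)
  have "1 - 8000 * S * x \<le> exp (- (8000 * S * x))" using exp_ge_add_one_self[of "- (8000 * S * x)"] by simp
  then have "exp (8000 * S * x) * (1 - 8000 * S * x) \<le> exp (8000 * S * x) * exp (- (8000 * S * x))"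
    by (intro mult_left_mono) auto
  also have "\<dots> = 1" by (simp add: exp_minus)
  finally show ?thesis using 1 by (simp add: algebra_simps)
qed

lemma kak_g_upper_gt1:
  assumes S: "0 \<le> S" and x: "1 < x"
  shows "kak_g S x \<le> 8000 * S * x * exp (8000 * S * x)"
proof -
  have "exp (8000 * S * x) * (1 + S * kak_kappa x) \<le> exp (8000 * S * x) * 1"
    using S x by (intro mult_left_mono) (auto simp: kak_kappa_def)
  then have 1: "kak_g S x \<le> exp (8000 * S * x) - 1" by (simp add: kak_g_def)
  have "1 - 8000 * S * x \<le> exp (- (8000 * S * x))" using exp_ge_add_one_self[of "- (8000 * S * x)"] by simp
  then have "exp (8000 * S * x) * (1 - 8000 * S * x) \<le> exp (8000 * S * x) * exp (- (8000 * S * x))"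
    by (intro mult_left_mono) auto
  also have "\<dots> = 1" by (simp add: exp_minus)
  finally show ?thesis using 1 by (simp add: algebra_simps)
qed

text \<open>The mean over [0, 1] is 160 - 4000, below the value - 3000 taken beyond. Two children
  thus contribute at most - 6000 against the - 3000 of the parent; the surplus pays for the
  errors.\<close>

lemma integral_kak_kappa:
  assumes x: "x > 1"
  shows "(\<integral>u. kak_kappa (x * u) \<partial>unif) \<le> - 3000"
proof -
  let ?G = "\<lambda>y::real. 160 * min y 1 - 4000 * (min y 1)\<^sup>2 - 3000 * (max y 1 - 1)"
  have "(\<integral>u. kak_kappa (x * u) \<partial>unif) = (?G x - ?G 0) / x"
  proof (rule integral_unif_scale[where S="{1}" and B=8000])
    fix y :: real assume y: "0 < y" "y < x" "y \<notin> {1}"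
    show "(?G has_real_derivative kak_kappa y) (at y)"
    proof (cases "y < 1")
      case True
      show ?thesis
        by (rule has_field_derivative_transform_within_open[of "\<lambda>y. 160 * y - 4000 * y\<^sup>2" _ _ "{..<1}"])
           (use True in \<open>auto intro!: derivative_eq_intros simp: kak_kappa_def\<close>)
    next
      case False
      show ?thesis
        by (rule has_field_derivative_transform_within_open[of "\<lambda>y. 160 - 4000 - 3000 * (y - 1)" _ _ "{1<..}"])
           (use False y in \<open>auto intro!: derivative_eq_intros simp: kak_kappa_def\<close>)
    qed
  qed (use x in \<open>auto intro!: continuous_intros kak_kappa_le\<close>)
  also have "\<dots> \<le> - 3000" using x by (simp add: field_simps)
  finally show ?thesis .
qed

lemma integral_indicator_le_2:
  assumes x: "x > 1"
  shows "(\<integral>u. indicator {..2} (x * u) \<partial>unif) \<le> 2 / x"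
proof -
  let ?G = "\<lambda>y::real. min y 2"
  have "(\<integral>u. indicator {..2} (x * u) \<partial>unif) = (?G x - ?G 0) / x"
  proof (rule integral_unif_scale[where S="{2}" and B=1])
    fix y :: real assume y: "0 < y" "y < x" "y \<notin> {2}"
    show "(?G has_real_derivative indicator {..2} y) (at y)"
    proof (cases "y < 2")
      case True
      show ?thesis
        by (rule has_field_derivative_transform_within_open[of "\<lambda>y. y" _ _ "{..<2}"])
           (use True in \<open>auto intro!: derivative_eq_intros\<close>)
    next
      case False
      show ?thesis
        by (rule has_field_derivative_transform_within_open[of "\<lambda>y. 2" _ _ "{2<..}"])
           (use False y in \<open>auto intro!: derivative_eq_intros\<close>)
    qed
  qed (use x in \<open>auto intro!: continuous_intros simp: indicator_def\<close>)
  also have "\<dots> \<le> 2 / x" using x by (intro divide_right_mono) auto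
  finally show ?thesis .
qed

lemma kak_g_super:
  assumes s: "\<bar>s\<bar> \<le> 1 / 10000" and S_def: "S = \<bar>s\<bar> ^ 3" and x: "1 < x"
  shows "(\<integral>u. kak_op (26 * \<bar>s\<bar>) x (kak_g S) u \<partial>unif) + 700 * S \<le> kak_g S x"
proof -
  have S: "0 \<le> S" "S \<le> 1 / 1000000000000"
  proof -
    have "\<bar>s\<bar> ^ 3 \<le> (1 / 10000) ^ 3" using s by (intro power_mono) auto
    then show "S \<le> 1 / 1000000000000" by (simp add: S_def power_divide)
  qed (simp add: S_def)
  let ?E = "exp (8000 * S * x)"
  let ?k = "\<lambda>u. kak_kappa (x * u)" and ?k' = "\<lambda>u. kak_kappa (x * (1 - u))"
  let ?i = "\<lambda>u. indicator {..2} (x * u) :: real" and ?i' = "\<lambda>u. indicator {..2} (x * (1 - u)) :: real"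
  let ?W = "?E * (S * (8000 * x + 160))"
  have x0: "0 \<le> x" using x by simp
  have kb: "\<bar>?k u\<bar> \<le> 8000" "\<bar>?k' u\<bar> \<le> 8000" if "0 \<le> u" "u \<le> 1" for u
    using scale_mem[OF x0 order_refl that] by (auto intro!: kak_kappa_le)
  have ik: "integrable unif ?k" "integrable unif ?k'"
    by (rule integrable_unif_bounded[of _ 8000]; use kb in simp)+
  have ii: "integrable unif ?i" "integrable unif ?i'"
    by (rule integrable_unif_bounded[of _ 1]; simp add: indicator_def)+
  have W: "0 \<le> ?W" using S x by simp
  have pt: "kak_op (26 * \<bar>s\<bar>) x (kak_g S) u \<le> (?E * (1 + S * S * 64000000) - 1) + ?E * S * ?k u + ?E * S * ?k' u
      + 26 * \<bar>s\<bar> * ?W * ?i' u + 26 * \<bar>s\<bar> * ?W * ?i u" if u: "0 \<le> u" "u \<le> 1" for u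
  proof -
    note m = scale_mem[OF x0 order_refl u]
    have E: "exp (8000 * S * (x * u)) * exp (8000 * S * (x * (1 - u))) = ?E"
      by (simp add: exp_add[symmetric] algebra_simps)
    have "kak_g S (x * u) + kak_g S (x * (1 - u)) + kak_g S (x * u) * kak_g S (x * (1 - u)) =
        (1 + kak_g S (x * u)) * (1 + kak_g S (x * (1 - u))) - 1" by (simp add: algebra_simps)
    also have "\<dots> = (exp (8000 * S * (x * u)) * exp (8000 * S * (x * (1 - u)))) * ((1 + S * ?k u) * (1 + S * ?k' u)) - 1"
      by (simp add: kak_g_def mult_ac)
    also have "\<dots> = ?E * (1 + S * ?k u + S * ?k' u + S * S * (?k u * ?k' u)) - 1"
      unfolding E by (simp add: algebra_simps)
    also have "\<dots> \<le> ?E * (1 + S * ?k u + S * ?k' u + S * S * 64000000) - 1"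
    proof -
      have "\<bar>?k u * ?k' u\<bar> \<le> 8000 * 8000" unfolding abs_mult using kb[OF u] by (intro mult_mono) auto
      then show ?thesis using S by (intro diff_right_mono mult_left_mono add_left_mono) auto
    qed
    finally have 1: "kak_g S (x * u) + kak_g S (x * (1 - u)) + kak_g S (x * u) * kak_g S (x * (1 - u))
        \<le> ?E * (1 + S * ?k u + S * ?k' u + S * S * 64000000) - 1" .
    have "26 * \<bar>s\<bar> * (kak_g S (x * u) * ?i' u + kak_g S (x * (1 - u)) * ?i u) \<le> 26 * \<bar>s\<bar> * (?W * ?i' u + ?W * ?i u)"
      using kak_g_upper[OF S(1) m(1,2)] kak_g_upper[OF S(1) m(3,4)] x
      by (intro mult_left_mono add_mono mult_right_mono) auto
    with 1 show ?thesis unfolding kak_op_def by (simp add: algebra_simps)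
  qed
  have iop: "integrable unif (kak_op (26 * \<bar>s\<bar>) x (kak_g S))"
  proof (rule integrable_kak_op[of _ _ ?W])
    show "\<bar>kak_g S y\<bar> \<le> ?W" if "0 \<le> y" "y \<le> x" for y
      using kak_g_upper[OF S(1) that] kak_g_lower(2)[OF S that(1)] x by simp
  qed (use x s in auto)
  have "(\<integral>u. kak_op (26 * \<bar>s\<bar>) x (kak_g S) u \<partial>unif) \<le>
      (\<integral>u. (?E * (1 + S * S * 64000000) - 1) + ?E * S * ?k u + ?E * S * ?k' u + 26 * \<bar>s\<bar> * ?W * ?i' u + 26 * \<bar>s\<bar> * ?W * ?i u \<partial>unif)"
    using ik ii by (intro integral_unif_mono[OF iop _ pt]) auto
  also have "\<dots> = (?E * (1 + S * S * 64000000) - 1) + ?E * S * (\<integral>u. ?k u \<partial>unif) + ?E * S * (\<integral>u. ?k' u \<partial>unif)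
      + 26 * \<bar>s\<bar> * ?W * (\<integral>u. ?i' u \<partial>unif) + 26 * \<bar>s\<bar> * ?W * (\<integral>u. ?i u \<partial>unif)"
  proof -
    have j: "integrable unif (\<lambda>u. ?E * (1 + S * S * 64000000) - 1)" "integrable unif (\<lambda>u. ?E * S * ?k u)"
      "integrable unif (\<lambda>u. ?E * S * ?k' u)" "integrable unif (\<lambda>u. 26 * \<bar>s\<bar> * ?W * ?i' u)" "integrable unif (\<lambda>u. 26 * \<bar>s\<bar> * ?W * ?i u)"
      using ik ii by (auto simp del: mult_exp_exp)
    show ?thesis
      by (simp only: Bochner_Integration.integral_add Bochner_Integration.integrable_add j integral_mult_right_zero integral_unif_const)
  qed
  also have "(\<integral>u. ?k' u \<partial>unif) = (\<integral>u. ?k u \<partial>unif)"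
    by (rule integral_unif_reflect[where f="?k"]) measurable
  also have "(\<integral>u. ?i' u \<partial>unif) = (\<integral>u. ?i u \<partial>unif)"
    by (rule integral_unif_reflect[where f="?i"]) measurable
  finally have 1: "(\<integral>u. kak_op (26 * \<bar>s\<bar>) x (kak_g S) u \<partial>unif) \<le> (?E * (1 + S * S * 64000000) - 1)
      + 2 * ((?E * S) * (\<integral>u. ?k u \<partial>unif)) + 2 * ((26 * \<bar>s\<bar> * ?W) * (\<integral>u. ?i u \<partial>unif))" by linarith
  have 2: "(?E * S) * (\<integral>u. ?k u \<partial>unif) \<le> (?E * S) * (- 3000)"
    using integral_kak_kappa[OF x] S by (intro mult_left_mono) auto
  have "(26 * \<bar>s\<bar> * ?W) * (\<integral>u. ?i u \<partial>unif) \<le> (26 * \<bar>s\<bar> * ?W) * (2 / x)"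
    using integral_indicator_le_2[OF x] W by (intro mult_left_mono) auto
  \<comment> \<open>The probability 2 / x of a short child cancels the linear growth of
    \<open>?W\<close>; the smallness of s then bounds the product by 50 times
    \<open>?E * S\<close>.\<close>
  also have "\<dots> = \<bar>s\<bar> * (?E * S) * (52 * (8000 + 160 / x))" using x by (simp add: field_simps)
  also have "\<dots> \<le> (1 / 10000) * (?E * S) * (52 * (8000 + 160))"
    using s S x by (intro mult_mono) (auto simp: field_simps)
  finally have 3: "(26 * \<bar>s\<bar> * ?W) * (\<integral>u. ?i u \<partial>unif) \<le> 50 * (?E * S)"
    using S by (simp add: mult_right_mono)
  have "S * S \<le> S * (1 / 1000000000000)" using S by (intro mult_left_mono)
  from mult_left_mono[OF this, of ?E] have "?E * (S * S) \<le> ?E * (S * (1 / 1000000000000))" by simp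
  moreover have "?E * (1 + S * S * 64000000) = ?E + 64000000 * (?E * (S * S))" by (simp add: algebra_simps)
  moreover have 5: "0 \<le> ?E * S" using S by simp
  ultimately have 4: "?E * (1 + S * S * 64000000) \<le> ?E + ?E * S" by linarith
  have "1 * S \<le> ?E * S" using S x by (intro mult_right_mono) auto
  \<comment> \<open>In units of \<open>?E * S\<close>: - 6000 from the correction, 100 from the
    cross terms, 1 from the quadratic terms and 700 from the residual.\<close>
  with 1 2 3 4 5 have "(\<integral>u. kak_op (26 * \<bar>s\<bar>) x (kak_g S) u \<partial>unif) + 700 * S \<le> ?E - 3000 * (?E * S) - 1"
    by linarith
  then show ?thesis using x by (simp add: kak_g_def kak_kappa_def algebra_simps)
qed

section \<open>The error between the normalised solution and its expansion\<close>

lemma norm_kak_theta_le: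
  assumes "norm (\<psi> x) \<le> 1"
  shows "norm (kak_theta s \<psi> x) \<le> exp (x * (kv * s\<^sup>2 / 2))"
proof -
  have "norm (kak_theta s \<psi> x) = exp (x * (kv * s\<^sup>2 / 2)) * norm (\<psi> x)"
    by (simp add: kak_theta_def norm_mult norm_exp)
  also have "\<dots> \<le> exp (x * (kv * s\<^sup>2 / 2)) * 1" using assms by (intro mult_left_mono) auto
  finally show ?thesis by simp
qed

lemma kak_theta_equation:
  assumes "kak_solution w \<psi>" "x > 1"
  shows "kak_theta s \<psi> x = (\<integral>u. kak_theta s \<psi> (x * u) * kak_theta s \<psi> (x * (1 - u)) \<partial>unif)"
proof -
  let ?q = "Complex (kv * s\<^sup>2 / 2) (- 2 * s)"
  have "kak_theta s \<psi> (x * u) * kak_theta s \<psi> (x * (1 - u)) = exp (of_real x * ?q) * (\<psi> (x * u) * \<psi> (x * (1 - u)))" for u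
  proof -
    have "of_real (x * u) * ?q + of_real (x * (1 - u)) * ?q = of_real x * ?q"
      unfolding distrib_right[symmetric] of_real_add[symmetric] by (simp add: algebra_simps)
    then have "exp (of_real (x * u) * ?q) * exp (of_real (x * (1 - u)) * ?q) = exp (of_real x * ?q)"
      by (simp only: exp_add[symmetric])
    then show ?thesis unfolding kak_theta_def by (simp only: mult_ac)
  qed
  then have "(\<integral>u. kak_theta s \<psi> (x * u) * kak_theta s \<psi> (x * (1 - u)) \<partial>unif) =
      exp (of_real x * ?q) * (\<integral>u. \<psi> (x * u) * \<psi> (x * (1 - u)) \<partial>unif)"
    by (simp only: integral_mult_right_zero)
  also have "(\<integral>u. \<psi> (x * u) * \<psi> (x * (1 - u)) \<partial>unif) = \<psi> x"
    using assms unfolding kak_solution_def by metis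
  finally show ?thesis by (simp only: kak_theta_def)
qed

text \<open>\<open>kak_theta\<close> solves the equation exactly and \<open>kak_tau\<close> up to
  700 |s|^3, so their distance is a subsolution for \<open>kak_op\<close> with that source.\<close>

lemma kak_error_sub:
  assumes sol: "kak_solution w \<psi>" and s: "\<bar>s\<bar> \<le> 1" and x: "x > 1"
    and f_def: "f = (\<lambda>x. norm (kak_theta s \<psi> x - kak_tau s x))"
    and bound: "\<And>y. 0 \<le> y \<Longrightarrow> y \<le> x \<Longrightarrow> f y \<le> \<Gamma>" and s26: "26 * \<bar>s\<bar> \<le> 1"
  shows "f x \<le> (\<integral>u. kak_op (26 * \<bar>s\<bar>) x f u \<partial>unif) + 700 * \<bar>s\<bar> ^ 3"
proof -
  have m\<psi>: "\<psi> \<in> borel_measurable borel" and n\<psi>: "\<And>x. norm (\<psi> x) \<le> 1" using sol by (auto simp: kak_solution_def)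
  note [measurable] = measurable_kak_theta[OF m\<psi>, of s]
  have mf [measurable]: "f \<in> borel_measurable borel" unfolding f_def by measurable
  let ?t = "kak_theta s \<psi>" and ?r = "kak_tau s"
  have x0: "0 \<le> x" using x by simp
  let ?B = "exp (x * (kv * s\<^sup>2 / 2))"
  have tb: "norm (?t y) \<le> ?B" if "0 \<le> y" "y \<le> x" for y
  proof -
    have "y * (kv * s\<^sup>2 / 2) \<le> x * (kv * s\<^sup>2 / 2)" using that kv_bounds by (intro mult_right_mono) auto
    then show ?thesis using norm_kak_theta_le[of \<psi> y s, OF n\<psi>] by (meson exp_le_cancel_iff order_trans)
  qed
  have rb: "norm (?r y) \<le> 27" if "0 \<le> y" for y
  proof -
    have "26 * \<bar>s\<bar> * indicator {..2} y \<le> 26" using s by (auto simp: indicator_def)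
    then show ?thesis
      using norm_kak_tau_minus_1[OF s that] norm_triangle_ineq[of "?r y - 1" 1] by simp
  qed
  have it: "integrable unif (\<lambda>u. ?t (x * u) * ?t (x * (1 - u)))"
  proof (rule integrable_unif_bounded[of _ "?B * ?B"])
    show "norm (?t (x * u) * ?t (x * (1 - u))) \<le> ?B * ?B" if "0 \<le> u" "u \<le> 1" for u
      unfolding norm_mult using scale_mem[OF x0 order_refl that] by (intro mult_mono tb) auto
  qed measurable
  have ir: "integrable unif (\<lambda>u. ?r (x * u) * ?r (x * (1 - u)))"
  proof (rule integrable_unif_bounded[of _ "27 * 27"])
    show "norm (?r (x * u) * ?r (x * (1 - u))) \<le> 27 * 27" if "0 \<le> u" "u \<le> 1" for u
      unfolding norm_mult using scale_mem[OF x0 order_refl that] by (intro mult_mono rb) auto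
  qed measurable
  have f0: "0 \<le> f y" for y by (simp add: f_def)
  have iop: "integrable unif (kak_op (26 * \<bar>s\<bar>) x f)"
    by (rule integrable_kak_op[OF mf, of _ \<Gamma>]) (use bound f0 x s26 in auto)
  let ?J = "\<integral>u. ?r (x * u) * ?r (x * (1 - u)) \<partial>unif"
  have "?t x - ?r x = (\<integral>u. ?t (x * u) * ?t (x * (1 - u)) - ?r (x * u) * ?r (x * (1 - u)) \<partial>unif) - (?r x - ?J)"
    using it ir kak_theta_equation[OF sol x, of s] by simp
  then have "f x \<le> norm (\<integral>u. ?t (x * u) * ?t (x * (1 - u)) - ?r (x * u) * ?r (x * (1 - u)) \<partial>unif) + norm (?r x - ?J)"
    unfolding f_def by (simp only: norm_triangle_ineq4)
  moreover have "norm (?r x - ?J) \<le> 700 * \<bar>s\<bar> ^ 3" by (rule kak_tau_equation[OF s x])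
  moreover have "norm (\<integral>u. ?t (x * u) * ?t (x * (1 - u)) - ?r (x * u) * ?r (x * (1 - u)) \<partial>unif) \<le> (\<integral>u. kak_op (26 * \<bar>s\<bar>) x f u \<partial>unif)"
  proof (rule norm_integral_unif_le[OF Bochner_Integration.integrable_diff[OF it ir] iop])
    fix u :: real assume u: "0 \<le> u" "u \<le> 1"
    note m = scale_mem[OF x0 order_refl u]
    define p q where "p = x * u" and "q = x * (1 - u)"
    let ?e = "\<lambda>y. ?t y - ?r y"
    have "?t p * ?t q - ?r p * ?r q = ?e p + ?e q + ?e p * ?e q + (?e p * (?r q - 1) + ?e q * (?r p - 1))"
      by (simp add: algebra_simps)
    also have "norm \<dots> \<le> f p + f q + f p * f q + (f p * norm (?r q - 1) + f q * norm (?r p - 1))"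
      unfolding f_def by (intro order_trans[OF norm_triangle_ineq] add_mono) (auto simp: norm_mult)
    also have "\<dots> \<le> f p + f q + f p * f q + (f p * (26 * \<bar>s\<bar> * indicator {..2} q) + f q * (26 * \<bar>s\<bar> * indicator {..2} p))"
      using m f0 by (intro add_mono mult_left_mono norm_kak_tau_minus_1[OF s] order_refl) (auto simp: p_def q_def)
    also have "\<dots> = kak_op (26 * \<bar>s\<bar>) x f u"
      unfolding kak_op_def p_def[symmetric] q_def[symmetric] by (simp add: algebra_simps)
    finally show "norm (?t (x * u) * ?t (x * (1 - u)) - ?r (x * u) * ?r (x * (1 - u))) \<le> kak_op (26 * \<bar>s\<bar>) x f u"
      by (simp only: p_def q_def)
  qed
  ultimately show ?thesis by linarith
qed

theorem kak_theta_minus_1_le: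
  assumes sol: "kak_solution (cis s) \<psi>" and s: "\<bar>s\<bar> \<le> 1 / 10000" and x: "x > 2"
  shows "norm (kak_theta s \<psi> x - 1) \<le> 8000 * \<bar>s\<bar> ^ 3 * x * exp (8000 * \<bar>s\<bar> ^ 3 * x)"
proof -
  have m\<psi>: "\<psi> \<in> borel_measurable borel" and n\<psi>: "\<And>x. norm (\<psi> x) \<le> 1" and le1: "\<And>x. x \<le> 1 \<Longrightarrow> \<psi> x = cis s"
    using sol by (auto simp: kak_solution_def)
  note [measurable] = measurable_kak_theta[OF m\<psi>, of s]
  define f where "f = (\<lambda>x. norm (kak_theta s \<psi> x - kak_tau s x))"
  define S where "S = \<bar>s\<bar> ^ 3"
  have s1: "\<bar>s\<bar> \<le> 1" and s26: "26 * \<bar>s\<bar> \<le> 1" using s by auto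
  have S: "0 \<le> S" "S \<le> 1 / 1000000000000"
  proof -
    have "\<bar>s\<bar> ^ 3 \<le> (1 / 10000) ^ 3" using s by (intro power_mono) auto
    then show "S \<le> 1 / 1000000000000" by (simp add: S_def power_divide)
  qed (simp add: S_def)
  let ?W = "exp (8000 * S * x) * (S * (8000 * x + 160))"
  \<comment> \<open>A crude common bound on [0, x]; its size is harmless because the comparison
    yields f <= g without any constant.\<close>
  define \<Gamma> where "\<Gamma> = exp (x * (kv * s\<^sup>2 / 2)) + 27 + ?W"
  have W: "0 \<le> ?W" using S x by simp
  have fb: "0 \<le> f y \<and> f y \<le> \<Gamma>" if "0 \<le> y" "y \<le> x" for y
  proof -
    have "y * (kv * s\<^sup>2 / 2) \<le> x * (kv * s\<^sup>2 / 2)" using that kv_bounds by (intro mult_right_mono) auto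
    then have 1: "norm (kak_theta s \<psi> y) \<le> exp (x * (kv * s\<^sup>2 / 2))"
      using norm_kak_theta_le[of \<psi> y s, OF n\<psi>] by (meson exp_le_cancel_iff order_trans)
    have "26 * \<bar>s\<bar> * indicator {..2} y \<le> 26" using s by (auto simp: indicator_def)
    then have 2: "norm (kak_tau s y) \<le> 27"
      using norm_kak_tau_minus_1[OF s1 that(1)] norm_triangle_ineq[of "kak_tau s y - 1" 1] by simp
    show ?thesis using 1 2 W norm_triangle_ineq4[of "kak_theta s \<psi> y" "kak_tau s y"] by (simp add: f_def \<Gamma>_def)
  qed
  have gb: "0 \<le> kak_g S y \<and> kak_g S y \<le> \<Gamma>" if "0 \<le> y" "y \<le> x" for y
  proof -
    have "0 \<le> exp (x * (kv * s\<^sup>2 / 2))" by simp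
    then show ?thesis
      using kak_g_lower(2)[OF S that(1)] kak_g_upper[OF S(1) that] x unfolding \<Gamma>_def by linarith
  qed
  have "f x \<le> kak_g S x"
  proof (rule kak_op_comparison[of f "kak_g S" x \<Gamma> "26 * \<bar>s\<bar>" "700 * S" x])
    show "f y \<le> kak_g S y" if "0 \<le> y" "y \<le> 1" for y
      using kak_theta_minus_tau_le1[of s y \<psi>, OF s1 that le1[OF that(2)]] kak_g_lower(1)[OF S that]
      by (simp add: f_def S_def)
    show "f y \<le> (\<integral>u. kak_op (26 * \<bar>s\<bar>) y f u \<partial>unif) + 700 * S" if "1 < y" "y \<le> x" for y
      unfolding S_def by (rule kak_error_sub[OF sol s1 that(1) f_def _ s26, of \<Gamma>]) (use fb that in auto)
    show "(\<integral>u. kak_op (26 * \<bar>s\<bar>) y (kak_g S) u \<partial>unif) + 700 * S \<le> kak_g S y" if "1 < y" "y \<le> x" for y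
      using kak_g_super[OF s S_def that(1)] .
    show "f \<in> borel_measurable borel" unfolding f_def by measurable
  qed (use fb gb s26 x in auto)
  also have "\<dots> \<le> 8000 * S * x * exp (8000 * S * x)" using x S by (intro kak_g_upper_gt1) auto
  \<comment> \<open>Above 2 \<open>kak_tau\<close> equals 1, so the distance to the expansion is the
    distance to 1.\<close>
  finally show ?thesis
    using x by (simp add: f_def S_def kak_tau_def kak_a_def kak_b_def Complex_eq)
qed

section \<open>The splitting process\<close>

text \<open>The position of the interval that \<open>kak_step\<close> takes with \<open>hd\<close>.
  As a least index defined by comparing lengths, it is accessible to measurability
  arguments.\<close>

definition max_idx :: "(real \<times> real) list \<Rightarrow> nat" where
  "max_idx P = (LEAST j. \<forall>i<length P. ilen (P ! i) \<le> ilen (P ! j))"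

lemma max_idx:
  assumes "P \<noteq> []"
  shows "max_idx P < length P" "ilen (P ! max_idx P) = maxlen P"
    "\<And>i. i < max_idx P \<Longrightarrow> ilen (P ! i) < maxlen P"
proof -
  have "maxlen P \<in> ilen ` set P"
    unfolding maxlen_def using assms by (intro Max_in) auto
  then obtain j where j: "j < length P" "ilen (P ! j) = maxlen P"
    by (auto simp: in_set_conv_nth)
  have le: "ilen (P ! i) \<le> maxlen P" if "i < length P" for i
    unfolding maxlen_def using that by (intro Max_ge) auto
  let ?Q = "\<lambda>j. \<forall>i<length P. ilen (P ! i) \<le> ilen (P ! j)"
  have Qj: "?Q j" using j le by simp
  have "?Q (max_idx P)" unfolding max_idx_def by (rule LeastI[of ?Q, OF Qj])
  have "max_idx P \<le> j" unfolding max_idx_def by (rule Least_le[of ?Q, OF Qj])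
  with j show 1: "max_idx P < length P" by simp
  show eq: "ilen (P ! max_idx P) = maxlen P"
    using \<open>?Q (max_idx P)\<close> j le[OF 1] by force
  show "ilen (P ! i) < maxlen P" if "i < max_idx P" for i
  proof -
    have "\<not> ?Q i" using that unfolding max_idx_def by (rule not_less_Least)
    then obtain k where "k < length P" "ilen (P ! i) < ilen (P ! k)" by force
    with le[of k] show ?thesis by linarith
  qed
qed

lemma kak_step_eq:
  assumes "P \<noteq> []"
  shows "kak_step u P = take (max_idx P) P @ drop (Suc (max_idx P)) P @
    [(fst (P ! max_idx P), fst (P ! max_idx P) + u * ilen (P ! max_idx P)),
     (fst (P ! max_idx P) + u * ilen (P ! max_idx P), snd (P ! max_idx P))]"
proof -
  define m where "m = max_idx P"
  note m = max_idx[OF assms, folded m_def]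
  have P: "P = take m P @ P ! m # drop (Suc m) P" using m(1) by (rule id_take_nth_drop)
  have lt: "ilen J < maxlen P" if "J \<in> set (take m P)" for J
    using that m(1,3) by (auto simp: in_set_conv_nth)
  have "filter (\<lambda>J. ilen J = maxlen P) (take m P) = []"
    using lt by (fastforce simp: filter_empty_conv)
  then have hd: "hd (filter (\<lambda>J. ilen J = maxlen P) P) = P ! m"
    using m(2) by (subst (2) P) simp
  have "P ! m \<notin> set (take m P)" using lt[of "P ! m"] m(2) by auto
  then have rem: "remove1 (P ! m) P = take m P @ drop (Suc m) P"
    by (subst (2) P) (simp add: remove1_append)
  show ?thesis
    unfolding kak_step_def hd Let_def rem m_def[symmetric] by (simp add: ilen_def)
qed

lemma length_kak_partition: "length (kak_partition u n) = Suc n"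
proof (induction n)
  case (Suc n)
  then have "kak_partition u n \<noteq> []" by auto
  from kak_step_eq[OF this] max_idx(1)[OF this] Suc show ?case by simp
qed simp

lemma kak_partition_nonempty [simp]: "kak_partition u n \<noteq> []"
  using length_kak_partition[of u n] by auto

lemma kak_partition_cong:
  "(\<And>i. i < n \<Longrightarrow> u i = u' i) \<Longrightarrow> kak_partition u n = kak_partition u' n"
  by (induction n) auto

lemma kak_M_cong: "(\<And>i. i < n \<Longrightarrow> u i = u' i) \<Longrightarrow> kak_M u n = kak_M u' n"
  unfolding kak_M_def using kak_partition_cong by metis

lemma maxlen_le_iff: "P \<noteq> [] \<Longrightarrow> maxlen P \<le> t \<longleftrightarrow> (\<forall>j<length P. ilen (P ! j) \<le> t)"
  unfolding maxlen_def by (subst Max_le_iff) (auto simp: all_set_conv_all_nth)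

definition iprod :: "(real \<Rightarrow> 'b::comm_monoid_mult) \<Rightarrow> (real \<times> real) list \<Rightarrow> 'b" where
  "iprod f P = prod_list (map (\<lambda>J. f (ilen J)) P)"

definition isum :: "(real \<Rightarrow> 'b::comm_monoid_add) \<Rightarrow> (real \<times> real) list \<Rightarrow> 'b" where
  "isum f P = sum_list (map (\<lambda>J. f (ilen J)) P)"

text \<open>The factor c of the unsplit intervals is the same for all u, so averaging over the
  splitting point touches only the two new factors.\<close>

lemma iprod_step:
  assumes "P \<noteq> []"
  shows "\<exists>c. iprod f P = c * f (maxlen P) \<and>
    (\<forall>u. iprod f (kak_step u P) = c * (f (maxlen P * u) * f (maxlen P * (1 - u))))"
proof (intro exI conjI allI)
  let ?m = "max_idx P"
  note m = max_idx[OF assms]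
  let ?c = "prod_list (map (\<lambda>J. f (ilen J)) (take ?m P)) * prod_list (map (\<lambda>J. f (ilen J)) (drop (Suc ?m) P))"
  have P: "P = take ?m P @ P ! ?m # drop (Suc ?m) P" using m(1) by (rule id_take_nth_drop)
  have "iprod f P = iprod f (take ?m P @ P ! ?m # drop (Suc ?m) P)" using P by simp
  then show "iprod f P = ?c * f (maxlen P)"
    by (simp add: iprod_def m(2) mult_ac)
  show "iprod f (kak_step u P) = ?c * (f (maxlen P * u) * f (maxlen P * (1 - u)))" for u
  proof -
    have 1: "ilen (fst (P ! ?m), fst (P ! ?m) + u * ilen (P ! ?m)) = maxlen P * u"
      using m(2) by (simp add: ilen_def)
    have "ilen (fst (P ! ?m) + u * ilen (P ! ?m), snd (P ! ?m)) = ilen (P ! ?m) - u * ilen (P ! ?m)"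
      by (simp add: ilen_def)
    then have 2: "ilen (fst (P ! ?m) + u * ilen (P ! ?m), snd (P ! ?m)) = maxlen P * (1 - u)"
      unfolding m(2) by (simp add: algebra_simps)
    show ?thesis
      unfolding kak_step_eq[OF assms] iprod_def using 1 2 by (simp add: mult_ac)
  qed
qed

lemma isum_step:
  assumes "P \<noteq> []"
  shows "\<exists>c. isum f P = c + f (maxlen P) \<and>
    (\<forall>u. isum f (kak_step u P) = c + (f (maxlen P * u) + f (maxlen P * (1 - u))))"
proof (intro exI conjI allI)
  let ?m = "max_idx P"
  note m = max_idx[OF assms]
  let ?c = "sum_list (map (\<lambda>J. f (ilen J)) (take ?m P)) + sum_list (map (\<lambda>J. f (ilen J)) (drop (Suc ?m) P))"
  have P: "P = take ?m P @ P ! ?m # drop (Suc ?m) P" using m(1) by (rule id_take_nth_drop)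
  have "isum f P = isum f (take ?m P @ P ! ?m # drop (Suc ?m) P)" using P by simp
  then show "isum f P = ?c + f (maxlen P)"
    by (simp add: isum_def m(2) add_ac)
  show "isum f (kak_step u P) = ?c + (f (maxlen P * u) + f (maxlen P * (1 - u)))" for u
  proof -
    have 1: "ilen (fst (P ! ?m), fst (P ! ?m) + u * ilen (P ! ?m)) = maxlen P * u"
      using m(2) by (simp add: ilen_def)
    have "ilen (fst (P ! ?m) + u * ilen (P ! ?m), snd (P ! ?m)) = ilen (P ! ?m) - u * ilen (P ! ?m)"
      by (simp add: ilen_def)
    then have 2: "ilen (fst (P ! ?m) + u * ilen (P ! ?m), snd (P ! ?m)) = maxlen P * (1 - u)"
      unfolding m(2) by (simp add: algebra_simps)
    show ?thesis
      unfolding kak_step_eq[OF assms] isum_def using 1 2 by (simp add: add_ac)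
  qed
qed

section \<open>Measurability of the process and the stopping rule\<close>

lemma measurable_ilen [measurable]: "ilen \<in> borel_measurable (borel \<Otimes>\<^sub>M borel)"
  unfolding ilen_def by measurable

lemma measurable_kak_partition_nth:
  assumes "\<And>i. i < n \<Longrightarrow> (\<lambda>x. X x i) \<in> borel_measurable M" and "j \<le> n"
  shows "(\<lambda>x. kak_partition (X x) n ! j) \<in> measurable M (borel \<Otimes>\<^sub>M borel)"
  using assms
proof (induction n arbitrary: j)
  case 0
  then show ?case by simp
next
  case (Suc n)
  let ?P = "\<lambda>x. kak_partition (X x) n"
  have IH [measurable]: "(\<lambda>x. ?P x ! i) \<in> measurable M (borel \<Otimes>\<^sub>M borel)" if "i \<le> n" for i
    using Suc that by auto
  \<comment> \<open>The entry at the random position \<open>m' x\<close> is a countable composition,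
    which needs a measurable family over all natural indices; the default (0, 0) fills the
    rest.\<close>
  define Q where "Q i x = (if i \<le> n then ?P x ! i else (0, 0))" for i x
  have Q [measurable]: "Q i \<in> measurable M (borel \<Otimes>\<^sub>M borel)" for i
    unfolding Q_def by (cases "i \<le> n") auto
  define m' where "m' x = (LEAST k. k \<le> n \<and> (\<forall>i\<in>{..n}. ilen (Q i x) \<le> ilen (Q k x)))" for x
  have m'_eq: "m' x = max_idx (?P x)" for x
  proof -
    note mx = max_idx[of "?P x", OF kak_partition_nonempty]
    have le: "ilen (?P x ! i) \<le> maxlen (?P x)" if "i \<le> n" for i
      using that maxlen_le_iff[of "?P x" "maxlen (?P x)"] by (simp add: length_kak_partition)
    show ?thesis unfolding m'_def
    proof (rule Least_equality)
      show "max_idx (?P x) \<le> n \<and> (\<forall>i\<in>{..n}. ilen (Q i x) \<le> ilen (Q (max_idx (?P x)) x))"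
        using mx le by (auto simp: Q_def length_kak_partition)
    next
      fix k assume k: "k \<le> n \<and> (\<forall>i\<in>{..n}. ilen (Q i x) \<le> ilen (Q k x))"
      have "max_idx (?P x) \<le> n" using mx(1) by (simp add: length_kak_partition)
      with k have "maxlen (?P x) \<le> ilen (?P x ! k)" using mx(2) by (force simp: Q_def)
      with mx(3)[of k] show "max_idx (?P x) \<le> k" by force
    qed
  qed
  have m' [measurable]: "m' \<in> measurable M (count_space UNIV)"
    unfolding m'_def by measurable
  have Qm [measurable]: "(\<lambda>x. Q (m' x) x) \<in> measurable M (borel \<Otimes>\<^sub>M borel)"
    by (rule measurable_compose_countable[OF Q m'])
  have X [measurable]: "(\<lambda>x. X x n) \<in> borel_measurable M" using Suc by auto
  have Qm_eq: "Q (m' x) x = ?P x ! max_idx (?P x)" for x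
    using max_idx(1)[of "?P x"] by (simp add: m'_eq Q_def length_kak_partition)
  have nth: "kak_partition (X x) (Suc n) ! j =
     (if j < n then (if j < m' x then Q j x else Q (Suc j) x)
      else if j = n then (fst (Q (m' x) x), fst (Q (m' x) x) + X x n * ilen (Q (m' x) x))
      else (fst (Q (m' x) x) + X x n * ilen (Q (m' x) x), snd (Q (m' x) x)))" for x
  proof -
    have l: "max_idx (?P x) \<le> n" using max_idx(1)[of "?P x"] by (simp add: length_kak_partition)
    then show ?thesis
      unfolding Qm_eq using Suc.prems(2)
      by (auto simp: kak_step_eq m'_eq nth_append length_kak_partition Q_def min_def nth_Cons' le_Suc_eq)
  qed
  show ?case unfolding nth
    by (cases "j < n"; cases "j = n") simp_all
qed


lemma iprod_conv_prod: "iprod f P = (\<Prod>i<length P. f (ilen (P ! i)))"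
  by (simp add: iprod_def prod.list_conv_set_nth atLeast0LessThan)

lemma isum_conv_sum: "isum f P = (\<Sum>i<length P. f (ilen (P ! i)))"
  by (simp add: isum_def sum.list_conv_set_nth atLeast0LessThan)

lemma iprod_eq_power:
  assumes "\<And>l. l \<le> t \<Longrightarrow> f l = w" "P \<noteq> []" "maxlen P \<le> t"
  shows "iprod f P = w ^ length P"
  using assms by (simp add: iprod_conv_prod maxlen_le_iff)

text \<open>For splitting points outside [0, 1] \<open>kak_M\<close> need not decrease. Quantifying
  over all k <= n makes this the exact negation of having reached the threshold by time n, for every
  sequence.\<close>

definition alive :: "(nat \<Rightarrow> real) \<Rightarrow> real \<Rightarrow> nat \<Rightarrow> bool" where
  "alive u t n \<longleftrightarrow> (\<forall>k\<le>n. t < kak_M u k)"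

lemma alive_Suc: "alive u t (Suc n) \<longleftrightarrow> alive u t n \<and> t < kak_M u (Suc n)"
  by (auto simp: alive_def le_Suc_eq)

lemma alive_cong: "(\<And>i. i < n \<Longrightarrow> u i = u' i) \<Longrightarrow> alive u t n = alive u' t n"
  unfolding alive_def using kak_M_cong[of _ u u'] by (metis less_le_trans)

lemma kak_N_Suc:
  assumes "alive u t n" "kak_M u (Suc n) \<le> t"
  shows "kak_N u t = Suc n"
  unfolding kak_N_def using assms
  by (intro Least_equality) (auto simp: alive_def not_less_eq_eq[symmetric] dest: leD)

text \<open>The stopping time property: once the threshold is reached by time n, the first n
  coordinates determine when.\<close>

lemma kak_N_cong:
  assumes "\<not> alive u t n" "\<And>i. i < n \<Longrightarrow> u i = u' i"
  shows "kak_N u t = kak_N u' t"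
proof -
  have M: "kak_M u k = kak_M u' k" if "k \<le> n" for k
    using that assms(2) by (intro kak_M_cong) auto
  obtain k0 where k0: "k0 \<le> n" "kak_M u k0 \<le> t"
    using assms(1) by (force simp: alive_def not_less)
  let ?k = "kak_N u t"
  have 1: "kak_M u ?k \<le> t" unfolding kak_N_def by (rule LeastI[of _ k0]) (rule k0)
  have 2: "?k \<le> n" unfolding kak_N_def using k0 Least_le[of "\<lambda>n. kak_M u n \<le> t" k0] by simp
  have 3: "\<not> kak_M u j \<le> t" if "j < ?k" for j using that unfolding kak_N_def by (rule not_less_Least)
  have "kak_N u' t = ?k" unfolding kak_N_def[of u']
  proof (rule Least_equality)
    show "kak_M u' ?k \<le> t" using 1 2 M by simp
    show "?k \<le> y" if "kak_M u' y \<le> t" for y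
      using that 2 3[of y] M[of y] by (cases "y < ?k") auto
  qed
  then show ?thesis by simp
qed

context
  fixes M :: "'a measure" and X :: "'a \<Rightarrow> nat \<Rightarrow> real"
  assumes X: "\<And>i. (\<lambda>x. X x i) \<in> borel_measurable M"
begin

lemma measurable_ilen_nth: "j \<le> n \<Longrightarrow> (\<lambda>x. ilen (kak_partition (X x) n ! j)) \<in> borel_measurable M"
  using measurable_kak_partition_nth[of n X M j, OF X] by measurable

lemma measurable_iprod:
  fixes f :: "real \<Rightarrow> complex"
  assumes "f \<in> borel_measurable borel"
  shows "(\<lambda>x. iprod f (kak_partition (X x) n)) \<in> borel_measurable M"
  unfolding iprod_conv_prod length_kak_partition
  by (intro borel_measurable_prod measurable_compose[OF measurable_ilen_nth assms]) auto

lemma measurable_isum: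
  fixes f :: "real \<Rightarrow> real"
  assumes "f \<in> borel_measurable borel"
  shows "(\<lambda>x. isum f (kak_partition (X x) n)) \<in> borel_measurable M"
  unfolding isum_conv_sum length_kak_partition
  by (intro borel_measurable_sum measurable_compose[OF measurable_ilen_nth assms]) auto

lemma measurable_kak_M_le: "Measurable.pred M (\<lambda>x. kak_M (X x) n \<le> t)"
proof -
  have [measurable]: "Measurable.pred M (\<lambda>x. ilen (kak_partition (X x) n ! j) \<le> t)" if "j \<le> n" for j
    using measurable_ilen_nth[OF that] by measurable
  have "Measurable.pred M (\<lambda>x. \<forall>j\<in>{..n}. ilen (kak_partition (X x) n ! j) \<le> t)"
    by (rule pred_intros_finite) auto
  then show ?thesis
    by (simp add: kak_M_def maxlen_le_iff length_kak_partition less_Suc_eq_le Ball_def)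
qed

lemma measurable_alive: "Measurable.pred M (\<lambda>x. alive (X x) t n)"
  unfolding alive_def not_le[symmetric] using measurable_kak_M_le by measurable

lemma measurable_kak_N: "(\<lambda>x. kak_N (X x) t) \<in> measurable M (count_space UNIV)"
  unfolding kak_N_def using measurable_kak_M_le by measurable

end

text \<open>Outside \<open>I\<close> the coordinate is constantly \<open>undefined\<close> on the
  extensional space. Thus the facts about the process, which assume all coordinates measurable,
  apply to finite products.\<close>

lemma measurable_PiM_component_any:
  "(\<lambda>u. u i) \<in> borel_measurable (PiM I (\<lambda>_. unif))"
proof (cases "i \<in> I")
  case True
  then have "(\<lambda>u. u i) \<in> measurable (PiM I (\<lambda>_. unif)) unif" by measurable
  then show ?thesis by (simp only: measurable_cong_sets[OF refl sets_unif])
next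
  case False
  then have "(\<lambda>u. u i) \<in> borel_measurable (PiM I (\<lambda>_. unif)) \<longleftrightarrow>
     (\<lambda>u. undefined :: real) \<in> borel_measurable (PiM I (\<lambda>_. unif))"
    by (intro measurable_cong) (auto simp: space_PiM PiE_def extensional_def)
  then show ?thesis by simp
qed

lemmas measurable_PiM_kak =
  measurable_iprod[of "\<lambda>x. x", OF measurable_PiM_component_any]
  measurable_isum[of "\<lambda>x. x", OF measurable_PiM_component_any]
  measurable_alive[of "\<lambda>x. x", OF measurable_PiM_component_any]
  measurable_kak_N[of "\<lambda>x. x", OF measurable_PiM_component_any]


interpretation unif_prod: product_prob_space "\<lambda>_. unif" UNIV
  by unfold_locales

lemma prob_space_PiM_unif: "prob_space (PiM I (\<lambda>_::nat. unif))"
  by (rule prob_space_PiM) (rule prob_space_unif)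

text \<open>The product of \<open>\<psi>\<close> over the current intervals is a martingale until the threshold time, because
  splitting an interval of relative length \<open>x > 1\<close> preserves \<open>\<psi> x\<close> on average.\<close>

lemma integral_stopped_product:
  fixes \<psi> :: "real \<Rightarrow> complex" and w :: complex
  assumes [measurable]: "\<psi> \<in> borel_measurable borel" and bound: "\<And>x. norm (\<psi> x) \<le> 1" and w: "norm w \<le> 1"
    and le1: "\<And>x. x \<le> 1 \<Longrightarrow> \<psi> x = w"
    and gt1: "\<And>x. x > 1 \<Longrightarrow> \<psi> x = (\<integral>u. \<psi> (x * u) * \<psi> (x * (1 - u)) \<partial>unif)"
    and t: "t > 0"
  shows "(\<integral>u. (if alive u t n then iprod (\<lambda>l. \<psi> (l / t)) (kak_partition u n) else w ^ Suc (kak_N u t))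
            \<partial>PiM {..<n} (\<lambda>_. unif)) = \<psi> (1 / t)"
proof (induction n)
  let ?f = "\<lambda>l. \<psi> (l / t)"
  define Z where "Z n u = (if alive u t n then iprod ?f (kak_partition u n) else w ^ Suc (kak_N u t))" for n u
  have f [measurable]: "?f \<in> borel_measurable borel" by measurable
  {
    case 0
    \<comment> \<open>For t >= 1 the process stops at once with a single interval, and w is also the
      value of \<open>\<psi>\<close> at 1 / t <= 1.\<close>
    have "kak_N u t = 0" if "1 \<le> t" for u
      unfolding kak_N_def using that by (intro Least_equality) (auto simp: kak_M_def maxlen_def ilen_def)
    then have "Z 0 u = \<psi> (1 / t)" for u
      using t by (auto simp: Z_def alive_def kak_M_def maxlen_def ilen_def iprod_def le1)
    moreover have "measure (PiM {..<0} (\<lambda>_::nat. unif)) (space (PiM {..<0} (\<lambda>_. unif))) = 1"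
      by (rule prob_space.prob_space[OF prob_space_PiM_unif])
    ultimately show ?case unfolding Z_def[symmetric] by simp
  next
    case (Suc n)
    have mZ: "Z k \<in> borel_measurable (PiM I (\<lambda>_. unif))" for k I
    proof -
      note [measurable] = measurable_PiM_kak(1)[OF f] measurable_PiM_kak(3,4)
      show ?thesis unfolding Z_def by measurable
    qed
    have "norm (Z k u) \<le> 1" for k u
      using w bound unfolding Z_def iprod_conv_prod
      by (auto simp: norm_power norm_mult prod_norm[symmetric] intro!: power_le_one prod_le_1 mult_le_one)
    then have int: "integrable (PiM I (\<lambda>_. unif)) (Z k)" for k I
      by (intro finite_measure.integrable_const_bound[of _ _ 1] mZ)
         (auto intro: prob_space.finite_measure prob_space_PiM_unif)
    have inner: "(\<integral>y. Z (Suc n) (x(n := y)) \<partial>unif) = Z n x" for x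
    proof (cases "alive x t n")
      case False
      then have "\<not> alive (x(n := y)) t n" for y by (subst alive_cong[of n _ x]) auto
      moreover have "kak_N (x(n := y)) t = kak_N x t" for y
        using kak_N_cong[OF False, of "x(n := y)"] by simp
      ultimately have "Z (Suc n) (x(n := y)) = Z n x" for y
        using False by (simp add: Z_def alive_Suc)
      then show ?thesis using unif.prob_space by simp
    next
      case True
      let ?P = "kak_partition x n"
      have P: "kak_partition (x(n := y)) n = ?P" for y by (rule kak_partition_cong) simp
      have al: "alive (x(n := y)) t n" for y using True by (subst alive_cong[of n _ x]) auto
      obtain c where c: "iprod ?f ?P = c * ?f (maxlen ?P)"
        "\<And>u. iprod ?f (kak_step u ?P) = c * (?f (maxlen ?P * u) * ?f (maxlen ?P * (1 - u)))"
        using iprod_step[OF kak_partition_nonempty[of x n], of ?f] by auto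
      have "Z (Suc n) (x(n := y)) = iprod ?f (kak_step y ?P)" for y
      proof (cases "t < kak_M (x(n := y)) (Suc n)")
        case False
        then have "kak_M (x(n := y)) (Suc n) \<le> t" by simp
        \<comment> \<open>If the threshold is reached now, each of the n + 2 intervals contributes
          w, so the stopped value still equals the product.\<close>
        then have "iprod ?f (kak_partition (x(n := y)) (Suc n)) = w ^ Suc (Suc n)"
          using le1 t by (subst iprod_eq_power[of t _ w]) (auto simp: kak_M_def length_kak_partition simp del: kak_partition.simps)
        moreover have "kak_N (x(n := y)) t = Suc n" using al False by (intro kak_N_Suc) auto
        ultimately show ?thesis using False P by (simp add: Z_def alive_Suc)
      qed (use al P in \<open>simp add: Z_def alive_Suc\<close>)
      then have "(\<integral>y. Z (Suc n) (x(n := y)) \<partial>unif) = c * (\<integral>y. ?f (maxlen ?P * y) * ?f (maxlen ?P * (1 - y)) \<partial>unif)"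
        by (simp add: c)
      also have "(\<integral>y. ?f (maxlen ?P * y) * ?f (maxlen ?P * (1 - y)) \<partial>unif) = ?f (maxlen ?P)"
        using gt1[of "maxlen ?P / t"] True t by (simp add: alive_def kak_M_def)
      finally show ?thesis using True c(1) by (simp only: Z_def[of n x] if_True)
    qed
    have "{..<Suc n} = insert n {..<n}" by auto
    then have "(\<integral>u. Z (Suc n) u \<partial>PiM {..<Suc n} (\<lambda>_. unif)) = (\<integral>x. (\<integral>y. Z (Suc n) (x(n := y)) \<partial>unif) \<partial>PiM {..<n} (\<lambda>_. unif))"
      using unif_prod.product_integral_insert[of "{..<n}" n "Z (Suc n)"] int by simp
    then show ?case using Suc unfolding inner Z_def[symmetric] by simp
  }
qed

lemma integral_unif_squares: "(\<integral>u. c + ((l * u)\<^sup>2 + (l * (1 - u))\<^sup>2) \<partial>unif) = c + 2 / 3 * l\<^sup>2"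
  and integrable_unif_squares: "integrable unif (\<lambda>u. c + ((l * u)\<^sup>2 + (l * (1 - u))\<^sup>2))"
proof -
  let ?F = "\<lambda>u. c * u + l\<^sup>2 * u ^ 3 / 3 - l\<^sup>2 * (1 - u) ^ 3 / 3"
  have "((\<lambda>u. c + ((l * u)\<^sup>2 + (l * (1 - u))\<^sup>2)) has_integral (?F 1 - ?F 0)) {0..1}"
    by (intro fundamental_theorem_of_calculus)
       (auto intro!: derivative_eq_intros simp: has_real_derivative_iff_has_vector_derivative[symmetric] power2_eq_square field_simps)
  also have "?F 1 - ?F 0 = c + 2 / 3 * l\<^sup>2" by (simp add: field_simps)
  finally have 1: "((\<lambda>u. c + ((l * u)\<^sup>2 + (l * (1 - u))\<^sup>2)) has_integral (c + 2 / 3 * l\<^sup>2)) {0..1}" .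
  have 2: "\<bar>c + ((l * u)\<^sup>2 + (l * (1 - u))\<^sup>2)\<bar> \<le> \<bar>c\<bar> + 2 * l\<^sup>2" if "0 \<le> u" "u \<le> 1" for u
  proof -
    have "u\<^sup>2 \<le> 1" "(1 - u)\<^sup>2 \<le> 1" using that by (auto intro: power_le_one)
    then have "(l * u)\<^sup>2 \<le> l\<^sup>2" "(l * (1 - u))\<^sup>2 \<le> l\<^sup>2"
      unfolding power_mult_distrib by (auto intro: mult_left_le)
    then show ?thesis
      using zero_le_power2[of "l * u"] zero_le_power2[of "l * (1 - u)"] by linarith
  qed
  show "(\<integral>u. c + ((l * u)\<^sup>2 + (l * (1 - u))\<^sup>2) \<partial>unif) = c + 2 / 3 * l\<^sup>2"
    by (rule integral_unif_has_integral(1)[OF 1 _ 2]) auto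
  show "integrable unif (\<lambda>u. c + ((l * u)\<^sup>2 + (l * (1 - u))\<^sup>2))"
    by (rule integral_unif_has_integral(2)[OF 1 _ 2]) auto
qed

text \<open>Splitting an interval of length \<open>l > t\<close> lowers the expected sum of squares by \<open>l\<^sup>2 / 3 \<ge> t\<^sup>2 / 3\<close>.\<close>

lemma nn_integral_alive_squares:
  assumes t: "t > 0"
  shows "(\<integral>\<^sup>+u. (if alive u t n then ennreal (isum (\<lambda>l. l\<^sup>2) (kak_partition u n) + real n * t\<^sup>2 / 3) else 0)
            \<partial>PiM {..<n} (\<lambda>_. unif)) \<le> 1"
proof (induction n)
  let ?f = "\<lambda>l::real. l\<^sup>2"
  define V where "V n u = (if alive u t n then ennreal (isum ?f (kak_partition u n) + real n * t\<^sup>2 / 3) else 0)" for n u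
  {
    case 0
    have "V 0 u \<le> 1" for u by (auto simp: V_def isum_def ilen_def)
    then have "(\<integral>\<^sup>+u. V 0 u \<partial>PiM {..<0} (\<lambda>_. unif)) \<le> (\<integral>\<^sup>+u. 1 \<partial>PiM {..<0} (\<lambda>_::nat. unif))"
      by (intro nn_integral_mono)
    also have "\<dots> = 1"
      using prob_space.emeasure_space_1[OF prob_space_PiM_unif, of "{..<0}"] by simp
    finally show ?case unfolding V_def .
  next
    case (Suc n)
    have mV: "V k \<in> borel_measurable (PiM I (\<lambda>_. unif))" for k I
    proof -
      note [measurable] = measurable_PiM_kak(2)[of ?f] measurable_PiM_kak(3)
      show ?thesis unfolding V_def by measurable
    qed
    have inner: "(\<integral>\<^sup>+y. V (Suc n) (x(n := y)) \<partial>unif) \<le> V n x" for x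
    proof (cases "alive x t n")
      case False
      then have "\<not> alive (x(n := y)) t n" for y by (subst alive_cong[of n _ x]) auto
      then show ?thesis by (simp add: V_def alive_Suc)
    next
      case True
      let ?P = "kak_partition x n"
      let ?l = "maxlen ?P"
      have P: "kak_partition (x(n := y)) n = ?P" for y by (rule kak_partition_cong) simp
      obtain c where c: "isum ?f ?P = c + ?f ?l"
        "\<And>u. isum ?f (kak_step u ?P) = c + (?f (?l * u) + ?f (?l * (1 - u)))"
        using isum_step[OF kak_partition_nonempty[of x n], of ?f] by auto
      let ?c = "c + real (Suc n) * t\<^sup>2 / 3"
      have nonneg: "0 \<le> isum ?f Q" for Q by (simp add: isum_conv_sum sum_nonneg)
      have "V (Suc n) (x(n := y)) \<le> ennreal (?c + (?f (?l * y) + ?f (?l * (1 - y))))" for y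
        using P c(2)[of y] by (auto simp: V_def intro!: ennreal_leI)
      then have "(\<integral>\<^sup>+y. V (Suc n) (x(n := y)) \<partial>unif) \<le> (\<integral>\<^sup>+y. ennreal (?c + (?f (?l * y) + ?f (?l * (1 - y)))) \<partial>unif)"
        by (intro nn_integral_mono)
      also have "\<dots> = ennreal (\<integral>y. ?c + (?f (?l * y) + ?f (?l * (1 - y))) \<partial>unif)"
      proof (intro nn_integral_eq_integral integrable_unif_squares AE_I2)
        fix y
        have "0 \<le> real (Suc n) * t\<^sup>2 / 3" by simp
        with nonneg[of "kak_step y ?P"] show "0 \<le> ?c + (?f (?l * y) + ?f (?l * (1 - y)))"
          unfolding c(2) by linarith
      qed
      also have "\<dots> = ennreal (?c + 2 / 3 * ?l\<^sup>2)" by (simp only: integral_unif_squares)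
      also have "\<dots> \<le> ennreal (isum ?f ?P + real n * t\<^sup>2 / 3)"
      proof (rule ennreal_leI)
        have "t\<^sup>2 \<le> ?l\<^sup>2" using True t by (intro power_mono) (auto simp: alive_def kak_M_def less_imp_le)
        then show "?c + 2 / 3 * ?l\<^sup>2 \<le> isum ?f ?P + real n * t\<^sup>2 / 3" unfolding c by (simp add: field_simps)
      qed
      finally show ?thesis using True by (simp add: V_def)
    qed
    have "{..<Suc n} = insert n {..<n}" by auto
    then have "(\<integral>\<^sup>+u. V (Suc n) u \<partial>PiM {..<Suc n} (\<lambda>_. unif)) = (\<integral>\<^sup>+x. (\<integral>\<^sup>+y. V (Suc n) (x(n := y)) \<partial>unif) \<partial>PiM {..<n} (\<lambda>_. unif))"
      using unif_prod.product_nn_integral_insert[of "{..<n}" n "V (Suc n)"] mV by simp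
    also have "\<dots> \<le> (\<integral>\<^sup>+x. V n x \<partial>PiM {..<n} (\<lambda>_. unif))" by (intro nn_integral_mono inner)
    also have "\<dots> \<le> 1" using Suc unfolding V_def .
    finally show ?case unfolding V_def .
  }
qed

section \<open>Transfer from product measures to the given random variables\<close>

context
  fixes M :: "'a measure" and U :: "nat \<Rightarrow> 'a \<Rightarrow> real"
  assumes prob: "prob_space M"
    and indep: "prob_space.indep_vars M (\<lambda>_. borel) U UNIV"
    and measU: "\<And>i. U i \<in> borel_measurable M"
    and distrU: "\<And>i. distr M lborel (U i) = unif"
begin

text \<open>The characterisation of independence by product laws is applied to nonempty index sets;
  for n = 0 both sides are the point mass on the empty product.\<close>

lemma distr_restrict_U:
  "distr M (PiM {..<n} (\<lambda>_. borel)) (\<lambda>\<omega>. \<lambda>i\<in>{..<n}. U i \<omega>) = PiM {..<n} (\<lambda>_. unif)"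
proof (cases "n = 0")
  case True
  interpret prob_space M by (rule prob)
  show ?thesis
  proof (rule measure_eqI)
    fix A assume "A \<in> sets (distr M (PiM {..<n} (\<lambda>_. borel)) (\<lambda>\<omega>. \<lambda>i\<in>{..<n}. U i \<omega>))"
    then have "A = {} \<or> A = {\<lambda>_. undefined}" using True by (auto simp: PiM_empty)
    then show "emeasure (distr M (PiM {..<n} (\<lambda>_. borel)) (\<lambda>\<omega>. \<lambda>i\<in>{..<n}. U i \<omega>)) A = emeasure (PiM {..<n} (\<lambda>_. unif)) A"
      using True emeasure_space_1 by (auto simp: PiM_empty emeasure_distr restrict_def)
  qed (use True in \<open>simp add: PiM_empty\<close>)
next
  case False
  interpret prob_space M by (rule prob)
  have "indep_vars (\<lambda>_. borel) U {..<n}" using indep by (rule indep_vars_subset) auto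
  moreover have "distr M borel (U i) = unif" for i
    using distrU[of i] by (metis distr_cong sets_lborel)
  ultimately show ?thesis
    using indep_vars_iff_distr_eq_PiM[of "{..<n}" U "\<lambda>_. borel"] False measU by (auto simp: lessThan_empty_iff)
qed

lemma measurable_restrict_U: "(\<lambda>\<omega>. \<lambda>i\<in>{..<n}. U i \<omega>) \<in> measurable M (PiM {..<n} (\<lambda>_. borel))"
  using measU by (intro measurable_restrict) auto

lemma sets_PiM_unif: "sets (PiM I (\<lambda>_. unif)) = sets (PiM I (\<lambda>_. borel))"
  by (intro sets_PiM_cong) auto

lemma alive_restrict: "alive (\<lambda>i\<in>{..<n}. U i \<omega>) t n = alive (\<lambda>i. U i \<omega>) t n"
  by (rule alive_cong) simp

text \<open>Markov's inequality: on this event the quantity in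
  \<open>nn_integral_alive_squares\<close> is at least n t^2 / 3, while its expectation is at most
  1.\<close>

lemma measure_alive_le:
  assumes t: "t > 0" and n: "n > 0"
  shows "measure M {\<omega> \<in> space M. alive (\<lambda>i. U i \<omega>) t n} \<le> 3 / (t\<^sup>2 * real n)"
proof -
  interpret prob_space M by (rule prob)
  have [measurable]: "Measurable.pred M (\<lambda>\<omega>. alive (\<lambda>i. U i \<omega>) t n)"
    by (rule measurable_alive) (use measU in auto)
  have [measurable]: "Measurable.pred (PiM {..<n} (\<lambda>_. unif)) (\<lambda>u. alive u t n)"
    by (rule measurable_PiM_kak(3))
  have [measurable]: "Measurable.pred (PiM {..<n} (\<lambda>_. borel)) (\<lambda>u. alive u t n)"
    using measurable_PiM_kak(3) by (simp only: measurable_cong_sets[OF sets_PiM_unif refl])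
  let ?c = "real n * t\<^sup>2 / 3"
  let ?A = "{\<omega> \<in> space M. alive (\<lambda>i. U i \<omega>) t n}"
  have "ennreal ?c * emeasure M ?A = (\<integral>\<^sup>+\<omega>. (if alive (\<lambda>i. U i \<omega>) t n then ennreal ?c else 0) \<partial>M)"
    by (subst nn_integral_cmult_indicator[symmetric]) (auto intro!: nn_integral_cong split: split_indicator)
  also have "\<dots> = (\<integral>\<^sup>+\<omega>. (if alive (\<lambda>i\<in>{..<n}. U i \<omega>) t n then ennreal ?c else 0) \<partial>M)"
    by (simp only: alive_restrict)
  also have "\<dots> = (\<integral>\<^sup>+u. (if alive u t n then ennreal ?c else 0) \<partial>PiM {..<n} (\<lambda>_. unif))"
    unfolding distr_restrict_U[symmetric] by (subst nn_integral_distr[OF measurable_restrict_U]) auto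
  also have "\<dots> \<le> (\<integral>\<^sup>+u. (if alive u t n then ennreal (isum (\<lambda>l. l\<^sup>2) (kak_partition u n) + ?c) else 0) \<partial>PiM {..<n} (\<lambda>_. unif))"
    by (intro nn_integral_mono) (auto intro!: ennreal_leI simp: isum_conv_sum sum_nonneg)
  also have "\<dots> \<le> 1" by (rule nn_integral_alive_squares[OF t])
  finally have "ennreal (?c * prob ?A) \<le> ennreal 1"
    using t by (subst ennreal_mult) (auto simp: emeasure_eq_measure simp del: ennreal_mult)
  then have "?c * prob ?A \<le> 1" by (simp only: ennreal_le_iff[OF zero_le_one])
  then show ?thesis using t n by (simp add: field_simps)
qed

text \<open>The stopped product and the power of w have modulus at most 1 and agree once the
  threshold is reached, so their expectations differ by at most twice the probability of
  \<open>alive\<close>, which tends to 0. Sequences that never reach the threshold lie in all these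
  events.\<close>

lemma expectation_power_kak_N:
  fixes \<psi> :: "real \<Rightarrow> complex" and w :: complex
  assumes \<psi> [measurable]: "\<psi> \<in> borel_measurable borel" and bound: "\<And>x. norm (\<psi> x) \<le> 1" and w: "norm w \<le> 1"
    and le1: "\<And>x. x \<le> 1 \<Longrightarrow> \<psi> x = w"
    and gt1: "\<And>x. x > 1 \<Longrightarrow> \<psi> x = (\<integral>u. \<psi> (x * u) * \<psi> (x * (1 - u)) \<partial>unif)"
    and t: "t > 0"
  shows "(\<integral>\<omega>. w ^ Suc (kak_N (\<lambda>i. U i \<omega>) t) \<partial>M) = \<psi> (1 / t)"
proof -
  interpret prob_space M by (rule prob)
  let ?f = "\<lambda>l. \<psi> (l / t)"
  let ?u = "\<lambda>\<omega> i. U i \<omega>"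
  define Z where "Z n u = (if alive u t n then iprod ?f (kak_partition u n) else w ^ Suc (kak_N u t))" for n u
  have f [measurable]: "?f \<in> borel_measurable borel" by measurable
  have mN [measurable]: "(\<lambda>\<omega>. kak_N (?u \<omega>) t) \<in> measurable M (count_space UNIV)"
    by (rule measurable_kak_N) (use measU in auto)
  have mal [measurable]: "Measurable.pred M (\<lambda>\<omega>. alive (?u \<omega>) t n)" for n
    by (rule measurable_alive) (use measU in auto)
  have mi [measurable]: "(\<lambda>\<omega>. iprod ?f (kak_partition (?u \<omega>) n)) \<in> borel_measurable M" for n
    by (rule measurable_iprod) (use measU f in auto)
  have mZ: "Z n \<in> borel_measurable (PiM I (\<lambda>_. borel))" for n I
  proof -
    note [measurable] = measurable_PiM_kak(1)[OF f] measurable_PiM_kak(3,4)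
    have "Z n \<in> borel_measurable (PiM I (\<lambda>_. unif))" unfolding Z_def by measurable
    then show ?thesis by (simp only: measurable_cong_sets[OF sets_PiM_unif refl])
  qed
  have mZM [measurable]: "(\<lambda>\<omega>. Z n (?u \<omega>)) \<in> borel_measurable M" for n
    unfolding Z_def by measurable
  have nZ: "norm (Z n u) \<le> 1" for n u
    using w bound unfolding Z_def iprod_conv_prod
    by (auto simp: norm_power norm_mult prod_norm[symmetric] intro!: power_le_one prod_le_1 mult_le_one)
  have nw: "norm (w ^ k) \<le> 1" for k using w by (simp add: norm_power power_le_one)
  have EZ: "(\<integral>\<omega>. Z n (?u \<omega>) \<partial>M) = \<psi> (1 / t)" for n
  proof -
    have "Z n (?u \<omega>) = Z n (\<lambda>i\<in>{..<n}. U i \<omega>)" for \<omega>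
      using kak_N_cong[of "?u \<omega>" t n "\<lambda>i\<in>{..<n}. U i \<omega>"]
        kak_partition_cong[of n "?u \<omega>" "\<lambda>i\<in>{..<n}. U i \<omega>"]
      by (auto simp: Z_def alive_restrict)
    then have "(\<integral>\<omega>. Z n (?u \<omega>) \<partial>M) = (\<integral>\<omega>. Z n (\<lambda>i\<in>{..<n}. U i \<omega>) \<partial>M)" by simp
    also have "\<dots> = (\<integral>u. Z n u \<partial>PiM {..<n} (\<lambda>_. unif))"
      unfolding distr_restrict_U[symmetric] by (rule integral_distr[OF measurable_restrict_U mZ, symmetric])
    also have "\<dots> = \<psi> (1 / t)"
      unfolding Z_def by (rule integral_stopped_product[OF \<psi> bound w le1 gt1 t])
    finally show ?thesis .
  qed
  let ?w = "\<lambda>\<omega>. w ^ Suc (kak_N (?u \<omega>) t)"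
  have iw: "integrable M ?w" by (rule integrable_const_bound[of _ 1]) (use nw in \<open>auto simp del: power_Suc\<close>)
  have iZ: "integrable M (\<lambda>\<omega>. Z n (?u \<omega>))" for n by (rule integrable_const_bound[of _ 1]) (use nZ in auto)
  have "norm ((\<integral>\<omega>. ?w \<omega> \<partial>M) - \<psi> (1 / t)) \<le> 2 * (3 / (t\<^sup>2 * real n))" if n: "n > 0" for n
  proof -
    have "norm ((\<integral>\<omega>. ?w \<omega> \<partial>M) - \<psi> (1 / t)) = norm (\<integral>\<omega>. ?w \<omega> - Z n (?u \<omega>) \<partial>M)"
      using iw iZ by (subst Bochner_Integration.integral_diff) (auto simp: EZ)
    also have "\<dots> \<le> (\<integral>\<omega>. 2 * indicator {\<omega> \<in> space M. alive (?u \<omega>) t n} \<omega> \<partial>M)"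
    proof (rule norm_integral_le_integral)
      show "norm (?w \<omega> - Z n (?u \<omega>)) \<le> 2 * indicator {\<omega> \<in> space M. alive (?u \<omega>) t n} \<omega>" if "\<omega> \<in> space M" for \<omega>
        using norm_triangle_ineq4[of "?w \<omega>" "Z n (?u \<omega>)"] nw[of "Suc (kak_N (?u \<omega>) t)"] nZ[of n "?u \<omega>"] that
        by (auto simp: Z_def)
    qed (use iw iZ in \<open>auto intro!: integrable_real_indicator simp: emeasure_eq_measure\<close>)
    also have "\<dots> \<le> 2 * (3 / (t\<^sup>2 * real n))"
      using measure_alive_le[OF t n] by simp
    finally show ?thesis .
  qed
  then have ev: "\<forall>\<^sub>F n in sequentially. norm ((\<integral>\<omega>. ?w \<omega> \<partial>M) - \<psi> (1 / t)) \<le> 2 * (3 / (t\<^sup>2 * real n))"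
    by (intro eventually_mono[OF eventually_gt_at_top[of 0]])
  have "(\<lambda>n. 2 * (3 / (t\<^sup>2 * real n))) \<longlonglongrightarrow> 2 * 0"
    using t by (intro tendsto_intros tendsto_divide_0 filterlim_at_top_imp_at_infinity
        filterlim_tendsto_pos_mult_at_top[OF tendsto_const _ filterlim_real_sequentially]) auto
  from tendsto_le[OF _ this tendsto_const ev] show ?thesis by simp
qed

end

section \<open>The Berry--Esseen bound\<close>

lemma Phi_eq_measure: "Phi x = measure std_normal_distribution {..x}"
proof -
  have "emeasure std_normal_distribution {..x} = (\<integral>\<^sup>+y. ennreal (indicator {..x} y * std_normal_density y) \<partial>lborel)"
    by (subst emeasure_density) (auto intro!: nn_integral_cong simp: indicator_def)
  also have "\<dots> = ennreal (\<integral>y. indicator {..x} y * std_normal_density y \<partial>lborel)"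
    using integrable_mult_indicator[of "{..x}" lborel std_normal_density] by (intro nn_integral_eq_integral) auto
  finally show ?thesis
    by (simp add: Phi_def set_lebesgue_integral_def measure_def Bochner_Integration.integral_nonneg)
qed

lemma std_normal_Ioc_le:
  assumes "a \<le> b"
  shows "measure std_normal_distribution {a<..b} \<le> b - a"
proof -
  interpret prob_space std_normal_distribution by (rule prob_space_normal_density) simp
  have le1: "std_normal_density y \<le> 1" for y
  proof -
    have "1 \<le> sqrt (2 * pi)" using pi_gt3 by simp
    then have "1 / sqrt (2 * pi) \<le> 1" by simp
    moreover have "exp (- y\<^sup>2 / 2) \<le> 1" by simp
    ultimately show ?thesis unfolding std_normal_density_def by (intro mult_le_one) auto
  qed
  have "emeasure std_normal_distribution {a<..b} = (\<integral>\<^sup>+y. ennreal (std_normal_density y) * indicator {a<..b} y \<partial>lborel)"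
    by (subst emeasure_density) auto
  also have "\<dots> \<le> (\<integral>\<^sup>+y. indicator {a<..b} y \<partial>lborel)"
    using le1 by (intro nn_integral_mono) (auto simp: indicator_def)
  also have "\<dots> = ennreal (b - a)" using assms by (simp add: nn_integral_indicator)
  finally show ?thesis using assms by (simp add: emeasure_eq_measure)
qed

section \<open>The normal law used for comparison\<close>

context
  fixes \<tau> :: real
  assumes \<tau>: "\<tau> > 0"
begin

abbreviation scaled_normal :: "real measure" where
  "scaled_normal \<equiv> distr std_normal_distribution borel (\<lambda>y. \<tau> * y)"

lemma real_distribution_scaled_normal: "real_distribution scaled_normal"
proof -
  interpret prob_space std_normal_distribution by (rule prob_space_normal_density) simp
  show ?thesis by (rule real_distribution_distr) simp
qed

lemma char_scaled_normal: "char scaled_normal u = of_real (exp (- (\<tau> * u)\<^sup>2 / 2))"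
proof -
  have "char scaled_normal u = char std_normal_distribution (\<tau> * u)"
    unfolding char_def by (subst integral_distr) (auto simp: mult_ac)
  then show ?thesis by (simp add: char_std_normal_distribution)
qed

lemma cdf_scaled_normal: "cdf scaled_normal y = measure std_normal_distribution {..y / \<tau>}"
  unfolding cdf_def using \<tau> by (subst measure_distr) (auto simp: vimage_def field_simps intro!: arg_cong[where f="measure _"])

lemma cdf_scaled_normal_lipschitz:
  assumes "x \<le> y"
  shows "cdf scaled_normal y - cdf scaled_normal x \<le> 1 / \<tau> * (y - x)"
proof (cases "x = y")
  case False
  interpret real_distribution std_normal_distribution by (rule real_dist_normal_dist)
  have lt: "x / \<tau> < y / \<tau>" using assms False \<tau> by (simp add: divide_strict_right_mono)
  have "cdf scaled_normal y - cdf scaled_normal x = measure std_normal_distribution {x / \<tau><..y / \<tau>}"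
    using cdf_diff_eq[OF lt] unfolding cdf_scaled_normal by (simp add: cdf_def)
  also have "\<dots> \<le> y / \<tau> - x / \<tau>" using lt by (intro std_normal_Ioc_le) simp
  finally show ?thesis by (simp add: diff_divide_distrib)
qed simp

text \<open>Up to a factor the integrand is the normal density with deviation 2 / \<tau>. Its
  integral and the Lipschitz constant are both of order 1 / \<tau>, hence of order sqrt t.\<close>

lemma gaussian_integral:
  "integrable lborel (\<lambda>u. 2 * exp (- (\<tau> * u)\<^sup>2 / 8))"
  "(\<integral>u. 2 * exp (- (\<tau> * u)\<^sup>2 / 8) \<partial>lborel) = 4 * sqrt (2 * pi) / \<tau>"
proof -
  let ?c = "4 * sqrt (2 * pi) / \<tau>"
  have eq: "2 * exp (- (\<tau> * u)\<^sup>2 / 8) = ?c * normal_density 0 (2 / \<tau>) u" for u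
  proof -
    have "sqrt (2 * pi * (2 / \<tau>)\<^sup>2) = sqrt (2 * pi) * (2 / \<tau>)" using \<tau> by (simp add: real_sqrt_mult)
    moreover have "- (u - 0)\<^sup>2 / (2 * (2 / \<tau>)\<^sup>2) = - (\<tau> * u)\<^sup>2 / 8"
      using \<tau> by (simp add: power_mult_distrib power_divide field_simps)
    ultimately show ?thesis using \<tau> by (simp add: normal_density_def)
  qed
  have p: "2 / \<tau> > 0" using \<tau> by simp
  show "integrable lborel (\<lambda>u. 2 * exp (- (\<tau> * u)\<^sup>2 / 8))"
    unfolding eq using integrable_normal_density[OF p] by simp
  show "(\<integral>u. 2 * exp (- (\<tau> * u)\<^sup>2 / 8) \<partial>lborel) = ?c"
    unfolding eq using integral_normal_density[OF p] by simp
qed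

end

theorem theorem1p8:
  fixes M :: "'a measure" and U :: "nat \<Rightarrow> 'a \<Rightarrow> real"
  assumes "prob_space M"
    and "prob_space.indep_vars M (\<lambda>_. borel) U UNIV"
    and "\<And>i. U i \<in> borel_measurable M"
    and "\<And>i. distr M lborel (U i) = uniform_measure lborel {0..1}"
  shows "\<exists>C::real. C \<ge> 0 \<and> (\<forall>t::real. t > 0 \<longrightarrow> (\<forall>x::real.
           \<bar>measure M {\<omega> \<in> space M.
               sqrt (2 * t / kak_sigma2) * (real (kak_N (\<lambda>i. U i \<omega>) t) - 2 / t) \<le> x}
            - Phi x\<bar> \<le> C * sqrt t))"
proof -
  interpret prob_space M by fact
  obtain C1 where C1: "smoothing_bound C1" using esseen_smoothing ..
  \<comment> \<open>The scale that turns the cutoff |u| <= 1 into |s| <= s1. It meets the hypothesis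
    of \<open>kak_theta_minus_1_le\<close>, and 8000 * 12 / 100000 < 1 keeps the error exponent
    below \<open>q\<close>.\<close>
  define s1 :: real where "s1 = 1 / 100000"
  \<comment> \<open>The 2 serves t >= 1 / 2, where the trivial bound 1 is at most 2 sqrt t; smaller
    t give y > 2, where the expansion has ended.\<close>
  define C where "C = max 2 (C1 * (4 * sqrt (2 * pi) + 1) / (s1 * sqrt kv))"
  have kv: "kv > 0" using kv_bounds by linarith
  have sigma: "kak_sigma2 = 2 * kv" by (simp add: kak_sigma2_def kv_def)
  have Phi01: "0 \<le> Phi x" "Phi x \<le> 1" for x
    using prob_space.prob_le_1[OF prob_space_normal_density[of 1 0]] by (simp_all add: Phi_eq_measure)
  have "\<bar>measure M {\<omega> \<in> space M. sqrt (2 * t / kak_sigma2) * (real (kak_N (\<lambda>i. U i \<omega>) t) - 2 / t) \<le> x} - Phi x\<bar> \<le> C * sqrt t"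
    if t: "t > 0" for t x
  proof (cases "t < 1 / 2")
    case False
    have "1 / 2 = sqrt (1 / 4)" by (simp add: real_sqrt_divide)
    also have "\<dots> \<le> sqrt t" using False by (intro real_sqrt_le_mono) simp
    finally have "1 \<le> 2 * sqrt t" by simp
    also have "\<dots> \<le> C * sqrt t" using t by (intro mult_right_mono) (auto simp: C_def)
    finally have "1 \<le> C * sqrt t" .
    then show ?thesis using Phi01[of x] measure_nonneg[of M] prob_le_1 by (smt (verit))
  next
    case True
    define N where "N \<omega> = real (kak_N (\<lambda>i. U i \<omega>) t)" for \<omega>
    define y where "y = 1 / t"
    have y: "y > 2" using True t by (simp add: y_def field_simps)
    define \<tau> where "\<tau> = s1 * sqrt (kv * y)"
    have \<tau>: "\<tau> > 0" using kv y by (simp add: \<tau>_def s1_def)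
    have mN0 [measurable]: "(\<lambda>\<omega>. kak_N (\<lambda>i. U i \<omega>) t) \<in> measurable M (count_space UNIV)"
      by (rule measurable_kak_N) (rule assms(3))
    have mN [measurable]: "N \<in> borel_measurable M" unfolding N_def by measurable
    let ?\<mu> = "distr M borel (\<lambda>\<omega>. s1 * (N \<omega> - 2 / t))"
    let ?G = "\<lambda>u. 2 * exp (- (\<tau> * u)\<^sup>2 / 8)"
    have ch: "norm (char ?\<mu> u - char (scaled_normal \<tau>) u) \<le> \<bar>u\<bar> * ?G u" if u: "\<bar>u\<bar> \<le> 1" for u
    proof -
      define s where "s = s1 * u"
      have s: "\<bar>s\<bar> \<le> 1 / 100000" using u by (simp add: s_def s1_def abs_mult)
      obtain \<psi> where sol: "kak_solution (cis s) \<psi>" using kak_solution_exists[of "cis s"] by auto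
      note \<psi> = sol[unfolded kak_solution_def]
      have E: "(\<integral>\<omega>. cis s ^ Suc (kak_N (\<lambda>i. U i \<omega>) t) \<partial>M) = \<psi> y"
        unfolding y_def by (rule expectation_power_kak_N[OF assms]) (use \<psi> t in auto)
      define g where "g = exp (- (kv * s\<^sup>2 * y / 2))"
      have "char ?\<mu> u = (\<integral>\<omega>. iexp (u * (s1 * (N \<omega> - 2 / t))) \<partial>M)"
        unfolding char_def by (subst integral_distr) auto
      also have "\<dots> = (\<integral>\<omega>. iexp (- (s * (1 + 2 * y))) * cis s ^ Suc (kak_N (\<lambda>i. U i \<omega>) t) \<partial>M)"
      proof (rule Bochner_Integration.integral_cong[OF refl])
        fix \<omega>
        have "cis s ^ Suc (kak_N (\<lambda>i. U i \<omega>) t) = iexp ((1 + N \<omega>) * s)"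
          by (simp only: Complex.DeMoivre) (simp add: cis_conv_exp N_def)
        then show "iexp (u * (s1 * (N \<omega> - 2 / t))) = iexp (- (s * (1 + 2 * y))) * cis s ^ Suc (kak_N (\<lambda>i. U i \<omega>) t)"
          by (simp add: exp_add[symmetric] s_def y_def algebra_simps del: power_Suc)
      qed
      also have "\<dots> = iexp (- (s * (1 + 2 * y))) * \<psi> y" by (simp only: integral_mult_right_zero E)
      also have "\<dots> = of_real g * (iexp (- s) * kak_theta s \<psi> y)"
      proof -
        have "iexp (- (s * (1 + 2 * y))) = of_real g * (iexp (- s) * exp (of_real y * Complex (kv * s\<^sup>2 / 2) (- 2 * s)))"
          unfolding g_def exp_of_real[symmetric] exp_add[symmetric]
          by (intro arg_cong[where f=exp]) (simp add: complex_eq_iff algebra_simps)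
        then show ?thesis by (simp add: kak_theta_def mult_ac)
      qed
      finally have 1: "char ?\<mu> u = of_real g * (iexp (- s) * kak_theta s \<psi> y)" .
      have ts: "(\<tau> * u)\<^sup>2 = kv * s\<^sup>2 * y" using kv y by (simp add: \<tau>_def s_def power_mult_distrib mult_ac)
      have 2: "char (scaled_normal \<tau>) u = of_real g" unfolding char_scaled_normal[OF \<tau>] ts g_def by simp
      \<comment> \<open>\<open>iexp (- s)\<close> stems from counting N + 1 intervals while N is
        centred; splitting it off costs |s|, which is affordable.\<close>
      have "char ?\<mu> u - char (scaled_normal \<tau>) u = of_real g * (iexp (- s) * (kak_theta s \<psi> y - 1) + (iexp (- s) - 1))"
        unfolding 1 2 by (simp add: algebra_simps)
      also have "norm \<dots> \<le> g * (norm (kak_theta s \<psi> y - 1) + norm (iexp (- s) - 1))"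
        unfolding norm_mult by (intro mult_mono order_trans[OF norm_triangle_ineq]) (auto simp: norm_mult g_def)
      also have "\<dots> \<le> g * (8000 * \<bar>s\<bar> ^ 3 * y * exp (8000 * \<bar>s\<bar> ^ 3 * y) + \<bar>s\<bar>)"
      proof (intro mult_left_mono add_mono)
        show "norm (kak_theta s \<psi> y - 1) \<le> 8000 * \<bar>s\<bar> ^ 3 * y * exp (8000 * \<bar>s\<bar> ^ 3 * y)"
          using s by (intro kak_theta_minus_1_le[OF sol _ y]) simp
        show "norm (iexp (- s) - 1) \<le> \<bar>s\<bar>" using iexp_approx1[of "- s" 0] by simp
      qed (simp add: g_def)
      also have "\<dots> \<le> 200000 * \<bar>s\<bar> * exp (- (kv * s\<^sup>2 * y / 8))"
      proof -
        \<comment> \<open>The Gaussian factor \<open>g\<close> is exp (- 2 q). The exponential in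
          the error uses up q, the polynomial factor q / 2, and exp (- q / 2) remains as the
          integrable majorant.\<close>
        define q where "q = kv * s\<^sup>2 * y / 4"
        have q0: "0 \<le> q" using kv y by (simp add: q_def)
        have sy: "s\<^sup>2 * y \<le> 12 * q"
        proof -
          have "1 / 3 * (s\<^sup>2 * y) \<le> kv * (s\<^sup>2 * y)" using kv_bounds y by (intro mult_right_mono) auto
          then show ?thesis by (simp add: q_def mult_ac)
        qed
        have s3: "\<bar>s\<bar> ^ 3 * y = \<bar>s\<bar> * (s\<^sup>2 * y)" by (simp add: power3_eq_cube power2_eq_square)
        have "8000 * \<bar>s\<bar> ^ 3 * y = 8000 * \<bar>s\<bar> * (s\<^sup>2 * y)" using s3 by simp
        also have "\<dots> \<le> 8000 * (1 / 100000) * (12 * q)" by (rule mult_mono[OF _ sy]) (use s y in auto)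
        also have "\<dots> \<le> q" using q0 by simp
        finally have e1: "8000 * \<bar>s\<bar> ^ 3 * y \<le> q" .
        have "8000 * \<bar>s\<bar> ^ 3 * y = \<bar>s\<bar> * (8000 * (s\<^sup>2 * y))" using s3 by simp
        also have "\<dots> \<le> \<bar>s\<bar> * (8000 * (12 * q))" using sy by (intro mult_left_mono) auto
        finally have e2: "8000 * \<bar>s\<bar> ^ 3 * y \<le> \<bar>s\<bar> * (96000 * q)" by simp
        have "8000 * \<bar>s\<bar> ^ 3 * y * exp (8000 * \<bar>s\<bar> ^ 3 * y) \<le> \<bar>s\<bar> * (96000 * q) * exp q"
          by (rule mult_mono[OF e2]) (use e1 y q0 in auto)
        moreover have "\<bar>s\<bar> * 1 \<le> \<bar>s\<bar> * exp q" using q0 by (intro mult_left_mono) auto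
        ultimately have "8000 * \<bar>s\<bar> ^ 3 * y * exp (8000 * \<bar>s\<bar> ^ 3 * y) + \<bar>s\<bar> \<le> \<bar>s\<bar> * (96000 * q + 1) * exp q"
          by (simp add: algebra_simps)
        also have "\<dots> \<le> \<bar>s\<bar> * (200000 * exp (q / 2)) * exp q"
        proof (intro mult_right_mono mult_left_mono)
          have "1 + q / 2 \<le> exp (q / 2)" by (rule exp_ge_add_one_self)
          then show "96000 * q + 1 \<le> 200000 * exp (q / 2)" using q0 by linarith
        qed auto
        finally have "g * (8000 * \<bar>s\<bar> ^ 3 * y * exp (8000 * \<bar>s\<bar> ^ 3 * y) + \<bar>s\<bar>) \<le> g * (\<bar>s\<bar> * (200000 * exp (q / 2)) * exp q)"
          by (intro mult_left_mono) (auto simp: g_def)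
        also have "\<dots> = 200000 * \<bar>s\<bar> * (g * exp (q / 2) * exp q)" by simp
        also have "g * exp (q / 2) * exp q = exp (- (kv * s\<^sup>2 * y / 8))"
          unfolding g_def exp_add[symmetric] q_def by (intro arg_cong[where f=exp]) simp
        finally show ?thesis .
      qed
      also have "\<dots> = \<bar>u\<bar> * ?G u"
        unfolding ts by (simp add: s_def s1_def abs_mult)
      finally show ?thesis .
    qed
    have "\<bar>cdf ?\<mu> (\<tau> * x) - cdf (scaled_normal \<tau>) (\<tau> * x)\<bar> \<le> C1 * ((\<integral>u. ?G u \<partial>lborel) + 1 / \<tau>)"
    proof (rule smoothing_boundD[OF C1])
      show "real_distribution ?\<mu>" by (rule real_distribution_distr) measurable
    qed (use \<tau> ch cdf_scaled_normal_lipschitz[OF \<tau>] real_distribution_scaled_normal[OF \<tau>] gaussian_integral(1)[OF \<tau>] in auto)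
    also have "C1 * ((\<integral>u. ?G u \<partial>lborel) + 1 / \<tau>) = C1 * (4 * sqrt (2 * pi) + 1) * (1 / \<tau>)"
      unfolding gaussian_integral(2)[OF \<tau>] by (simp add: algebra_simps)
    also have "1 / \<tau> = sqrt t / (s1 * sqrt kv)"
      by (simp add: \<tau>_def y_def real_sqrt_divide)
    also have "C1 * (4 * sqrt (2 * pi) + 1) * (sqrt t / (s1 * sqrt kv)) = C1 * (4 * sqrt (2 * pi) + 1) / (s1 * sqrt kv) * sqrt t"
      by simp
    also have "\<dots> \<le> C * sqrt t" using t by (intro mult_right_mono) (auto simp: C_def)
    finally have main: "\<bar>cdf ?\<mu> (\<tau> * x) - cdf (scaled_normal \<tau>) (\<tau> * x)\<bar> \<le> C * sqrt t" .
    have "cdf (scaled_normal \<tau>) (\<tau> * x) = Phi x" using \<tau> by (simp add: cdf_scaled_normal Phi_eq_measure)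
    moreover have "cdf ?\<mu> (\<tau> * x) = measure M {\<omega> \<in> space M. sqrt (2 * t / kak_sigma2) * (N \<omega> - 2 / t) \<le> x}"
    proof -
      \<comment> \<open>By \<open>sigma\<close>, 2 t / \<open>kak_sigma2\<close> is t /
        \<open>kv\<close> = 1 / (\<open>kv\<close> y), so this is the definition of \<tau> read
        backwards.\<close>
      have s1r: "s1 * r = \<tau> * (sqrt (2 * t / kak_sigma2) * r)" for r
      proof -
        have "sqrt (kv * y) * sqrt (2 * t / kak_sigma2) = 1"
          unfolding real_sqrt_mult[symmetric] using kv t by (simp add: sigma y_def)
        then show ?thesis by (simp add: \<tau>_def mult.assoc[symmetric])
      qed
      have "s1 * r \<le> \<tau> * x \<longleftrightarrow> sqrt (2 * t / kak_sigma2) * r \<le> x" for r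
        unfolding s1r using \<tau> by simp
      then show ?thesis unfolding cdf_def
        by (subst measure_distr) (auto intro!: arg_cong[where f="measure M"])
    qed
    ultimately show ?thesis using main unfolding N_def by simp
  qed
  moreover have "C \<ge> 0" by (simp add: C_def)
  ultimately show ?thesis by blast
qed

end
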